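(* Let $X_1,\ldots,X_n$ be a stationary, time homogeneous, $\phi$-irreducible, aperiodic Markov chain (not assumed reversible) with Polish state space $\Omega$ and unique stationary distribution $\pi$ (so $X_1\sim\pi$), with pseudo spectral gap $\gamma_{\mathrm{ps}}>0$. Let $f$ be a measurable function in $L^2(\pi)$, $V_f:=\mathrm{Var}_\pi(f)$, and $$\sigma_{\mathrm{as}}^2:=\left\langle \bar f,\left(2(\boldsymbol{I}-(\boldsymbol{P}-\boldsymbol{\pi}))^{-1}-\boldsymbol{I}\right)\bar f\right\rangle_\pi,\qquad \bar f:=f-\mathbb{E}_\pi(f).$$ Then $$\mathrm{Var}_\pi[f(X_1)+\cdots+f(X_n)]\le\frac{4nV_f}{\gamma_{\mathrm{ps}}},$$ $$\left|\mathrm{Var}_\pi[f(X_1)+\cdots+f(X_n)]-n\sigma_{\mathrm{as}}^2\right|\le 16V_f/\gamma_{\mathrm{ps}}^2.$$ More generally, let $f_1,\ldots,f_n$ be functions in $L^2(\pi)$; then $$\mathrm{Var}_\pi[f_1(X_1)+\cdots+f_n(X_n)]\le\frac{4}{\gamma_{\mathrm{ps}}}\sum_{i=1}^n\mathrm{Var}_\pi[f_i(X_i)].$$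
   Context: $\mathbb{E}_\pi$, $\mathrm{Var}_\pi$ refer to the chain started from $X_1\sim\pi$. $L^2(\pi)$ is the Hilbert space of square integrable functions on $\Omega$ with $\langle f,g\rangle_\pi=\int f g^*\,d\pi$; here functions $f, f_i$ whose sums are considered are real valued random observables of the chain. For the Markov kernel $P(x,dy)$, $(\boldsymbol{P}f)(x)=\int f(y)P(x,dy)$, with adjoint $\boldsymbol{P}^*$ on $L^2(\pi)$; $\boldsymbol{I}$ is the identity and $\boldsymbol{\pi}$ is the projection $\boldsymbol{\pi}(f)(x)=\mathbb{E}_\pi(f)$. For a self-adjoint Markov operator $\boldsymbol{Q}$ on (complex) $L^2(\pi)$ with spectrum $S_2\subset\mathbb{R}$, $\gamma(\boldsymbol{Q}):=1-\sup\{\lambda\in S_2:\lambda\ne1\}$ if the eigenvalue $1$ has multiplicity $1$, and $0$ otherwise. The pseudo spectral gap is $\gamma_{\mathrm{ps}}:=\max_{k\ge1}\{\gamma((\boldsymbol{P}^* )^k\boldsymbol{P}^k)/k\}$. $\phi$-irreducible: there is a non-zero $\sigma$-finite measure $\phi$ on $\Omega$ such that for all $A$ with $\phi(A)>0$ and all $x\in\Omega$ there is $n\ge1$ with $P^n(x,A)>0$. Aperiodic: there are no $d\ge2$ and disjoint $\Omega_1,\ldots,\Omega_d\subset\Omega$ with $\pi(\Omega_1)>0$, $P(x,\Omega_{i+1})=1$ for $x\in\Omega_i$ ($i\le d-1$), and $P(x,\Omega_1)=1$ for $x\in\Omega_d$. *)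

theory Defs
  imports "HOL-Probability.Probability"
begin

section \<open>Markov kernels on a Polish space\<close>

definition markov_kernel :: "('a::polish_space \<Rightarrow> 'a measure) \<Rightarrow> bool" where
  "markov_kernel P \<longleftrightarrow> P \<in> borel \<rightarrow>\<^sub>M prob_algebra borel"

primrec kernel_pow :: "('a::polish_space \<Rightarrow> 'a measure) \<Rightarrow> nat \<Rightarrow> 'a \<Rightarrow> 'a measure" where
  "kernel_pow P 0 x = return borel x"
| "kernel_pow P (Suc n) x = bind (kernel_pow P n x) P"

definition stationary_dist :: "('a::polish_space \<Rightarrow> 'a measure) \<Rightarrow> 'a measure \<Rightarrow> bool" where
  "stationary_dist P \<mu> \<longleftrightarrow> prob_space \<mu> \<and> sets \<mu> = sets borel \<and> bind \<mu> P = \<mu>"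

definition phi_irreducible :: "('a::polish_space \<Rightarrow> 'a measure) \<Rightarrow> bool" where
  "phi_irreducible P \<longleftrightarrow>
    (\<exists>\<phi>. sets \<phi> = sets borel \<and> sigma_finite_measure \<phi> \<and> emeasure \<phi> UNIV \<noteq> 0 \<and>
      (\<forall>A\<in>sets borel. emeasure \<phi> A > 0 \<longrightarrow>
        (\<forall>x. \<exists>n\<ge>1. emeasure (kernel_pow P n x) A > 0)))"

definition aperiodic :: "('a::polish_space \<Rightarrow> 'a measure) \<Rightarrow> 'a measure \<Rightarrow> bool" where
  "aperiodic P \<pi> \<longleftrightarrow>
    \<not> (\<exists>d\<ge>2. \<exists>S :: nat \<Rightarrow> 'a set.
        (\<forall>i\<in>{1..d}. S i \<in> sets borel) \<and> disjoint_family_on S {1..d} \<and>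
        measure \<pi> (S 1) > 0 \<and>
        (\<forall>i\<in>{1..d-1}. \<forall>x\<in>S i. measure (P x) (S (i + 1)) = 1) \<and>
        (\<forall>x\<in>S d. measure (P x) (S 1) = 1))"

text \<open>The \<open>\<sigma>\<close>-algebra generated by \<open>X\<^sub>1, \<dots>, X\<^sub>i\<close>.\<close>

definition past_algebra :: "'b measure \<Rightarrow> (nat \<Rightarrow> 'b \<Rightarrow> 'a::polish_space) \<Rightarrow> nat \<Rightarrow> 'b measure" where
  "past_algebra M X i =
    sigma (space M) (\<Union>j\<in>{1..i}. {X j -` A \<inter> space M | A. A \<in> sets borel})"

text \<open>
  \<open>X\<^sub>1, \<dots>, X\<^sub>n\<close> (defined on the probability space \<open>M\<close>) is a time homogeneous Markov chain with
  kernel \<open>P\<close> and initial distribution \<open>\<mu>\<close>. The chain is stationary when \<open>\<mu>\<close> is a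
  stationary distribution of \<open>P\<close>.
\<close>

definition markov_chain ::
  "'b measure \<Rightarrow> nat \<Rightarrow> (nat \<Rightarrow> 'b \<Rightarrow> 'a::polish_space) \<Rightarrow> ('a \<Rightarrow> 'a measure) \<Rightarrow> 'a measure \<Rightarrow> bool"
where
  "markov_chain M n X P \<mu> \<longleftrightarrow>
    prob_space M \<and> markov_kernel P \<and>
    (\<forall>i\<in>{1..n}. X i \<in> M \<rightarrow>\<^sub>M borel) \<and>
    distr M borel (X 1) = \<mu> \<and>
    (\<forall>i\<in>{1..<n}. \<forall>A\<in>sets borel. AE \<omega> in M.
      real_cond_exp M (past_algebra M X i) (indicator (X (i + 1) -` A \<inter> space M)) \<omega>
        = measure (P (X i \<omega>)) A)"

section \<open>The Hilbert space of square integrable functions\<close>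

text \<open>
  Elements of \<open>L\<^sup>2(\<pi>)\<close> are represented by functions, and equality in \<open>L\<^sup>2(\<pi>)\<close> is equality almost
  everywhere. Operators on \<open>L\<^sup>2(\<pi>)\<close> are maps on representatives, and only their action on
  square integrable functions, up to null sets, is meaningful.
\<close>

definition L2 :: "'a measure \<Rightarrow> ('a \<Rightarrow> 'b::{real_normed_vector, second_countable_topology}) set" where
  "L2 \<pi> = {f \<in> borel_measurable \<pi>. integrable \<pi> (\<lambda>x. (norm (f x))\<^sup>2)}"

definition l2_inner :: "'a measure \<Rightarrow> ('a \<Rightarrow> complex) \<Rightarrow> ('a \<Rightarrow> complex) \<Rightarrow> complex" where
  "l2_inner \<pi> f g = (\<integral>x. f x * cnj (g x) \<partial>\<pi>)"

definition l2_norm :: "'a measure \<Rightarrow> ('a \<Rightarrow> complex) \<Rightarrow> real" where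
  "l2_norm \<pi> f = sqrt (\<integral>x. (cmod (f x))\<^sup>2 \<partial>\<pi>)"

type_synonym 'a operator = "('a \<Rightarrow> complex) \<Rightarrow> ('a \<Rightarrow> complex)"

text \<open>Linearity and boundedness together make such a map respect equality almost everywhere.\<close>

definition l2_bounded_operator :: "'a measure \<Rightarrow> 'a operator \<Rightarrow> bool" where
  "l2_bounded_operator \<pi> T \<longleftrightarrow>
    (\<forall>f\<in>L2 \<pi>. T f \<in> L2 \<pi>) \<and>
    (\<forall>f\<in>L2 \<pi>. \<forall>g\<in>L2 \<pi>. AE x in \<pi>. T (\<lambda>y. f y + g y) x = T f x + T g x) \<and>
    (\<forall>c. \<forall>f\<in>L2 \<pi>. AE x in \<pi>. T (\<lambda>y. c * f y) x = c * T f x) \<and>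
    (\<exists>C. \<forall>f\<in>L2 \<pi>. l2_norm \<pi> (T f) \<le> C * l2_norm \<pi> f)"

definition l2_is_inverse :: "'a measure \<Rightarrow> 'a operator \<Rightarrow> 'a operator \<Rightarrow> bool" where
  "l2_is_inverse \<pi> T S \<longleftrightarrow> l2_bounded_operator \<pi> S \<and>
    (\<forall>f\<in>L2 \<pi>. (AE x in \<pi>. T (S f) x = f x) \<and> (AE x in \<pi>. S (T f) x = f x))"

text \<open>Unique up to null sets; meaningful only for invertible \<open>T\<close>.\<close>

definition l2_inverse :: "'a measure \<Rightarrow> 'a operator \<Rightarrow> 'a operator" where
  "l2_inverse \<pi> T = (SOME S. l2_is_inverse \<pi> T S)"

text \<open>The representing vector exists, uniquely up to null sets, for bounded \<open>T\<close> and
  \<open>g \<in> L\<^sup>2(\<pi>)\<close>.\<close>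

definition l2_adjoint :: "'a measure \<Rightarrow> 'a operator \<Rightarrow> 'a operator" where
  "l2_adjoint \<pi> T g =
    (SOME h. h \<in> L2 \<pi> \<and> (\<forall>f\<in>L2 \<pi>. l2_inner \<pi> (T f) g = l2_inner \<pi> f h))"

definition l2_spectrum :: "'a measure \<Rightarrow> 'a operator \<Rightarrow> complex set" where
  "l2_spectrum \<pi> T = {z. \<not> (\<exists>S. l2_is_inverse \<pi> (\<lambda>f x. z * f x - T f x) S)}"

definition l2_eigenspace :: "'a measure \<Rightarrow> 'a operator \<Rightarrow> complex \<Rightarrow> ('a \<Rightarrow> complex) set" where
  "l2_eigenspace \<pi> T z = {f \<in> L2 \<pi>. AE x in \<pi>. T f x = z * f x}"

definition l2_simple_eigenvalue :: "'a measure \<Rightarrow> 'a operator \<Rightarrow> complex \<Rightarrow> bool" where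
  "l2_simple_eigenvalue \<pi> T z \<longleftrightarrow>
    (\<exists>h\<in>l2_eigenspace \<pi> T z. \<not> (AE x in \<pi>. h x = 0) \<and>
      (\<forall>g\<in>l2_eigenspace \<pi> T z. \<exists>c. AE x in \<pi>. g x = c * h x))"

section \<open>Spectral gap and pseudo spectral gap\<close>

text \<open>
  Intended for self-adjoint Markov operators, whose spectrum is real. If the spectrum is
  \<open>{1}\<close> with a simple eigenvalue (then \<open>L\<^sup>2(\<pi>)\<close> is one-dimensional), the supremum is over the
  empty set and is read as \<open>0\<close>.
\<close>

definition spectral_gap :: "'a measure \<Rightarrow> 'a operator \<Rightarrow> real" where
  "spectral_gap \<pi> Q =
    (let S = {t::real. complex_of_real t \<in> l2_spectrum \<pi> Q \<and> t \<noteq> 1} in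
     if l2_simple_eigenvalue \<pi> Q 1 then 1 - (if S = {} then 0 else Sup S) else 0)"

definition markov_op :: "('a \<Rightarrow> 'a measure) \<Rightarrow> 'a operator" where
  "markov_op P f x = (\<integral>y. f y \<partial>(P x))"

definition mean_op :: "'a measure \<Rightarrow> 'a operator" where
  "mean_op \<pi> f x = (\<integral>y. f y \<partial>\<pi>)"

text \<open>The supremum is a maximum, since the gaps lie in \<open>[0, 1]\<close>.\<close>

definition pseudo_spectral_gap :: "('a \<Rightarrow> 'a measure) \<Rightarrow> 'a measure \<Rightarrow> real" where
  "pseudo_spectral_gap P \<pi> =
    (SUP k\<in>{1::nat..}.
      spectral_gap \<pi> ((l2_adjoint \<pi> (markov_op P) ^^ k) \<circ> (markov_op P ^^ k)) / real k)"

section \<open>Asymptotic variance\<close>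

text \<open>
  For real \<open>f\<close> the inner product is real; \<^const>\<open>Re\<close> only adjusts the type.
\<close>

definition asymptotic_variance :: "('a \<Rightarrow> 'a measure) \<Rightarrow> 'a measure \<Rightarrow> ('a \<Rightarrow> real) \<Rightarrow> real" where
  "asymptotic_variance P \<pi> f =
    (let fbar = (\<lambda>x. complex_of_real (f x - (\<integral>y. f y \<partial>\<pi>)));
         R = l2_inverse \<pi> (\<lambda>g x. g x - (markov_op P g x - mean_op \<pi> g x))
     in Re (l2_inner \<pi> fbar (\<lambda>x. 2 * R fbar x - fbar x)))"

end

theory Submission
  imports Defs
begin

text \<open>
  Let \<open>x < \<gamma>\<^sub>p\<^sub>s\<close>. Some \<open>k\<close> satisfies \<open>k x < \<gamma>((P\<^sup>*)\<^sup>k P\<^sup>k)\<close>, and a spectral gap of a positive self-adjoint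
  contraction \<open>Q\<close> bounds its quadratic form on the orthogonal complement of the constants, so
  \<open>P\<^sup>k\<close> contracts centered functions by \<open>sqrt (1 - k x)\<close>. Hence \<open>\<parallel>P\<^sup>n f\<parallel> \<le> c\<^sub>n \<parallel>f\<parallel>\<close> for centered \<open>f\<close>, with
  \<open>\<Sum> c\<^sub>n \<le> 2 / x\<close>. Since \<open>E[f(X\<^sub>i) g(X\<^sub>j)] = \<langle>f, P\<^sup>j\<^sup>-\<^sup>i g\<rangle>\<close> for \<open>i \<le> j\<close>, summing the covariances gives the variance
  bounds with \<open>x\<close> in place of \<open>\<gamma>\<^sub>p\<^sub>s\<close>. For the asymptotic variance, solve the Poisson equation twice:
  with \<open>h = R f\<close> and \<open>g = R h\<close>, \<open>R\<close> the resolvent, the covariance sum telescopes to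
  \<open>n \<sigma>\<^sup>2 - 2 \<langle>f, P g - P\<^sup>n\<^sup>+\<^sup>1 g\<rangle>\<close>, and \<open>\<parallel>g\<parallel> \<le> (2 / x)\<^sup>2 \<parallel>f\<parallel>\<close>. Finally \<open>x\<close> tends to \<open>\<gamma>\<^sub>p\<^sub>s\<close>.

  The bound on the quadratic form avoids the spectral theorem. If no \<open>t\<close> in \<open>(s, 1)\<close> is in the spectrum, then
  \<open>(Q - s)(Q - 1) \<ge> 0\<close>; this forces \<open>\<langle>Q\<^sup>n f, f\<rangle> - \<langle>Q\<^sup>n\<^sup>+\<^sup>1 f, f\<rangle>\<close> to decay like \<open>s\<^sup>n\<close>, and summing this series bounds
  \<open>\<langle>f, f\<rangle>\<close> by \<open>\<langle>f - Q f, f\<rangle> / (1 - s)\<close>.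
\<close>

section \<open>The space of square integrable functions\<close>

text \<open>Operators act on representatives, and inverse and adjoint are choices by
  \<open>SOME\<close>, so these notions carry information only once existence is proved. The adjoint
  of \<open>P\<close> is obtained by Radon-Nikodym. The inverse of \<open>I - (P - \<pi>)\<close> is
  a Neumann series, which needs completeness of \<open>L2\<close>.

  The inequality (Q - s)(Q - 1) \<ge> 0 leaves the spectral point 1 untouched. That point is handled
  by the simplicity of the eigenvalue together with orthogonality to the constants.

  Origin of the constants: since sqrt (1 - k x) \<le> 1 - k x / 2, a block of k steps contributes k
  to a geometric series with sum at most k / (k x / 2) = 2 / x, whatever k is. The 4 of the variance
  bounds is this 2 times the two sides of the diagonal i = j. The 16 is 4 (2 / x)^2 without x: the
  Poisson equation is solved twice, each time at the cost of 2 / x, and two boundary terms occur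
  with factor 2.

  A strict x < \<gamma> serves twice: some k realizes it even if the supremum were not attained, and
  1 - k x stays positive, which the decay argument needs in order to divide by s.\<close>

lemma L2_measurable: "f \<in> L2 M \<Longrightarrow> f \<in> borel_measurable M"
  by (simp add: L2_def)

lemma L2_cmult [simp, intro]:
  fixes f :: "'a \<Rightarrow> 'b::{real_normed_field, second_countable_topology}"
  assumes "f \<in> L2 M" shows "(\<lambda>x. c * f x) \<in> L2 M"
  using assms unfolding L2_def by (auto simp: norm_mult power_mult_distrib)

lemma L2_zero [simp, intro]: "(\<lambda>x. 0) \<in> L2 M"
  by (auto simp: L2_def)

lemma L2_add [simp, intro]:
  fixes f g :: "'a \<Rightarrow> 'b::{real_normed_vector, second_countable_topology}"
  assumes "f \<in> L2 M" "g \<in> L2 M" shows "(\<lambda>x. f x + g x) \<in> L2 M"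
proof -
  have [measurable]: "f \<in> borel_measurable M" "g \<in> borel_measurable M"
    using assms by (auto simp: L2_def)
  have "integrable M (\<lambda>x. 2 * (norm (f x))\<^sup>2 + 2 * (norm (g x))\<^sup>2)"
    using assms by (auto simp: L2_def)
  moreover have "(norm (f x + g x))\<^sup>2 \<le> 2 * (norm (f x))\<^sup>2 + 2 * (norm (g x))\<^sup>2" for x
  proof -
    have "(norm (f x + g x))\<^sup>2 \<le> (norm (f x) + norm (g x))\<^sup>2"
      by (intro power_mono norm_triangle_ineq) auto
    also have "\<dots> \<le> 2 * (norm (f x))\<^sup>2 + 2 * (norm (g x))\<^sup>2"
      by (smt (verit) sum_squares_bound power2_sum)
    finally show ?thesis .
  qed
  ultimately have "integrable M (\<lambda>x. (norm (f x + g x))\<^sup>2)"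
    using Bochner_Integration.integrable_bound[of M "\<lambda>x. 2 * (norm (f x))\<^sup>2 + 2 * (norm (g x))\<^sup>2"
      "\<lambda>x. (norm (f x + g x))\<^sup>2"] by simp
  then show ?thesis by (simp add: L2_def)
qed

lemma L2_uminus [simp, intro]:
  fixes f :: "'a \<Rightarrow> 'b::{real_normed_vector, second_countable_topology}"
  assumes "f \<in> L2 M" shows "(\<lambda>x. - f x) \<in> L2 M"
  using assms unfolding L2_def by auto

lemma L2_diff [simp, intro]:
  fixes f g :: "'a \<Rightarrow> 'b::{real_normed_vector, second_countable_topology}"
  assumes "f \<in> L2 M" "g \<in> L2 M" shows "(\<lambda>x. f x - g x) \<in> L2 M"
  using L2_add[OF assms(1) L2_uminus[OF assms(2)]] by simp

lemma L2_sum [simp, intro]: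
  fixes f :: "'i \<Rightarrow> 'a \<Rightarrow> 'b::{real_normed_vector, second_countable_topology}"
  shows "(\<And>i. i \<in> I \<Longrightarrow> f i \<in> L2 M) \<Longrightarrow> (\<lambda>x. \<Sum>i\<in>I. f i x) \<in> L2 M"
  by (induction I rule: infinite_finite_induct) auto

lemma L2_cmod [simp, intro]: "f \<in> L2 M \<Longrightarrow> (\<lambda>x. complex_of_real (cmod (f x))) \<in> L2 M"
  unfolding L2_def by auto

lemma (in finite_measure) L2_const [simp, intro]: "(\<lambda>x. c) \<in> L2 M"
  by (auto simp: L2_def)

lemma (in finite_measure) L2_integrable:
  fixes f :: "'a \<Rightarrow> 'b::{banach, second_countable_topology}"
  assumes "f \<in> L2 M" shows "integrable M f"
proof (rule Bochner_Integration.integrable_bound)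
  show "integrable M (\<lambda>x. 1 + (norm (f x))\<^sup>2)"
    using assms by (auto simp: L2_def)
  have "t \<le> 1 + t\<^sup>2" for t :: real
    using sum_squares_bound[of t 1] by (simp) (smt (verit) zero_le_power2)
  then show "AE x in M. norm (f x) \<le> norm (1 + (norm (f x))\<^sup>2)"
    by (intro AE_I2) (metis abs_ge_self order_trans real_norm_def)
qed (use assms in \<open>simp add: L2_def\<close>)

section \<open>Inner product, norm and the Cauchy-Schwarz inequality\<close>

lemma borel_measurable_cnj [measurable (raw)]:
  "f \<in> borel_measurable M \<Longrightarrow> (\<lambda>x. cnj (f x)) \<in> borel_measurable M"
  by (rule borel_measurable_continuous_on[OF continuous_on_cnj[OF continuous_on_id]])

lemma L2_integrable_mult:
  assumes "f \<in> L2 M" "g \<in> L2 M" shows "integrable M (\<lambda>x. cmod (f x) * cmod (g x))"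
proof (rule Bochner_Integration.integrable_bound)
  show "integrable M (\<lambda>x. (cmod (f x))\<^sup>2 + (cmod (g x))\<^sup>2)"
    using assms by (auto simp: L2_def)
  have [measurable]: "f \<in> borel_measurable M" "g \<in> borel_measurable M"
    using assms by (auto simp: L2_def)
  show "(\<lambda>x. cmod (f x) * cmod (g x)) \<in> borel_measurable M" by measurable
  have "s * t \<le> s\<^sup>2 + t\<^sup>2" if "s \<ge> 0" "t \<ge> 0" for s t :: real
    using sum_squares_bound[of s t] mult_nonneg_nonneg[OF that] by linarith
  then show "AE x in M. norm (cmod (f x) * cmod (g x)) \<le> norm ((cmod (f x))\<^sup>2 + (cmod (g x))\<^sup>2)"
    by auto
qed

lemma L2_integrable_inner:
  assumes "f \<in> L2 M" "g \<in> L2 M" shows "integrable M (\<lambda>x. f x * cnj (g x))"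
proof (rule Bochner_Integration.integrable_bound[OF L2_integrable_mult[OF assms]])
  have [measurable]: "f \<in> borel_measurable M" "g \<in> borel_measurable M"
    using assms by (auto simp: L2_def)
  show "(\<lambda>x. f x * cnj (g x)) \<in> borel_measurable M" by measurable
qed (simp add: norm_mult)

lemma l2_inner_add_left [simp]:
  "f \<in> L2 M \<Longrightarrow> g \<in> L2 M \<Longrightarrow> h \<in> L2 M \<Longrightarrow>
    l2_inner M (\<lambda>x. f x + g x) h = l2_inner M f h + l2_inner M g h"
  unfolding l2_inner_def by (simp add: distrib_right L2_integrable_inner)

lemma l2_inner_diff_left [simp]:
  "f \<in> L2 M \<Longrightarrow> g \<in> L2 M \<Longrightarrow> h \<in> L2 M \<Longrightarrow>
    l2_inner M (\<lambda>x. f x - g x) h = l2_inner M f h - l2_inner M g h"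
  unfolding l2_inner_def by (simp add: left_diff_distrib L2_integrable_inner)

lemma l2_inner_cmult_left [simp]: "l2_inner M (\<lambda>x. c * f x) h = c * l2_inner M f h"
  unfolding l2_inner_def by (simp add: mult.assoc)

lemma l2_inner_cnj: "cnj (l2_inner M f g) = l2_inner M g f"
  unfolding l2_inner_def by (subst Bochner_Integration.integral_cnj[symmetric]) (simp add: mult.commute)

lemma l2_inner_add_right [simp]:
  "f \<in> L2 M \<Longrightarrow> g \<in> L2 M \<Longrightarrow> h \<in> L2 M \<Longrightarrow>
    l2_inner M h (\<lambda>x. f x + g x) = l2_inner M h f + l2_inner M h g"
  unfolding l2_inner_def by (simp add: distrib_left L2_integrable_inner)

lemma l2_inner_diff_right [simp]:
  "f \<in> L2 M \<Longrightarrow> g \<in> L2 M \<Longrightarrow> h \<in> L2 M \<Longrightarrow>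
    l2_inner M h (\<lambda>x. f x - g x) = l2_inner M h f - l2_inner M h g"
  unfolding l2_inner_def by (simp add: right_diff_distrib L2_integrable_inner)

lemma l2_inner_cmult_right [simp]: "l2_inner M h (\<lambda>x. c * f x) = cnj c * l2_inner M h f"
  by (metis l2_inner_cnj l2_inner_cmult_left complex_cnj_mult)

lemma Re_l2_inner_commute: "Re (l2_inner M f g) = Re (l2_inner M g f)"
  using arg_cong[OF l2_inner_cnj[of M f g], of Re] by simp

lemma l2_inner_cong_AE:
  assumes "AE x in M. f x = f' x" "AE x in M. g x = g' x"
    and "f \<in> L2 M" "f' \<in> L2 M" "g \<in> L2 M" "g' \<in> L2 M"
  shows "l2_inner M f g = l2_inner M f' g'"
proof -
  have [measurable]: "f \<in> borel_measurable M" "g \<in> borel_measurable M"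
     "f' \<in> borel_measurable M" "g' \<in> borel_measurable M"
    using assms by (auto simp: L2_def)
  show ?thesis unfolding l2_inner_def
    by (rule integral_cong_AE) (use assms(1,2) in auto)
qed

lemma l2_norm_nonneg [simp]: "0 \<le> l2_norm M f"
  by (simp add: l2_norm_def)

lemma l2_norm_power2: "(l2_norm M f)\<^sup>2 = (\<integral>x. (cmod (f x))\<^sup>2 \<partial>M)"
  by (simp add: l2_norm_def)

lemma l2_inner_self: "l2_inner M f f = complex_of_real ((l2_norm M f)\<^sup>2)"
  unfolding l2_norm_power2 l2_inner_def
  by (simp add: complex_norm_square[symmetric] flip: of_real_power)

lemma Re_l2_inner_self: "Re (l2_inner M f f) = (l2_norm M f)\<^sup>2"
  by (simp add: l2_inner_self)

lemma l2_norm_cong_AE: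
  assumes "AE x in M. f x = g x" "f \<in> L2 M" "g \<in> L2 M" shows "l2_norm M f = l2_norm M g"
  using l2_inner_cong_AE[OF assms(1,1,2,3,2,3)] l2_norm_nonneg
  by (metis Re_l2_inner_self power2_eq_iff_nonneg)

lemma l2_norm_eq_0_iff: "f \<in> L2 M \<Longrightarrow> l2_norm M f = 0 \<longleftrightarrow> (AE x in M. f x = 0)"
  by (simp add: l2_norm_def integral_nonneg_eq_0_iff_AE L2_def)

lemma l2_norm_diff_eq_0_iff:
  "f \<in> L2 M \<Longrightarrow> g \<in> L2 M \<Longrightarrow> l2_norm M (\<lambda>x. f x - g x) = 0 \<longleftrightarrow> (AE x in M. f x = g x)"
  by (simp add: l2_norm_eq_0_iff)

lemma l2_norm_cmult [simp]: "l2_norm M (\<lambda>x. c * f x) = cmod c * l2_norm M f"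
  by (simp add: l2_norm_def norm_mult power_mult_distrib real_sqrt_mult)

lemma l2_norm_cmod: "l2_norm M (\<lambda>x. complex_of_real (cmod (f x))) = l2_norm M f"
  by (simp add: l2_norm_def)

lemma l2_norm_diff_commute: "l2_norm M (\<lambda>x. f x - g x) = l2_norm M (\<lambda>x. g x - f x)"
  by (simp add: l2_norm_def norm_minus_commute)

lemma l2_norm_zero [simp]: "l2_norm M (\<lambda>x. 0) = 0"
  by (simp add: l2_norm_def)

text \<open>Weighted arithmetic-geometric mean inequality under the integral. With a and b the two
  norms, the weights b / (2 a) and a / (2 b) make each square contribute a b / 2. Vanishing norms
  are treated apart because the weights divide by them.\<close>

lemma l2_Cauchy_Schwarz:
  assumes f: "f \<in> L2 M" and g: "g \<in> L2 M"
  shows "cmod (l2_inner M f g) \<le> l2_norm M f * l2_norm M g"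
proof (cases "l2_norm M f = 0 \<or> l2_norm M g = 0")
  case True
  then have "l2_inner M f g = 0"
  proof
    assume "l2_norm M f = 0"
    then have "AE x in M. f x = 0" using f by (simp add: l2_norm_eq_0_iff)
    then have "l2_inner M f g = l2_inner M (\<lambda>x. 0) g" using f g by (intro l2_inner_cong_AE) auto
    then show ?thesis by (simp add: l2_inner_def)
  next
    assume "l2_norm M g = 0"
    then have "AE x in M. g x = 0" using g by (simp add: l2_norm_eq_0_iff)
    then have "l2_inner M f g = l2_inner M f (\<lambda>x. 0)" using f g by (intro l2_inner_cong_AE) auto
    then show ?thesis by (simp add: l2_inner_def)
  qed
  then show ?thesis by (simp add: mult_nonneg_nonneg)
next
  case False
  define a b where "a = l2_norm M f" and "b = l2_norm M g"
  have ab: "a > 0" "b > 0" using False by (simp_all add: a_def b_def less_le)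
  have "cmod (l2_inner M f g) \<le> (\<integral>x. cmod (f x) * cmod (g x) \<partial>M)"
    unfolding l2_inner_def by (rule order_trans[OF integral_norm_bound]) (simp add: norm_mult)
  also have "\<dots> \<le> (\<integral>x. (b / (2 * a)) * (cmod (f x))\<^sup>2 + (a / (2 * b)) * (cmod (g x))\<^sup>2 \<partial>M)"
  proof (rule integral_mono)
    show "integrable M (\<lambda>x. cmod (f x) * cmod (g x))" using L2_integrable_mult[OF f g] .
    show "integrable M (\<lambda>x. (b / (2 * a)) * (cmod (f x))\<^sup>2 + (a / (2 * b)) * (cmod (g x))\<^sup>2)"
      using f g by (auto simp: L2_def)
    fix x
    define s t where "s = cmod (f x)" and "t = cmod (g x)"
    have "0 \<le> (b * s - a * t)\<^sup>2 / (2 * a * b)" using ab by simp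
    also have "\<dots> = (b / (2 * a)) * s\<^sup>2 + (a / (2 * b)) * t\<^sup>2 - s * t"
      using ab by (simp add: field_simps power2_eq_square)
    finally show "s * t \<le> (b / (2 * a)) * s\<^sup>2 + (a / (2 * b)) * t\<^sup>2" by simp
  qed
  also have "\<dots> = (b / (2 * a)) * a\<^sup>2 + (a / (2 * b)) * b\<^sup>2"
    unfolding a_def b_def l2_norm_power2 using f g by (subst Bochner_Integration.integral_add) (auto simp: L2_def)
  also have "\<dots> = a * b" using ab by (simp add: power2_eq_square)
  finally show ?thesis by (simp add: a_def b_def)
qed

lemma l2_norm_add_power2:
  assumes "f \<in> L2 M" "g \<in> L2 M"
  shows "(l2_norm M (\<lambda>x. f x + g x))\<^sup>2
    = (l2_norm M f)\<^sup>2 + 2 * Re (l2_inner M f g) + (l2_norm M g)\<^sup>2"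
  using assms by (simp add: Re_l2_inner_self[symmetric] Re_l2_inner_commute[of M g f])

lemma l2_norm_diff_power2:
  assumes "f \<in> L2 M" "g \<in> L2 M"
  shows "(l2_norm M (\<lambda>x. f x - g x))\<^sup>2
    = (l2_norm M f)\<^sup>2 - 2 * Re (l2_inner M f g) + (l2_norm M g)\<^sup>2"
  using assms by (simp add: Re_l2_inner_self[symmetric] Re_l2_inner_commute[of M g f])

lemma l2_norm_triangle:
  assumes "f \<in> L2 M" "g \<in> L2 M"
  shows "l2_norm M (\<lambda>x. f x + g x) \<le> l2_norm M f + l2_norm M g"
proof (rule power2_le_imp_le)
  have "Re (l2_inner M f g) \<le> l2_norm M f * l2_norm M g"
    using l2_Cauchy_Schwarz[OF assms] complex_Re_le_cmod order_trans by blast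
  then show "(l2_norm M (\<lambda>x. f x + g x))\<^sup>2 \<le> (l2_norm M f + l2_norm M g)\<^sup>2"
    using assms by (simp add: l2_norm_add_power2 power2_sum)
qed simp

lemma l2_norm_triangle_sub:
  assumes "f \<in> L2 M" "g \<in> L2 M" "h \<in> L2 M"
  shows "l2_norm M (\<lambda>x. f x - h x) \<le> l2_norm M (\<lambda>x. f x - g x) + l2_norm M (\<lambda>x. g x - h x)"
  using l2_norm_triangle[of "\<lambda>x. f x - g x" M "\<lambda>x. g x - h x"] assms by simp

lemma l2_norm_sum:
  "(\<And>i. i \<in> I \<Longrightarrow> f i \<in> L2 M) \<Longrightarrow> l2_norm M (\<lambda>x. \<Sum>i\<in>I. f i x) \<le> (\<Sum>i\<in>I. l2_norm M (f i))"
proof (induction I rule: infinite_finite_induct)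
  case (insert i I)
  then show ?case using l2_norm_triangle[of "f i" M "\<lambda>x. \<Sum>i\<in>I. f i x"] by fastforce
qed auto

lemma nn_integral_l2_norm:
  "f \<in> L2 M \<Longrightarrow> (\<integral>\<^sup>+x. ennreal ((cmod (f x))\<^sup>2) \<partial>M) = ennreal ((l2_norm M f)\<^sup>2)"
  unfolding l2_norm_power2 by (rule nn_integral_eq_integral) (auto simp: L2_def)

section \<open>Completeness\<close>

lemma L2_bound_nn_integral:
  assumes [measurable]: "f \<in> borel_measurable M"
    and "(\<integral>\<^sup>+x. ennreal ((cmod (f x))\<^sup>2) \<partial>M) \<le> ennreal (c\<^sup>2)" "c \<ge> 0"
  shows "f \<in> L2 M" "l2_norm M f \<le> c"
proof -
  have "integrable M (\<lambda>x. (cmod (f x))\<^sup>2)"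
    by (rule integrableI_bounded) (use assms(2) in \<open>auto simp: less_top[symmetric] top_unique\<close>)
  then show f: "f \<in> L2 M" by (simp add: L2_def)
  have "(l2_norm M f)\<^sup>2 \<le> c\<^sup>2" using assms(2) by (simp add: nn_integral_l2_norm[OF f])
  then show "l2_norm M f \<le> c" using assms(3) by (rule power2_le_imp_le)
qed

text \<open>Riesz-Fischer in series form. By the triangle inequality and monotone convergence the
  sum of the moduli has a finite square integral, so the series converges absolutely almost
  everywhere. Fatou's lemma then bounds the norm of every tail of the pointwise sum.\<close>

lemma L2_summable:
  fixes g :: "nat \<Rightarrow> 'a \<Rightarrow> complex"
  assumes g: "\<And>n. g n \<in> L2 M" and sm: "summable (\<lambda>n. l2_norm M (g n))"
  shows "\<exists>G\<in>L2 M. (\<lambda>N. l2_norm M (\<lambda>x. G x - (\<Sum>n<N. g n x))) \<longlonglongrightarrow> 0"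
proof -
  have [measurable]: "g n \<in> borel_measurable M" for n using g[of n] by (simp add: L2_def)
  define C where "C = (\<Sum>n. l2_norm M (g n))"
  have C0: "C \<ge> 0" unfolding C_def by (intro suminf_nonneg sm) simp
  have part: "l2_norm M (\<lambda>x. \<Sum>n<N. complex_of_real (cmod (g n x))) \<le> C" for N
  proof -
    have "l2_norm M (\<lambda>x. \<Sum>n<N. complex_of_real (cmod (g n x)))
        \<le> (\<Sum>n<N. l2_norm M (\<lambda>x. complex_of_real (cmod (g n x))))"
      by (intro l2_norm_sum L2_cmod g)
    also have "\<dots> \<le> C" unfolding l2_norm_cmod C_def by (intro sum_le_suminf sm) auto
    finally show ?thesis .
  qed
  have sumc: "cmod (\<Sum>n<N. complex_of_real (cmod (g n x))) = (\<Sum>n<N. cmod (g n x))" for N x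
    by (simp flip: of_real_sum add: sum_nonneg)
  have "(\<integral>\<^sup>+x. (SUP N. ennreal ((\<Sum>n<N. cmod (g n x))\<^sup>2)) \<partial>M)
     = (SUP N. \<integral>\<^sup>+x. ennreal ((\<Sum>n<N. cmod (g n x))\<^sup>2) \<partial>M)"
    by (intro nn_integral_monotone_convergence_SUP)
      (auto simp: incseq_def le_fun_def intro!: ennreal_leI power_mono sum_mono2 sum_nonneg)
  also have "\<dots> \<le> ennreal (C\<^sup>2)"
  proof (rule SUP_least)
    fix N
    have "(\<integral>\<^sup>+x. ennreal ((\<Sum>n<N. cmod (g n x))\<^sup>2) \<partial>M)
       = ennreal ((l2_norm M (\<lambda>x. \<Sum>n<N. complex_of_real (cmod (g n x))))\<^sup>2)"
      by (subst nn_integral_l2_norm[symmetric]) (use g in \<open>auto simp only: sumc intro!: L2_sum L2_cmod\<close>)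
    also have "\<dots> \<le> ennreal (C\<^sup>2)" by (intro ennreal_leI power_mono part) simp
    finally show "(\<integral>\<^sup>+x. ennreal ((\<Sum>n<N. cmod (g n x))\<^sup>2) \<partial>M) \<le> ennreal (C\<^sup>2)" .
  qed
  finally have "AE x in M. (SUP N. ennreal ((\<Sum>n<N. cmod (g n x))\<^sup>2)) \<noteq> \<infinity>"
    by (intro nn_integral_PInf_AE) (auto simp: top_unique)
  then have ae: "AE x in M. summable (\<lambda>n. g n x)"
  proof eventually_elim
    case (elim x)
    define B where "B = enn2real (SUP N. ennreal ((\<Sum>n<N. cmod (g n x))\<^sup>2))"
    have "(\<Sum>n<N. cmod (g n x)) \<le> sqrt B" for N
    proof -
      have "ennreal ((\<Sum>n<N. cmod (g n x))\<^sup>2) \<le> ennreal B"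
        unfolding B_def using elim by (subst ennreal_enn2real) (auto simp only: less_top infinity_ennreal_def intro!: SUP_upper)
      then have "(\<Sum>n<N. cmod (g n x))\<^sup>2 \<le> B" by (simp add: B_def)
      then show ?thesis by (simp add: real_le_rsqrt)
    qed
    then have "summable (\<lambda>n. cmod (g n x))" by (intro summableI_nonneg_bounded) auto
    then show ?case by (rule summable_norm_cancel)
  qed
  \<comment> \<open>On the null set where the series diverges, \<open>suminf\<close> has an
    unspecified value; measurability holds regardless.\<close>
  define G where "G = (\<lambda>x. \<Sum>n. g n x)"
  have [measurable]: "G \<in> borel_measurable M" unfolding G_def by measurable
  define r where "r = (\<lambda>N. \<Sum>n. l2_norm M (g (n + N)))"
  have smN: "summable (\<lambda>n. l2_norm M (g (n + N)))" for N using summable_ignore_initial_segment[OF sm] .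
  have r0: "r N \<ge> 0" for N unfolding r_def by (intro suminf_nonneg smN) simp
  have tail: "(\<integral>\<^sup>+x. ennreal ((cmod (G x - (\<Sum>n<N. g n x)))\<^sup>2) \<partial>M) \<le> ennreal ((r N)\<^sup>2)" for N
  proof -
    \<comment> \<open>The tail is the pointwise limit of the blocks
      \<open>g N + ... + g (N + m - 1)\<close>, each of norm at most \<open>r N\<close>, so Fatou's
      lemma applies.\<close>
    have "(\<integral>\<^sup>+x. ennreal ((cmod (G x - (\<Sum>n<N. g n x)))\<^sup>2) \<partial>M)
        = (\<integral>\<^sup>+x. liminf (\<lambda>m. ennreal ((cmod (\<Sum>n<m. g (n + N) x))\<^sup>2)) \<partial>M)"
    proof (rule nn_integral_cong_AE, use ae in eventually_elim)
      case (elim x)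
      have "(\<lambda>n. g (n + N) x) sums (G x - (\<Sum>n<N. g n x))"
        unfolding G_def using elim by (subst sums_iff_shift) (auto simp: summable_sums)
      then have "(\<lambda>m. ennreal ((cmod (\<Sum>n<m. g (n + N) x))\<^sup>2))
          \<longlonglongrightarrow> ennreal ((cmod (G x - (\<Sum>n<N. g n x)))\<^sup>2)"
        unfolding sums_def by (intro tendsto_intros)
      then show ?case by (intro lim_imp_Liminf[symmetric]) auto
    qed
    also have "\<dots> \<le> liminf (\<lambda>m. \<integral>\<^sup>+x. ennreal ((cmod (\<Sum>n<m. g (n + N) x))\<^sup>2) \<partial>M)"
      by (intro nn_integral_liminf) measurable
    also have "\<dots> \<le> liminf (\<lambda>m::nat. ennreal ((r N)\<^sup>2))"
    proof (intro Liminf_mono always_eventually allI)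
      fix m
      have "l2_norm M (\<lambda>x. \<Sum>n<m. g (n + N) x) \<le> (\<Sum>n<m. l2_norm M (g (n + N)))"
        by (intro l2_norm_sum g)
      also have "\<dots> \<le> r N" unfolding r_def by (intro sum_le_suminf smN) auto
      finally show "(\<integral>\<^sup>+x. ennreal ((cmod (\<Sum>n<m. g (n + N) x))\<^sup>2) \<partial>M) \<le> ennreal ((r N)\<^sup>2)"
        using g by (subst nn_integral_l2_norm) (auto intro!: ennreal_leI power_mono)
    qed
    also have "\<dots> = ennreal ((r N)\<^sup>2)" by (simp add: Liminf_const)
    finally show ?thesis .
  qed
  have "G \<in> L2 M" using L2_bound_nn_integral(1)[OF _ tail[of 0] r0] by simp
  moreover have "l2_norm M (\<lambda>x. G x - (\<Sum>n<N. g n x)) \<le> r N" for N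
    by (rule L2_bound_nn_integral(2)[OF _ tail r0]) measurable
  moreover have "r \<longlonglongrightarrow> 0"
    unfolding r_def using suminf_exist_split2[OF sm] .
  ultimately show ?thesis
    using tendsto_sandwich[of "\<lambda>_. 0" "\<lambda>N. l2_norm M (\<lambda>x. G x - (\<Sum>n<N. g n x))" sequentially r 0]
    by (intro bexI[of _ G]) simp_all
qed

section \<open>Bounded operators and Neumann series\<close>

lemma bounded_operator_L2: "l2_bounded_operator M T \<Longrightarrow> f \<in> L2 M \<Longrightarrow> T f \<in> L2 M"
  by (simp add: l2_bounded_operator_def)

lemma bounded_operator_add:
  "l2_bounded_operator M T \<Longrightarrow> f \<in> L2 M \<Longrightarrow> g \<in> L2 M \<Longrightarrow>
    AE x in M. T (\<lambda>y. f y + g y) x = T f x + T g x"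
  by (simp add: l2_bounded_operator_def)

lemma bounded_operator_cmult:
  "l2_bounded_operator M T \<Longrightarrow> f \<in> L2 M \<Longrightarrow> AE x in M. T (\<lambda>y. c * f y) x = c * T f x"
  by (simp add: l2_bounded_operator_def)

lemma bounded_operator_bound:
  assumes "l2_bounded_operator M T"
  obtains C where "C \<ge> 0" "\<And>f. f \<in> L2 M \<Longrightarrow> l2_norm M (T f) \<le> C * l2_norm M f"
proof -
  obtain C where C: "\<And>f. f \<in> L2 M \<Longrightarrow> l2_norm M (T f) \<le> C * l2_norm M f"
    using assms unfolding l2_bounded_operator_def by blast
  show thesis
  proof (rule that[of "\<bar>C\<bar>"])
    fix f :: "'a \<Rightarrow> complex" assume "f \<in> L2 M"
    then have "l2_norm M (T f) \<le> C * l2_norm M f" by (rule C)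
    also have "\<dots> \<le> \<bar>C\<bar> * l2_norm M f" by (rule mult_right_mono) auto
    finally show "l2_norm M (T f) \<le> \<bar>C\<bar> * l2_norm M f" .
  qed simp
qed

lemma bounded_operator_diff:
  assumes "l2_bounded_operator M T" "f \<in> L2 M" "g \<in> L2 M"
  shows "AE x in M. T (\<lambda>y. f y - g y) x = T f x - T g x"
  using bounded_operator_add[OF assms(1,2) L2_cmult[OF assms(3), of "-1"]]
    bounded_operator_cmult[OF assms(1,3), of "-1"] by auto

text \<open>Boundedness sends the null function \<open>f - g\<close> to a null function. This is
  what allows an equation that holds almost everywhere to be pushed through an operator defined on
  representatives.\<close>

lemma bounded_operator_cong:
  assumes T: "l2_bounded_operator M T" and "f \<in> L2 M" "g \<in> L2 M" "AE x in M. f x = g x"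
  shows "AE x in M. T f x = T g x"
proof -
  obtain C where C: "\<And>f. f \<in> L2 M \<Longrightarrow> l2_norm M (T f) \<le> C * l2_norm M f"
    using bounded_operator_bound[OF T] by blast
  have "l2_norm M (\<lambda>x. f x - g x) = 0" using assms by (simp add: l2_norm_diff_eq_0_iff)
  then have "l2_norm M (T (\<lambda>x. f x - g x)) \<le> 0" using C[of "\<lambda>x. f x - g x"] assms by simp
  then have "l2_norm M (T (\<lambda>x. f x - g x)) = 0" using l2_norm_nonneg by (rule antisym)
  then have "AE x in M. T (\<lambda>x. f x - g x) x = 0"
    using bounded_operator_L2[OF T] assms by (simp add: l2_norm_eq_0_iff)
  with bounded_operator_diff[OF T assms(2,3)] show ?thesis by auto
qed

lemma bounded_operator_id: "l2_bounded_operator M (\<lambda>f. f)"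
  unfolding l2_bounded_operator_def by (auto intro: exI[of _ 1])

lemma bounded_operator_zero: "l2_bounded_operator M (\<lambda>f x. 0)"
  unfolding l2_bounded_operator_def by (auto intro: exI[of _ 0])

lemma bounded_operator_comp:
  assumes T: "l2_bounded_operator M T" and S: "l2_bounded_operator M S"
  shows "l2_bounded_operator M (\<lambda>f. T (S f))"
  unfolding l2_bounded_operator_def
proof (intro conjI ballI allI)
  note L = bounded_operator_L2[OF T] bounded_operator_L2[OF S]
  show "T (S f) \<in> L2 M" if "f \<in> L2 M" for f using that L by blast
  show "AE x in M. T (S (\<lambda>y. f y + g y)) x = T (S f) x + T (S g) x"
    if f: "f \<in> L2 M" and g: "g \<in> L2 M" for f g
  proof -
    have "AE x in M. T (S (\<lambda>y. f y + g y)) x = T (\<lambda>x. S f x + S g x) x"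
      by (rule bounded_operator_cong[OF T _ _ bounded_operator_add[OF S f g]]) (simp_all add: L f g)
    moreover have "AE x in M. T (\<lambda>x. S f x + S g x) x = T (S f) x + T (S g) x"
      by (rule bounded_operator_add[OF T]) (simp_all add: L f g)
    ultimately show ?thesis by eventually_elim simp
  qed
  show "AE x in M. T (S (\<lambda>y. c * f y)) x = c * T (S f) x" if f: "f \<in> L2 M" for c f
  proof -
    have "AE x in M. T (S (\<lambda>y. c * f y)) x = T (\<lambda>x. c * S f x) x"
      by (rule bounded_operator_cong[OF T _ _ bounded_operator_cmult[OF S f]]) (simp_all add: L f)
    moreover have "AE x in M. T (\<lambda>x. c * S f x) x = c * T (S f) x"
      by (rule bounded_operator_cmult[OF T]) (simp_all add: L f)
    ultimately show ?thesis by eventually_elim simp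
  qed
  obtain C D where "C \<ge> 0"
    and C: "\<And>f. f \<in> L2 M \<Longrightarrow> l2_norm M (T f) \<le> C * l2_norm M f"
    and D: "\<And>f. f \<in> L2 M \<Longrightarrow> l2_norm M (S f) \<le> D * l2_norm M f"
    using bounded_operator_bound[OF T] bounded_operator_bound[OF S] by metis
  show "\<exists>C. \<forall>f\<in>L2 M. l2_norm M (T (S f)) \<le> C * l2_norm M f"
  proof (intro exI ballI)
    fix f :: "'a \<Rightarrow> complex" assume f: "f \<in> L2 M"
    have "l2_norm M (T (S f)) \<le> C * l2_norm M (S f)" using f by (intro C L)
    also have "\<dots> \<le> C * (D * l2_norm M f)" using f \<open>C \<ge> 0\<close> by (intro mult_left_mono D)
    finally show "l2_norm M (T (S f)) \<le> (C * D) * l2_norm M f" by (simp add: mult.assoc)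
  qed
qed

lemma bounded_operator_scale:
  assumes T: "l2_bounded_operator M T"
  shows "l2_bounded_operator M (\<lambda>f x. c * T f x)"
  unfolding l2_bounded_operator_def
proof (intro conjI ballI allI)
  note L = bounded_operator_L2[OF T]
  show "(\<lambda>x. c * T f x) \<in> L2 M" if "f \<in> L2 M" for f using that L by blast
  show "AE x in M. c * T (\<lambda>y. f y + g y) x = c * T f x + c * T g x"
    if f: "f \<in> L2 M" and g: "g \<in> L2 M" for f g
    using bounded_operator_add[OF T f g] by (auto simp: distrib_left)
  show "AE x in M. c * T (\<lambda>y. d * f y) x = d * (c * T f x)" if f: "f \<in> L2 M" for d f
    using bounded_operator_cmult[OF T f] by (auto simp: mult_ac)
  obtain C where C: "\<And>f. f \<in> L2 M \<Longrightarrow> l2_norm M (T f) \<le> C * l2_norm M f"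
    using bounded_operator_bound[OF T] by metis
  have "l2_norm M (\<lambda>x. c * T f x) \<le> (cmod c * C) * l2_norm M f" if "f \<in> L2 M" for f
    using mult_left_mono[OF C[OF that] norm_ge_zero[of c]] by (simp add: mult.assoc)
  then show "\<exists>C. \<forall>f\<in>L2 M. l2_norm M (\<lambda>x. c * T f x) \<le> C * l2_norm M f"
    by blast
qed

lemma bounded_operator_plus:
  assumes T: "l2_bounded_operator M T" and S: "l2_bounded_operator M S"
  shows "l2_bounded_operator M (\<lambda>f x. T f x + S f x)"
  unfolding l2_bounded_operator_def
proof (intro conjI ballI allI)
  note L = bounded_operator_L2[OF T] bounded_operator_L2[OF S]
  show "(\<lambda>x. T f x + S f x) \<in> L2 M" if "f \<in> L2 M" for f using that L by blast
  show "AE x in M. T (\<lambda>y. f y + g y) x + S (\<lambda>y. f y + g y) x = T f x + S f x + (T g x + S g x)"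
    if f: "f \<in> L2 M" and g: "g \<in> L2 M" for f g
    using bounded_operator_add[OF T f g] bounded_operator_add[OF S f g] by auto
  show "AE x in M. T (\<lambda>y. d * f y) x + S (\<lambda>y. d * f y) x = d * (T f x + S f x)"
    if f: "f \<in> L2 M" for d f
    using bounded_operator_cmult[OF T f, of d] bounded_operator_cmult[OF S f, of d]
    by (auto simp: distrib_left)
  obtain C D where C: "\<And>f. f \<in> L2 M \<Longrightarrow> l2_norm M (T f) \<le> C * l2_norm M f"
    and D: "\<And>f. f \<in> L2 M \<Longrightarrow> l2_norm M (S f) \<le> D * l2_norm M f"
    using bounded_operator_bound[OF T] bounded_operator_bound[OF S] by metis
  have "l2_norm M (\<lambda>x. T f x + S f x) \<le> (C + D) * l2_norm M f" if f: "f \<in> L2 M" for f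
    using l2_norm_triangle[OF L(1)[OF f] L(2)[OF f]] C[OF f] D[OF f] by (simp add: distrib_right)
  then show "\<exists>C. \<forall>f\<in>L2 M. l2_norm M (\<lambda>x. T f x + S f x) \<le> C * l2_norm M f"
    by blast
qed

lemma bounded_operator_minus:
  assumes T: "l2_bounded_operator M T" and S: "l2_bounded_operator M S"
  shows "l2_bounded_operator M (\<lambda>f x. T f x - S f x)"
  using bounded_operator_plus[OF T bounded_operator_scale[OF S, of "-1"]] by simp

lemma bounded_operator_funpow:
  "l2_bounded_operator M T \<Longrightarrow> l2_bounded_operator M (T ^^ n)"
  by (induction n) (auto simp: bounded_operator_id id_def comp_def intro: bounded_operator_comp)

lemma bounded_operator_sum:
  "(\<And>i. l2_bounded_operator M (T i)) \<Longrightarrow> l2_bounded_operator M (\<lambda>f x. \<Sum>i\<in>I. T i f x)"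
  by (induction I rule: infinite_finite_induct)
    (simp_all add: bounded_operator_zero bounded_operator_plus)

text \<open>Membership in \<open>L2\<close> is part of the notion because the Bochner integral of a
  non-integrable function is 0, so a vanishing \<open>l2_norm\<close> alone would say
  nothing.\<close>

definition l2_tendsto :: "'a measure \<Rightarrow> (nat \<Rightarrow> 'a \<Rightarrow> complex) \<Rightarrow> ('a \<Rightarrow> complex) \<Rightarrow> bool" where
  "l2_tendsto M s u \<longleftrightarrow>
    u \<in> L2 M \<and> (\<forall>n. s n \<in> L2 M) \<and> (\<lambda>n. l2_norm M (\<lambda>x. s n x - u x)) \<longlonglongrightarrow> 0"

lemma l2_tendstoI:
  assumes "u \<in> L2 M" "\<And>n. s n \<in> L2 M" "e \<longlonglongrightarrow> 0" "\<And>n. l2_norm M (\<lambda>x. s n x - u x) \<le> e n"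
  shows "l2_tendsto M s u"
proof -
  have "(\<lambda>n. l2_norm M (\<lambda>x. s n x - u x)) \<longlonglongrightarrow> 0"
    by (rule tendsto_sandwich[OF _ _ tendsto_const assms(3)]) (simp_all add: assms(4))
  then show ?thesis using assms by (simp add: l2_tendsto_def)
qed

lemma l2_tendsto_unique:
  assumes u: "l2_tendsto M s u" and v: "l2_tendsto M s v" shows "AE x in M. u x = v x"
proof -
  have L: "u \<in> L2 M" "v \<in> L2 M" "s n \<in> L2 M" for n using u v by (auto simp: l2_tendsto_def)
  have "(\<lambda>n. l2_norm M (\<lambda>x. s n x - u x) + l2_norm M (\<lambda>x. s n x - v x)) \<longlonglongrightarrow> 0 + 0"
    using u v unfolding l2_tendsto_def by (intro tendsto_add) auto
  moreover have "l2_norm M (\<lambda>x. u x - v x)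
      \<le> l2_norm M (\<lambda>x. s n x - u x) + l2_norm M (\<lambda>x. s n x - v x)" for n
    using l2_norm_triangle_sub[of u M "s n" v] L by (simp add: l2_norm_diff_commute[of M u])
  ultimately have "l2_norm M (\<lambda>x. u x - v x) \<le> 0"
    by (intro LIMSEQ_le_const) auto
  then have "l2_norm M (\<lambda>x. u x - v x) = 0" using l2_norm_nonneg by (rule antisym)
  then show ?thesis using L by (simp add: l2_norm_diff_eq_0_iff)
qed

lemma l2_tendsto_op:
  assumes s: "l2_tendsto M s u" and T: "l2_bounded_operator M T"
  shows "l2_tendsto M (\<lambda>n. T (s n)) (T u)"
proof -
  have L: "u \<in> L2 M" "s n \<in> L2 M" for n using s by (auto simp: l2_tendsto_def)
  obtain C where C: "\<And>f. f \<in> L2 M \<Longrightarrow> l2_norm M (T f) \<le> C * l2_norm M f"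
    using bounded_operator_bound[OF T] by metis
  show ?thesis
  proof (rule l2_tendstoI)
    show "(\<lambda>n. C * l2_norm M (\<lambda>x. s n x - u x)) \<longlonglongrightarrow> 0"
      using s unfolding l2_tendsto_def by (intro tendsto_mult_right_zero) auto
    show "l2_norm M (\<lambda>x. T (s n) x - T u x) \<le> C * l2_norm M (\<lambda>x. s n x - u x)" for n
    proof -
      have "l2_norm M (\<lambda>x. T (s n) x - T u x) = l2_norm M (T (\<lambda>x. s n x - u x))"
        using bounded_operator_diff[OF T L(2) L(1), of n] L bounded_operator_L2[OF T]
        by (intro l2_norm_cong_AE) auto
      also have "\<dots> \<le> C * l2_norm M (\<lambda>x. s n x - u x)" using L by (intro C) auto
      finally show ?thesis .
    qed
  qed (use L bounded_operator_L2[OF T] in auto)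
qed

lemma l2_tendsto_cong:
  assumes s: "l2_tendsto M s u" and t: "\<And>n. t n \<in> L2 M" "\<And>n. AE x in M. s n x = t n x"
  shows "l2_tendsto M t u"
proof -
  have L: "u \<in> L2 M" "s n \<in> L2 M" for n using s by (auto simp: l2_tendsto_def)
  have "l2_norm M (\<lambda>x. s n x - u x) = l2_norm M (\<lambda>x. t n x - u x)" for n
    using t(2)[of n] by (intro l2_norm_cong_AE) (use L t in auto)
  then show ?thesis using s t by (auto simp: l2_tendsto_def)
qed

lemma l2_tendsto_add:
  assumes s: "l2_tendsto M s u" and t: "l2_tendsto M t v"
  shows "l2_tendsto M (\<lambda>n x. s n x + t n x) (\<lambda>x. u x + v x)"
proof (rule l2_tendstoI)
  have L: "u \<in> L2 M" "v \<in> L2 M" "s n \<in> L2 M" "t n \<in> L2 M" for n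
    using s t by (auto simp: l2_tendsto_def)
  show "(\<lambda>x. u x + v x) \<in> L2 M" "(\<lambda>x. s n x + t n x) \<in> L2 M" for n using L by auto
  show "(\<lambda>n. l2_norm M (\<lambda>x. s n x - u x) + l2_norm M (\<lambda>x. t n x - v x)) \<longlonglongrightarrow> 0"
    using s t unfolding l2_tendsto_def by (intro tendsto_add_zero) auto
  show "l2_norm M (\<lambda>x. s n x + t n x - (u x + v x))
      \<le> l2_norm M (\<lambda>x. s n x - u x) + l2_norm M (\<lambda>x. t n x - v x)" for n
    using l2_norm_triangle[of "\<lambda>x. s n x - u x" M "\<lambda>x. t n x - v x"] L
    by (simp add: add_diff_add)
qed

lemma l2_tendsto_cmult:
  assumes s: "l2_tendsto M s u" shows "l2_tendsto M (\<lambda>n x. c * s n x) (\<lambda>x. c * u x)"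
  using l2_tendsto_op[OF s bounded_operator_scale[OF bounded_operator_id]] .

lemma l2_tendsto_diff:
  assumes s: "l2_tendsto M s u" and t: "l2_tendsto M t v"
  shows "l2_tendsto M (\<lambda>n x. s n x - t n x) (\<lambda>x. u x - v x)"
  using l2_tendsto_add[OF s l2_tendsto_cmult[OF t, of "-1"]] by simp

lemma l2_tendsto_norm:
  assumes s: "l2_tendsto M s u" shows "(\<lambda>n. l2_norm M (s n)) \<longlonglongrightarrow> l2_norm M u"
proof -
  have L: "u \<in> L2 M" "s n \<in> L2 M" for n using s by (auto simp: l2_tendsto_def)
  have le: "\<bar>l2_norm M (s n) - l2_norm M u\<bar> \<le> l2_norm M (\<lambda>x. s n x - u x)" for n
    using l2_norm_triangle[of "\<lambda>x. s n x - u x" M u] l2_norm_triangle[of "\<lambda>x. u x - s n x" M "s n"] L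
    by (simp add: l2_norm_diff_commute[of M u])
  have lim: "(\<lambda>n. l2_norm M (\<lambda>x. s n x - u x)) \<longlonglongrightarrow> 0"
    using s by (simp add: l2_tendsto_def)
  have "(\<lambda>n. \<bar>l2_norm M (s n) - l2_norm M u\<bar>) \<longlonglongrightarrow> 0"
    by (rule tendsto_sandwich[OF _ _ tendsto_const lim]) (simp_all add: le)
  then show ?thesis by (rule LIM_zero_cancel[OF tendsto_rabs_zero_cancel])
qed

lemma l2_tendsto_inner:
  assumes s: "l2_tendsto M s u" and g: "g \<in> L2 M"
  shows "(\<lambda>n. l2_inner M (s n) g) \<longlonglongrightarrow> l2_inner M u g"
proof (rule LIM_zero_cancel, rule tendsto_norm_zero_cancel)
  have L: "u \<in> L2 M" "s n \<in> L2 M" for n using s by (auto simp: l2_tendsto_def)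
  have lim: "(\<lambda>n. l2_norm M (\<lambda>x. s n x - u x) * l2_norm M g) \<longlonglongrightarrow> 0"
    using s unfolding l2_tendsto_def by (intro tendsto_mult_left_zero) auto
  have "cmod (l2_inner M (s n) g - l2_inner M u g)
      \<le> l2_norm M (\<lambda>x. s n x - u x) * l2_norm M g" for n
    using l2_Cauchy_Schwarz[of "\<lambda>x. s n x - u x" M g] L g by simp
  then show "(\<lambda>n. cmod (l2_inner M (s n) g - l2_inner M u g)) \<longlonglongrightarrow> 0"
    by (intro tendsto_sandwich[OF _ _ tendsto_const lim] always_eventually) simp_all
qed

section \<open>Neumann series\<close>

lemma l2_is_inverse_cmult:
  assumes "l2_is_inverse M T S" "c \<noteq> 0"
    and T: "\<And>f. f \<in> L2 M \<Longrightarrow> T f \<in> L2 M"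
  shows "l2_is_inverse M (\<lambda>f x. c * T f x) (\<lambda>f. S (\<lambda>x. inverse c * f x))"
proof -
  have S: "l2_bounded_operator M S" using assms(1) by (simp add: l2_is_inverse_def)
  have "l2_bounded_operator M (\<lambda>f. S (\<lambda>x. inverse c * f x))"
    by (intro bounded_operator_comp[OF S] bounded_operator_scale bounded_operator_id)
  moreover have "AE x in M. c * T (S (\<lambda>x. inverse c * f x)) x = f x" if "f \<in> L2 M" for f
  proof -
    have "AE x in M. T (S (\<lambda>x. inverse c * f x)) x = inverse c * f x"
      using assms(1) that unfolding l2_is_inverse_def by blast
    then show ?thesis by eventually_elim (simp add: assms(2) flip: mult.assoc)
  qed
  moreover have "AE x in M. S (\<lambda>x. inverse c * (c * T f x)) x = f x" if "f \<in> L2 M" for f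
    using assms(1) that by (auto simp: l2_is_inverse_def assms(2) simp flip: mult.assoc)
  ultimately show ?thesis unfolding l2_is_inverse_def by blast
qed

text \<open>Bounds on all powers are assumed instead of a norm below 1, because
  \<open>P - \<pi>\<close> may begin to contract only after several steps.\<close>

lemma l2_Neumann:
  assumes K: "l2_bounded_operator M K"
    and c: "\<And>n f. f \<in> L2 M \<Longrightarrow> l2_norm M ((K ^^ n) f) \<le> c n * l2_norm M f" and sm: "summable c"
    and c0: "\<And>n. c n \<ge> 0"
  shows "\<exists>S. l2_is_inverse M (\<lambda>f x. f x - K f x) S"
proof -
  define \<sigma> where "\<sigma> = (\<lambda>N f x. \<Sum>n<N. (K ^^ n) f x)"
  have Kn: "l2_bounded_operator M (K ^^ n)" for n by (intro bounded_operator_funpow K)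
  have \<sigma>: "l2_bounded_operator M (\<sigma> N)" for N unfolding \<sigma>_def by (intro bounded_operator_sum Kn)
  note L = bounded_operator_L2[OF K] bounded_operator_L2[OF Kn] bounded_operator_L2[OF \<sigma>]
  have "\<exists>G. l2_tendsto M (\<lambda>N. \<sigma> N f) G" if f: "f \<in> L2 M" for f
  proof -
    have "summable (\<lambda>n. l2_norm M ((K ^^ n) f))"
      by (rule summable_comparison_test'[OF summable_mult2[OF sm, of "l2_norm M f"]])
        (use c[OF f] in simp)
    then have "\<exists>G\<in>L2 M. (\<lambda>N. l2_norm M (\<lambda>x. G x - (\<Sum>n<N. (K ^^ n) f x))) \<longlonglongrightarrow> 0"
      by (intro L2_summable) (simp_all add: L f)
    then obtain G where "G \<in> L2 M" "(\<lambda>N. l2_norm M (\<lambda>x. G x - (\<Sum>n<N. (K ^^ n) f x))) \<longlonglongrightarrow> 0"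
      by blast
    then show ?thesis
      by (intro exI[of _ G])
        (simp add: l2_tendsto_def \<sigma>_def l2_norm_diff_commute[of M G] L f)
  qed
  \<comment> \<open>\<open>S f\<close> is chosen separately for each \<open>f\<close>, so linearity
    of \<open>S\<close> has to come from uniqueness of limits up to null sets.\<close>
  then obtain S where S: "\<And>f. f \<in> L2 M \<Longrightarrow> l2_tendsto M (\<lambda>N. \<sigma> N f) (S f)" by metis
  have SL: "S f \<in> L2 M" if "f \<in> L2 M" for f using S[OF that] by (simp add: l2_tendsto_def)
  have "l2_bounded_operator M S"
    unfolding l2_bounded_operator_def
  proof (intro conjI ballI allI)
    show "S f \<in> L2 M" if "f \<in> L2 M" for f using SL that .
    show "AE x in M. S (\<lambda>y. f y + g y) x = S f x + S g x" if f: "f \<in> L2 M" and g: "g \<in> L2 M" for f g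
    proof (rule l2_tendsto_unique)
      show "l2_tendsto M (\<lambda>N. \<sigma> N (\<lambda>y. f y + g y)) (S (\<lambda>y. f y + g y))"
        using f g by (intro S) auto
      show "l2_tendsto M (\<lambda>N. \<sigma> N (\<lambda>y. f y + g y)) (\<lambda>x. S f x + S g x)"
      proof (rule l2_tendsto_cong[OF l2_tendsto_add[OF S[OF f] S[OF g]]])
        show "AE x in M. \<sigma> n f x + \<sigma> n g x = \<sigma> n (\<lambda>y. f y + g y) x" for n
          using bounded_operator_add[OF \<sigma> f g, of n] by auto
      qed (simp_all add: L f g)
    qed
    show "AE x in M. S (\<lambda>y. d * f y) x = d * S f x" if f: "f \<in> L2 M" for d f
    proof (rule l2_tendsto_unique)
      show "l2_tendsto M (\<lambda>N. \<sigma> N (\<lambda>y. d * f y)) (S (\<lambda>y. d * f y))"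
        using f by (intro S) auto
      show "l2_tendsto M (\<lambda>N. \<sigma> N (\<lambda>y. d * f y)) (\<lambda>x. d * S f x)"
      proof (rule l2_tendsto_cong[OF l2_tendsto_cmult[OF S[OF f]]])
        show "AE x in M. d * \<sigma> n f x = \<sigma> n (\<lambda>y. d * f y) x" for n
          using bounded_operator_cmult[OF \<sigma> f, of n d] by (simp add: eq_commute)
      qed (simp_all add: L f)
    qed
    have "l2_norm M (S f) \<le> suminf c * l2_norm M f" if f: "f \<in> L2 M" for f
    proof (rule LIMSEQ_le_const2[OF l2_tendsto_norm[OF S[OF f]]], intro exI allI impI)
      fix N :: nat
      have "l2_norm M (\<sigma> N f) \<le> (\<Sum>n<N. l2_norm M ((K ^^ n) f))"
        unfolding \<sigma>_def using L f by (intro l2_norm_sum) auto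
      also have "\<dots> \<le> (\<Sum>n<N. c n) * l2_norm M f"
        unfolding sum_distrib_right by (intro sum_mono c f)
      also have "\<dots> \<le> suminf c * l2_norm M f"
        using sm c0 by (intro mult_right_mono sum_le_suminf) auto
      finally show "l2_norm M (\<sigma> N f) \<le> suminf c * l2_norm M f" .
    qed
    then show "\<exists>C. \<forall>f\<in>L2 M. l2_norm M (S f) \<le> C * l2_norm M f" by blast
  qed
  moreover have lim: "l2_tendsto M (\<lambda>N x. f x - (K ^^ N) f x) f" if f: "f \<in> L2 M" for f
  proof (rule l2_tendstoI)
    show "(\<lambda>N. c N * l2_norm M f) \<longlonglongrightarrow> 0"
      by (intro tendsto_mult_left_zero summable_LIMSEQ_zero sm)
    show "l2_norm M (\<lambda>x. f x - (K ^^ N) f x - f x) \<le> c N * l2_norm M f" for N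
      using c[OF f, of N] l2_norm_cmult[of M "-1" "(K ^^ N) f"] by simp
  qed (simp_all add: L f)
  moreover have "AE x in M. S f x - K (S f) x = f x" if f: "f \<in> L2 M" for f
  proof (rule l2_tendsto_unique[OF _ lim[OF f]])
    \<comment> \<open>Partial sums satisfy (I - K) \<sigma>_N = I - K^N. In this order
      \<open>K\<close> acts on a sum, so the identity holds only almost everywhere; already for N =
      0 the function \<open>K 0\<close> need not be literally zero.\<close>
    have eq: "AE x in M. \<sigma> N f x - K (\<sigma> N f) x = f x - (K ^^ N) f x" for N
    proof (induction N)
      case 0
      show ?case using bounded_operator_cmult[OF K f, of 0] by (simp add: \<sigma>_def)
    next
      case (Suc N)
      have "AE x in M. K (\<lambda>x. \<sigma> N f x + (K ^^ N) f x) x = K (\<sigma> N f) x + K ((K ^^ N) f) x"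
        using L f by (intro bounded_operator_add[OF K]) auto
      with Suc show ?case
        by eventually_elim (simp add: \<sigma>_def algebra_simps)
    qed
    show "l2_tendsto M (\<lambda>N x. f x - (K ^^ N) f x) (\<lambda>x. S f x - K (S f) x)"
      by (rule l2_tendsto_cong[OF l2_tendsto_diff[OF S[OF f] l2_tendsto_op[OF S[OF f] K]]])
        (simp_all add: eq L f)
  qed
  moreover have "AE x in M. S (\<lambda>x. f x - K f x) x = f x" if f: "f \<in> L2 M" for f
  proof (rule l2_tendsto_unique[OF _ lim[OF f]])
    \<comment> \<open>In the other order only iterates of \<open>K\<close> at \<open>f\<close>
      occur, and the telescoping is pointwise.\<close>
    have tele: "\<sigma> N f x - \<sigma> N (K f) x = f x - (K ^^ N) f x" for N x
      by (induction N) (auto simp: \<sigma>_def funpow_swap1 algebra_simps)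
    have fK: "(\<lambda>x. f x - K f x) \<in> L2 M" by (simp add: L f)
    show "l2_tendsto M (\<lambda>N x. f x - (K ^^ N) f x) (S (\<lambda>x. f x - K f x))"
    proof (rule l2_tendsto_cong[OF S[OF fK]])
      show "AE x in M. \<sigma> N (\<lambda>x. f x - K f x) x = f x - (K ^^ N) f x" for N
        using bounded_operator_diff[OF \<sigma> f L(1)[OF f], of N] by (simp add: tele)
    qed (simp_all add: L f)
  qed
  ultimately show ?thesis unfolding l2_is_inverse_def by blast
qed

section \<open>Spectral gaps of positive contractions\<close>

text \<open>Invertibility enters \<open>gap_form\<close> as a quantitative lower bound, which can be
  compared with an infimum.\<close>

lemma l2_is_inverse_bounded_below:
  assumes inv: "l2_is_inverse M T S" and T: "\<And>f. f \<in> L2 M \<Longrightarrow> T f \<in> L2 M"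
  obtains d where "d > 0" "\<And>f. f \<in> L2 M \<Longrightarrow> d * l2_norm M f \<le> l2_norm M (T f)"
proof -
  have S: "l2_bounded_operator M S" using inv by (simp add: l2_is_inverse_def)
  obtain C where C: "C \<ge> 0" "\<And>f. f \<in> L2 M \<Longrightarrow> l2_norm M (S f) \<le> C * l2_norm M f"
    using bounded_operator_bound[OF S] by blast
  show thesis
  \<comment> \<open>The bound \<open>C\<close> may be 0, for instance on a trivial space, hence
    \<open>C + 1\<close>.\<close>
  proof (rule that[of "1 / (C + 1)"])
    show "1 / (C + 1) > 0" using C by simp
    fix f :: "'a \<Rightarrow> complex" assume f: "f \<in> L2 M"
    have "AE x in M. f x = S (T f) x"
      using inv f by (simp add: l2_is_inverse_def eq_commute)
    then have "l2_norm M f = l2_norm M (S (T f))"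
      by (rule l2_norm_cong_AE) (simp_all add: f T bounded_operator_L2[OF S])
    also have "\<dots> \<le> C * l2_norm M (T f)" by (intro C T f)
    also have "\<dots> \<le> (C + 1) * l2_norm M (T f)" by (simp add: mult_right_mono)
    finally show "1 / (C + 1) * l2_norm M f \<le> l2_norm M (T f)"
      using C by (simp add: field_simps)
  qed
qed

text \<open>The condition \<open>firm\<close> is the operator inequality Q^2 \<le> Q. For a
  self-adjoint operator it combines positivity with norm at most 1, and it is directly available for
  operators of the form A* A with A a contraction.\<close>

locale l2_positive_contraction =
  fixes M :: "'a measure" and Q :: "'a operator"
  assumes Q: "l2_bounded_operator M Q"
    and selfadjoint: "\<And>f g. f \<in> L2 M \<Longrightarrow> g \<in> L2 M \<Longrightarrow> l2_inner M (Q f) g = l2_inner M f (Q g)"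
    and firm: "\<And>f. f \<in> L2 M \<Longrightarrow> (l2_norm M (Q f))\<^sup>2 \<le> Re (l2_inner M (Q f) f)"
begin

lemma Q_L2 [simp]: "f \<in> L2 M \<Longrightarrow> Q f \<in> L2 M"
  by (rule bounded_operator_L2[OF Q])

lemma Q_contraction:
  assumes f: "f \<in> L2 M" shows "l2_norm M (Q f) \<le> l2_norm M f"
proof -
  have "l2_norm M (Q f) * l2_norm M (Q f) \<le> l2_norm M (Q f) * l2_norm M f"
    using firm[OF f] l2_Cauchy_Schwarz[OF Q_L2[OF f] f] complex_Re_le_cmod[of "l2_inner M (Q f) f"]
    by (simp add: power2_eq_square)
  then show ?thesis
    by (cases "l2_norm M (Q f) = 0") (auto simp: mult_le_cancel_left less_le)
qed

lemma resolvent_op: "l2_bounded_operator M (\<lambda>f x. c * f x - Q f x)"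
  by (intro bounded_operator_minus bounded_operator_scale bounded_operator_id Q)

text \<open>Completing the square in \<open>firm\<close> gives \<bar>\<bar>Q - 1/2\<bar>\<bar> \<le>
  1/2, whereas t lies at distance more than 1/2 from 1/2. Hence t - Q = r (I - K) with r = t - 1/2
  and K = (Q - 1/2) / r of norm below 1.\<close>

lemma resolvent_outside:
  assumes t: "t < 0 \<or> 1 < t"
  shows "\<exists>S. l2_is_inverse M (\<lambda>f x. complex_of_real t * f x - Q f x) S"
proof -
  define r where "r = t - 1/2"
  have r: "\<bar>r\<bar> > 1/2" using t by (auto simp: r_def abs_if)
  define k :: real where "k = 1/2"
  define K where "K = (\<lambda>f x. complex_of_real (1/r) * (Q f x - complex_of_real k * f x))"
  have K: "l2_bounded_operator M K"
    unfolding K_def by (intro bounded_operator_minus bounded_operator_scale bounded_operator_id Q)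
  define q where "q = 1 / (2 * \<bar>r\<bar>)"
  have q: "0 \<le> q" "q < 1" using r by (auto simp: q_def)
  have half: "l2_norm M (\<lambda>x. Q f x - complex_of_real k * f x) \<le> l2_norm M f / 2"
    if f: "f \<in> L2 M" for f
  proof (rule power2_le_imp_le)
    have "(l2_norm M (\<lambda>x. Q f x - complex_of_real k * f x))\<^sup>2
        = (l2_norm M (Q f))\<^sup>2 - Re (l2_inner M (Q f) f) + (l2_norm M f)\<^sup>2 / 4"
      using f by (subst l2_norm_diff_power2) (simp_all add: power_mult_distrib, simp add: k_def power2_eq_square)
    then show "(l2_norm M (\<lambda>x. Q f x - complex_of_real k * f x))\<^sup>2 \<le> (l2_norm M f / 2)\<^sup>2"
      using firm[OF f] by (simp add: power_divide)
  qed simp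
  have K1: "l2_norm M (K f) \<le> q * l2_norm M f" if f: "f \<in> L2 M" for f
  proof -
    have "l2_norm M (K f) \<le> \<bar>1/r\<bar> * (l2_norm M f / 2)"
      unfolding K_def l2_norm_cmult norm_of_real by (intro mult_left_mono half f) simp
    then show ?thesis by (simp add: q_def)
  qed
  have Kn: "l2_norm M ((K ^^ n) f) \<le> q ^ n * l2_norm M f" if f: "f \<in> L2 M" for n f
  proof (induction n)
    case (Suc n)
    have "l2_norm M ((K ^^ Suc n) f) \<le> q * l2_norm M ((K ^^ n) f)"
      using K1[OF bounded_operator_L2[OF bounded_operator_funpow[OF K] f]] by simp
    also have "\<dots> \<le> q * (q ^ n * l2_norm M f)" by (intro mult_left_mono Suc q)
    finally show ?case by (simp add: mult.assoc)
  qed simp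
  obtain S where S: "l2_is_inverse M (\<lambda>f x. f x - K f x) S"
    using l2_Neumann[OF K Kn summable_geometric] q by auto
  have "l2_is_inverse M (\<lambda>f x. complex_of_real r * (f x - K f x))
      (\<lambda>f. S (\<lambda>x. inverse (complex_of_real r) * f x))"
    using r by (intro l2_is_inverse_cmult[OF S] L2_diff bounded_operator_L2[OF K]) auto
  moreover have "(\<lambda>f x. complex_of_real r * (f x - K f x)) = (\<lambda>f x. complex_of_real t * f x - Q f x)"
  proof (intro ext)
    fix f x
    have rr: "complex_of_real r * (complex_of_real (1 / r) * z) = z" for z
      using r by auto
    have "complex_of_real r * (f x - K f x)
        = complex_of_real r * f x - (Q f x - complex_of_real k * f x)"
      by (simp only: K_def right_diff_distrib[of _ "f x"] rr)
    also have "\<dots> = complex_of_real (r + k) * f x - Q f x" by (simp add: algebra_simps)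
    also have "r + k = t" by (simp add: r_def k_def)
    finally show "complex_of_real r * (f x - K f x) = complex_of_real t * f x - Q f x" .
  qed
  ultimately show ?thesis by auto
qed

text \<open>With \<open>c\<close> the midpoint and \<open>d\<close> half the length of the gap, the claim reads
  \<open>\<parallel>(Q - c) f\<parallel> \<ge> d \<parallel>f\<parallel>\<close>. If the best constant \<open>m\<close> were below \<open>d\<close>, then \<open>c + m\<close> and \<open>c - m\<close> would lie in the gap,
  and the invertibility of \<open>(Q - c)\<^sup>2 - m\<^sup>2\<close> would improve \<open>m\<close>.\<close>

lemma gap_form:
  assumes s: "s < 1"
    and gap: "\<And>t. s < t \<Longrightarrow> t < 1 \<Longrightarrow> \<exists>S. l2_is_inverse M (\<lambda>f x. complex_of_real t * f x - Q f x) S"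
    and f: "f \<in> L2 M"
  shows "0 \<le> (l2_norm M (Q f))\<^sup>2 - (1 + s) * Re (l2_inner M (Q f) f) + s * (l2_norm M f)\<^sup>2"
proof -
  define c d where "c = (1 + s) / 2" and "d = (1 - s) / 2"
  define E where "E = (\<lambda>t f x. complex_of_real t * f x - Q f x)"
  have Eop: "l2_bounded_operator M (E t)" for t unfolding E_def by (rule resolvent_op)
  note EL [simp] = bounded_operator_L2[OF Eop]
  have Esa: "l2_inner M (E t u) v = l2_inner M u (E t v)" if "u \<in> L2 M" "v \<in> L2 M" for t u v
    using that by (simp add: E_def selfadjoint)
  have d0: "d > 0" using s by (simp add: d_def)
  have "d\<^sup>2 * (l2_norm M f)\<^sup>2 \<le> (l2_norm M (E c f))\<^sup>2"
  proof (cases "l2_norm M f = 0")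
    case False
    \<comment> \<open>The Rayleigh quotients of (Q - c)^2, whose infimum is m^2. With E_c = c - Q,
      the operator A = E_c^2 - m^2 is then nonnegative, which is \<open>low\<close>.\<close>
    define R where "R = {(l2_norm M (E c f))\<^sup>2 / (l2_norm M f)\<^sup>2 | f. f \<in> L2 M \<and> l2_norm M f \<noteq> 0}"
    define m where "m = sqrt (Inf R)"
    have Rne: "R \<noteq> {}" using f False by (auto simp: R_def)
    have R0: "0 \<le> r" if "r \<in> R" for r using that by (auto simp: R_def)
    have bdd: "bdd_below R" using R0 by (rule bdd_belowI)
    have InfR: "0 \<le> Inf R" using Rne R0 by (rule cInf_greatest)
    then have m2: "m\<^sup>2 = Inf R" "0 \<le> m" by (simp_all add: m_def)
    have low: "m\<^sup>2 * (l2_norm M g)\<^sup>2 \<le> (l2_norm M (E c g))\<^sup>2" if g: "g \<in> L2 M" for g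
    proof (cases "l2_norm M g = 0")
      case nz: False
      then have "m\<^sup>2 \<le> (l2_norm M (E c g))\<^sup>2 / (l2_norm M g)\<^sup>2"
        unfolding m2 using g by (intro cInf_lower bdd) (auto simp: R_def)
      then show ?thesis using nz by (simp add: field_simps)
    qed simp
    have "d \<le> m"
    proof (rule ccontr)
      assume "\<not> d \<le> m"
      \<comment> \<open>From 0 \<le> m < d both c - m and c + m fall strictly between c - d = s and
        c + d = 1.\<close>
      then have "s < c - m" "c - m < 1" "s < c + m" "c + m < 1"
        using m2(2) s by (auto simp: c_def d_def field_simps)
      then obtain S1 S2 where "l2_is_inverse M (E (c - m)) S1" "l2_is_inverse M (E (c + m)) S2"
        using gap unfolding E_def by meson
      then obtain d1 d2 where d12: "d1 > 0" "d2 > 0"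
        and d1: "\<And>f. f \<in> L2 M \<Longrightarrow> d1 * l2_norm M f \<le> l2_norm M (E (c - m) f)"
        and d2: "\<And>f. f \<in> L2 M \<Longrightarrow> d2 * l2_norm M f \<le> l2_norm M (E (c + m) f)"
        using l2_is_inverse_bounded_below EL by metis
      obtain C0 where C0: "C0 \<ge> 0" "\<And>f. f \<in> L2 M \<Longrightarrow> l2_norm M (E c f) \<le> C0 * l2_norm M f"
        using bounded_operator_bound[OF Eop] by blast
      define C where "C = C0 + 1"
      have C: "C > 0" using C0 by (simp add: C_def)
      define e where "e = (d1 * d2 / C)\<^sup>2"
      have e: "e > 0" using d12 C by (simp add: e_def)
      have "m\<^sup>2 + e \<le> r" if r: "r \<in> R" for r
      proof -
        obtain f where f: "f \<in> L2 M" "l2_norm M f \<noteq> 0" and r: "r = (l2_norm M (E c f))\<^sup>2 / (l2_norm M f)\<^sup>2"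
          using r by (auto simp: R_def)
        \<comment> \<open>\<open>g\<close> is A f, because E_(c+m) E_(c-m) = (E_c + m)(E_c - m) =
          E_c^2 - m^2. Both factors are bounded below, hence so is A.\<close>
        define g where "g = E (c + m) (E (c - m) f)"
        have g: "g \<in> L2 M" using f by (simp add: g_def)
        have Ec: "(l2_norm M (E c g))\<^sup>2 \<le> C\<^sup>2 * (l2_norm M g)\<^sup>2"
        proof -
          have "l2_norm M (E c g) \<le> C * l2_norm M g"
            using C0(2)[OF g] by (simp add: C_def distrib_right add_increasing2)
          then show ?thesis using power_mono[of _ _ 2] by (fastforce simp: power_mult_distrib)
        qed
        have gg: "d1 * d2 * l2_norm M f \<le> l2_norm M g"
        proof -
          have "d1 * d2 * l2_norm M f \<le> d2 * l2_norm M (E (c - m) f)"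
            using mult_left_mono[OF d1[OF f(1)], of d2] d12 by (simp add: mult_ac)
          also have "\<dots> \<le> l2_norm M g" unfolding g_def using f by (intro d2) auto
          finally show ?thesis .
        qed
        \<comment> \<open>The form of A at the pair (f, g) is \<langle>A f, g\<rangle> =
          \<bar>\<bar>g\<bar>\<bar>^2, since \<open>g\<close> is A f.\<close>
        have B: "Re (l2_inner M (E c f) (E c g)) - m\<^sup>2 * Re (l2_inner M f g) = (l2_norm M g)\<^sup>2"
        proof -
          have "(l2_norm M g)\<^sup>2 = Re (l2_inner M (E (c - m) f) (E (c + m) g))"
            unfolding Re_l2_inner_self[symmetric] using Esa[of "E (c - m) f" g "c + m"] f g
            by (simp add: g_def)
          also have "\<dots> = Re (l2_inner M (E c f) (E c g)) - m\<^sup>2 * Re (l2_inner M f g)"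
            unfolding E_def using f g selfadjoint[OF f(1) g]
            by (simp add: algebra_simps power2_eq_square)
          finally show ?thesis by simp
        qed
        \<comment> \<open>The form of A at f + \<tau> g is nonnegative and at most \<langle>A f,
          f\<rangle> + (2 \<tau> + \<tau>^2 C^2) \<bar>\<bar>g\<bar>\<bar>^2. The choice \<tau> = -1
          / C^2 minimizes this and leaves \<bar>\<bar>A f\<bar>\<bar>^2 / C^2 \<le> \<langle>A f,
          f\<rangle>; the lower bound on A then lifts every Rayleigh quotient by
          \<open>e\<close>.\<close>
        define \<tau> where "\<tau> = - 1 / C\<^sup>2"
        define h where "h = (\<lambda>x. f x + complex_of_real \<tau> * g x)"
        have h: "h \<in> L2 M" using f g by (auto simp: h_def)
        have "AE x in M. E c h x = E c f x + complex_of_real \<tau> * E c g x"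
          using bounded_operator_add[OF Eop f(1) L2_cmult[OF g, of "complex_of_real \<tau>"], of c]
            bounded_operator_cmult[OF Eop g, of c "complex_of_real \<tau>"]
          unfolding h_def by eventually_elim simp
        then have "l2_norm M (E c h) = l2_norm M (\<lambda>x. E c f x + complex_of_real \<tau> * E c g x)"
          using f g h by (intro l2_norm_cong_AE) auto
        then have "(l2_norm M (E c h))\<^sup>2
            = (l2_norm M (E c f))\<^sup>2 + 2 * \<tau> * Re (l2_inner M (E c f) (E c g)) + \<tau>\<^sup>2 * (l2_norm M (E c g))\<^sup>2"
          using f g by (simp add: l2_norm_add_power2 power_mult_distrib)
        moreover have "(l2_norm M h)\<^sup>2 = (l2_norm M f)\<^sup>2 + 2 * \<tau> * Re (l2_inner M f g) + \<tau>\<^sup>2 * (l2_norm M g)\<^sup>2"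
          unfolding h_def using f g by (simp add: l2_norm_add_power2 power_mult_distrib)
        ultimately have "0 \<le> (l2_norm M (E c f))\<^sup>2 - m\<^sup>2 * (l2_norm M f)\<^sup>2
            + 2 * \<tau> * (Re (l2_inner M (E c f) (E c g)) - m\<^sup>2 * Re (l2_inner M f g))
            + \<tau>\<^sup>2 * ((l2_norm M (E c g))\<^sup>2 - m\<^sup>2 * (l2_norm M g)\<^sup>2)"
          using low[OF h] by (simp add: algebra_simps)
        also have "\<dots> \<le> (l2_norm M (E c f))\<^sup>2 - m\<^sup>2 * (l2_norm M f)\<^sup>2
            + 2 * \<tau> * (l2_norm M g)\<^sup>2 + \<tau>\<^sup>2 * (C\<^sup>2 * (l2_norm M g)\<^sup>2)"
          unfolding B by (intro add_mono order_refl mult_left_mono order_trans[OF _ Ec]) auto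
        also have "\<dots> = (l2_norm M (E c f))\<^sup>2 - m\<^sup>2 * (l2_norm M f)\<^sup>2 - (l2_norm M g)\<^sup>2 / C\<^sup>2"
          using C by (simp add: \<tau>_def field_simps power2_eq_square)
        finally have "(l2_norm M g / C)\<^sup>2 + m\<^sup>2 * (l2_norm M f)\<^sup>2 \<le> (l2_norm M (E c f))\<^sup>2"
          by (simp add: power_divide)
        moreover have "(d1 * d2 / C * l2_norm M f)\<^sup>2 \<le> (l2_norm M g / C)\<^sup>2"
          using gg C d12 by (intro power_mono) (auto simp: field_simps)
        ultimately have "(m\<^sup>2 + e) * (l2_norm M f)\<^sup>2 \<le> (l2_norm M (E c f))\<^sup>2"
          unfolding e_def power_mult_distrib[of _ "l2_norm M f"] by (simp add: distrib_right)
        then show ?thesis using f(2) by (simp add: r field_simps)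
      qed
      then have "m\<^sup>2 + e \<le> Inf R" by (intro cInf_greatest Rne)
      then show False using e m2 by simp
    qed
    then have "d\<^sup>2 * (l2_norm M f)\<^sup>2 \<le> m\<^sup>2 * (l2_norm M f)\<^sup>2"
      using d0 by (intro mult_right_mono power_mono) auto
    also have "\<dots> \<le> (l2_norm M (E c f))\<^sup>2" by (rule low[OF f])
    finally show ?thesis .
  qed simp
  also have "(l2_norm M (E c f))\<^sup>2 = c\<^sup>2 * (l2_norm M f)\<^sup>2 - 2 * c * Re (l2_inner M (Q f) f) + (l2_norm M (Q f))\<^sup>2"
    unfolding E_def using f
    by (subst l2_norm_diff_power2) (simp_all add: power_mult_distrib Re_l2_inner_commute[of M f])
  \<comment> \<open>Since c - d = s and c + d = 1, the difference (Q - c)^2 - d^2 is (Q - s)(Q -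
    1).\<close>
  finally have "0 \<le> (l2_norm M (Q f))\<^sup>2 - 2 * c * Re (l2_inner M (Q f) f) + (c\<^sup>2 - d\<^sup>2) * (l2_norm M f)\<^sup>2"
    by (simp add: left_diff_distrib)
  moreover have "c\<^sup>2 - d\<^sup>2 = s" by (simp add: c_def d_def power2_eq_square field_simps)
  moreover have "2 * c = 1 + s" by (simp add: c_def)
  ultimately show ?thesis by simp
qed

lemma inner_funpow:
  assumes f: "f \<in> L2 M"
  shows "l2_inner M ((Q ^^ i) f) ((Q ^^ j) f) = l2_inner M ((Q ^^ (i + j)) f) f"
proof (induction j arbitrary: i)
  case (Suc j)
  have "(Q ^^ n) f \<in> L2 M" for n using f by (induction n) auto
  then show ?case using Suc[of "Suc i"] by (simp add: selfadjoint)
qed simp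

text \<open>The squared distance of successive iterates decays geometrically, so the iterates converge to a
  fixed point of \<open>Q\<close>, which is constant and hence zero.\<close>

lemma form_le_of_gap:
  assumes s: "0 < s" "s < 1"
    and gap: "\<And>t. s < t \<Longrightarrow> t < 1 \<Longrightarrow> \<exists>S. l2_is_inverse M (\<lambda>f x. complex_of_real t * f x - Q f x) S"
    and simple: "l2_simple_eigenvalue M Q 1"
    and M: "prob_space M" and Q1: "AE x in M. Q (\<lambda>x. 1) x = 1"
    and f: "f \<in> L2 M" and f1: "l2_inner M f (\<lambda>x. 1) = 0"
  shows "Re (l2_inner M (Q f) f) \<le> s * (l2_norm M f)\<^sup>2"
proof -
  interpret prob_space M by fact
  define u where "u = (\<lambda>n. (Q ^^ n) f)"
  have u0: "u 0 = f" and uS: "u (Suc n) = Q (u n)" for n by (simp_all add: u_def)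
  have uL [simp]: "u n \<in> L2 M" for n by (induction n) (simp_all add: u0 uS f)
  define a where "a = (\<lambda>n. Re (l2_inner M (u n) f))"
  have a: "Re (l2_inner M (u i) (u j)) = a (i + j)" for i j
    unfolding a_def u_def by (simp add: inner_funpow f)
  have na: "(l2_norm M (u i))\<^sup>2 = a (2 * i)" for i
    using a[of i i] by (simp add: Re_l2_inner_self mult_2)
  \<comment> \<open>These are the numbers \<langle>Q^n (I - Q) f, f\<rangle>. The aim is w (n + 1)
    \<le> s w n; even and odd n need different positive operators.\<close>
  define w where "w = (\<lambda>n. a n - a (Suc n))"
  have w_even: "0 \<le> w (2 * n)" for n
  proof -
    have "a (Suc (2 * n)) \<le> l2_norm M (Q (u n)) * l2_norm M (u n)"
      using a[of "Suc n" n] l2_Cauchy_Schwarz[of "Q (u n)" M "u n"]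
        complex_Re_le_cmod[of "l2_inner M (Q (u n)) (u n)"] by (simp add: uS mult_2)
    also have "\<dots> \<le> (l2_norm M (u n))\<^sup>2"
      unfolding power2_eq_square by (intro mult_right_mono Q_contraction) auto
    finally show ?thesis by (simp add: w_def na)
  qed
  \<comment> \<open>\<open>gap_form\<close> at Q^n f reads a (2n+2) - (1 + s) a (2n+1) + s a (2n)
    \<ge> 0, which regroups to the claim.\<close>
  have w_odd: "w (Suc (2 * n)) \<le> s * w (2 * n)" for n
    using gap_form[OF s(2) gap uL[of n]] a[of "Suc n" n] na[of n] na[of "Suc n"]
    by (simp add: uS w_def mult_2 mult_2_right algebra_simps)
  \<comment> \<open>Squares of iterates reach only even indices, so positivity of Q - Q^2 is used
    instead, on (1 + \<tau> Q) Q^n f. It gives w (2n+1) + 2 \<tau> w (2n+2) + \<tau>^2 w (2n+3)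
    \<ge> 0. Once w (2n+3) \<le> s w (2n+2) is inserted, \<tau> = -1 / s is the best choice.\<close>
  have w_step: "w (Suc (Suc (2 * n))) \<le> s * w (Suc (2 * n))" for n
  proof -
    define \<tau> where "\<tau> = - 1 / s"
    define x where "x = (\<lambda>y. u n y + complex_of_real \<tau> * u (Suc n) y)"
    have x: "x \<in> L2 M" by (simp add: x_def)
    have Qx: "AE y in M. Q x y = u (Suc n) y + complex_of_real \<tau> * u (Suc (Suc n)) y"
      using bounded_operator_add[OF Q uL[of n] L2_cmult[OF uL[of "Suc n"], of "complex_of_real \<tau>"]]
        bounded_operator_cmult[OF Q uL[of "Suc n"], of "complex_of_real \<tau>"]
      unfolding x_def by eventually_elim (simp add: uS)
    let ?y = "\<lambda>y. u (Suc n) y + complex_of_real \<tau> * u (Suc (Suc n)) y"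
    have form: "(l2_norm M ?y)\<^sup>2 \<le> Re (l2_inner M ?y x)"
      using firm[OF x] l2_norm_cong_AE[OF Qx] l2_inner_cong_AE[OF Qx AE_I2, of x x] x by simp
    define k where "k = 2 * n"
    have e: "Re (l2_inner M (u (Suc n)) (u n)) = a (Suc k)"
      "Re (l2_inner M (u (Suc n)) (u (Suc n))) = a (k + 2)"
      "Re (l2_inner M (u (Suc (Suc n))) (u n)) = a (k + 2)"
      "Re (l2_inner M (u (Suc (Suc n))) (u (Suc n))) = a (k + 3)"
      "Re (l2_inner M (u (Suc n)) (u (Suc (Suc n)))) = a (k + 3)"
      "(l2_norm M (u (Suc n)))\<^sup>2 = a (k + 2)" "(l2_norm M (u (Suc (Suc n))))\<^sup>2 = a (k + 4)"
      unfolding a na by (auto intro!: arg_cong[of _ _ a] simp: k_def)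
    have "(l2_norm M ?y)\<^sup>2 = a (k + 2) + 2 * \<tau> * a (k + 3) + \<tau>\<^sup>2 * a (k + 4)"
      by (subst l2_norm_add_power2) (simp_all add: e power_mult_distrib)
    moreover have "Re (l2_inner M ?y x) = a (Suc k) + 2 * \<tau> * a (k + 2) + \<tau>\<^sup>2 * a (k + 3)"
      unfolding x_def by (simp add: e) (simp add: algebra_simps power2_eq_square)
    ultimately have "0 \<le> w (Suc k) + 2 * \<tau> * w (k + 2) + \<tau>\<^sup>2 * w (k + 3)"
      using form by (simp add: w_def algebra_simps numeral_eq_Suc)
    also have "w (k + 3) \<le> s * w (k + 2)" using w_odd[of "Suc n"] by (simp add: k_def numeral_3_eq_3)
    then have "w (Suc k) + 2 * \<tau> * w (k + 2) + \<tau>\<^sup>2 * w (k + 3)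
        \<le> w (Suc k) + 2 * \<tau> * w (k + 2) + \<tau>\<^sup>2 * (s * w (k + 2))"
      by (intro add_left_mono mult_left_mono) auto
    also have "\<dots> = w (Suc k) - w (k + 2) / s"
      using s by (simp add: \<tau>_def field_simps power2_eq_square)
    finally show ?thesis using s by (simp add: field_simps k_def)
  qed
  have w_Suc: "w (Suc n) \<le> s * w n" for n
    by (cases "even n") (auto elim!: evenE oddE simp: w_odd w_step)
  have w_le: "w n \<le> s ^ n * w 0" for n
  proof (induction n)
    case (Suc n)
    have "w (Suc n) \<le> s * w n" by (rule w_Suc)
    also have "\<dots> \<le> s * (s ^ n * w 0)" using s Suc by (intro mult_left_mono) auto
    finally show ?case by (simp add: mult.assoc)
  qed simp
  have w0: "0 \<le> w 0" using w_even[of 0] by simp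
  \<comment> \<open>Here w (2n+2) \<ge> 0 and w (2n+2) \<le> s w (2n+1) with s > 0.\<close>
  have w_odd_nonneg: "0 \<le> w (Suc (2 * n))" for n
    using w_even[of "Suc n"] w_Suc[of "Suc (2 * n)"] s
    by (simp add: zero_le_mult_iff) (smt (verit) mult_pos_neg)
  have d: "l2_norm M (\<lambda>x. u n x - u (Suc n) x) \<le> s ^ n * sqrt (w 0)" for n
  proof (rule power2_le_imp_le)
    have "(l2_norm M (\<lambda>x. u n x - u (Suc n) x))\<^sup>2 = w (2 * n) - w (Suc (2 * n))"
    proof -
      have "Re (l2_inner M (u n) (u (Suc n))) = a (Suc (2 * n))"
        unfolding a by (rule arg_cong[of _ _ a]) simp
      then show ?thesis using na[of n] na[of "Suc n"] by (simp add: l2_norm_diff_power2 w_def)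
    qed
    also have "\<dots> \<le> s ^ (2 * n) * w 0"
      using w_le[of "2 * n"] w_odd_nonneg[of n] by simp
    finally show "(l2_norm M (\<lambda>x. u n x - u (Suc n) x))\<^sup>2 \<le> (s ^ n * sqrt (w 0))\<^sup>2"
      using w0 by (simp add: power_mult_distrib power_mult mult.commute)
  qed (use s w0 in simp)
  have "summable (\<lambda>n. l2_norm M (\<lambda>x. u n x - u (Suc n) x))"
    by (rule summable_comparison_test'[OF summable_mult2[OF summable_geometric, of s "sqrt (w 0)"]])
      (use s d in auto)
  then have "\<exists>H\<in>L2 M. (\<lambda>N. l2_norm M (\<lambda>x. H x - (\<Sum>n<N. u n x - u (Suc n) x))) \<longlonglongrightarrow> 0"
    by (intro L2_summable) simp_all
  then obtain H where H: "H \<in> L2 M"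
    and Hlim: "(\<lambda>N. l2_norm M (\<lambda>x. H x - (\<Sum>n<N. u n x - u (Suc n) x))) \<longlonglongrightarrow> 0"
    by blast
  \<comment> \<open>\<open>H\<close> is the sum of all steps \<open>u n - u (Suc n)\<close>, so
    \<open>f - H\<close> is the limit of the iterates.\<close>
  define h where "h = (\<lambda>x. f x - H x)"
  have h: "h \<in> L2 M" using f H by (simp add: h_def)
  have tele: "(\<Sum>n<N. u n x - u (Suc n) x) = f x - u N x" for N x
    by (induction N) (auto simp: u0)
  have lim: "l2_tendsto M u h"
  proof (rule l2_tendstoI[OF h uL Hlim])
    show "l2_norm M (\<lambda>x. u n x - h x) \<le> l2_norm M (\<lambda>x. H x - (\<Sum>n<n. u n x - u (Suc n) x))" for n
      unfolding tele h_def by (simp add: algebra_simps)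
  qed
  have "l2_tendsto M (\<lambda>n. u (Suc n)) h"
    using lim LIMSEQ_Suc unfolding l2_tendsto_def by blast
  then have "AE x in M. Q h x = h x"
    using l2_tendsto_op[OF lim Q] unfolding uS by (rule l2_tendsto_unique[rotated])
  then have "h \<in> l2_eigenspace M Q 1" "(\<lambda>x. 1) \<in> l2_eigenspace M Q 1"
    using h Q1 by (auto simp: l2_eigenspace_def)
  \<comment> \<open>The eigenspace is spanned by one vector \<open>h0\<close>. The constant 1 is the
    multiple \<open>c' * h0\<close>, so \<open>c'\<close> is not 0 and \<open>h0\<close>, hence
    \<open>h\<close>, is constant almost everywhere.\<close>
  then obtain h0 c c' where "AE x in M. h x = c * h0 x" and c': "AE x in M. 1 = c' * h0 x"
    using simple unfolding l2_simple_eigenvalue_def by meson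
  then have hk: "AE x in M. h x = c / c'"
  proof eventually_elim
    case (elim x)
    then have "c' \<noteq> 0" by auto
    then have "h0 x = 1 / c'" using elim(2) by (simp add: field_simps)
    then show ?case using elim(1) by simp
  qed
  have "l2_inner M (u n) (\<lambda>x. 1) = 0" for n
  proof (induction n)
    case (Suc n)
    have "l2_inner M (Q (u n)) (\<lambda>x. 1) = l2_inner M (u n) (Q (\<lambda>x. 1))"
      by (simp add: selfadjoint)
    also have "\<dots> = l2_inner M (u n) (\<lambda>x. 1)"
      using Q1 by (intro l2_inner_cong_AE) auto
    finally show ?case using Suc by (simp add: uS)
  qed (simp add: u0 f1)
  then have "l2_inner M h (\<lambda>x. 1) = 0"
    using l2_tendsto_inner[OF lim, of "\<lambda>x. 1"] by (simp add: LIMSEQ_const_iff)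
  moreover have "l2_inner M h (\<lambda>x. 1) = l2_inner M (\<lambda>x. c / c') (\<lambda>x. 1)"
    using hk h by (intro l2_inner_cong_AE) auto
  ultimately have "c / c' = 0" by (simp add: l2_inner_def prob_space)
  with hk have "AE x in M. h x = 0" by simp
  then have "l2_norm M h = 0" using h by (simp add: l2_norm_eq_0_iff)
  then have "(\<lambda>n. a (2 * n)) \<longlonglongrightarrow> 0"
    using tendsto_power[OF l2_tendsto_norm[OF lim], of 2] by (simp add: na)
  then have "(\<lambda>N. a 0 - a (2 * N)) \<longlonglongrightarrow> a 0 - 0" by (intro tendsto_intros)
  moreover have "a 0 - a (2 * N) \<le> w 0 / (1 - s)" for N
  proof -
    have "a 0 - a (2 * N) = (\<Sum>n<2 * N. w n)"
      unfolding w_def by (rule sum_lessThan_telescope'[symmetric])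
    also have "\<dots> \<le> (\<Sum>n<2 * N. s ^ n * w 0)" by (intro sum_mono w_le)
    also have "\<dots> = (\<Sum>n<2 * N. s ^ n) * w 0" by (simp add: sum_distrib_right)
    also have "\<dots> \<le> (1 / (1 - s)) * w 0"
      using s w0 by (intro mult_right_mono) (simp_all add: sum_gp_strict divide_right_mono)
    finally show ?thesis by simp
  qed
  \<comment> \<open>The even moments are the squared norms of the iterates and tend to 0, so the
    telescoping sum of the \<open>w n\<close> exhausts all of \<open>a 0\<close>.\<close>
  ultimately have "a 0 \<le> w 0 / (1 - s)"
    by (intro LIMSEQ_le_const2[of _ "a 0"]) auto
  \<comment> \<open>As w 0 = a 0 - a 1, the bound rearranges to the claim about a 1 = \<langle>Q f,
    f\<rangle>.\<close>
  then have "a 1 \<le> s * a 0" using s by (simp add: w_def field_simps)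
  then show ?thesis using na[of 0] by (simp add: a_def u_def)
qed

lemma spectrum_bounds:
  assumes "complex_of_real t \<in> l2_spectrum M Q" shows "0 \<le> t" "t \<le> 1"
proof -
  have "\<not> (t < 0 \<or> 1 < t)"
    using assms resolvent_outside[of t] unfolding l2_spectrum_def by blast
  then show "0 \<le> t" "t \<le> 1" by auto
qed

text \<open>The spectrum lies in [0, 1], and an empty remainder is read as supremum 0. This bound
  also makes the family defining the pseudo spectral gap bounded above.\<close>

lemma spectral_gap_le_1: "spectral_gap M Q \<le> 1"
proof -
  define S where "S = {t::real. complex_of_real t \<in> l2_spectrum M Q \<and> t \<noteq> 1}"
  have "bdd_above S" using spectrum_bounds by (intro bdd_aboveI[of _ 1]) (auto simp: S_def)
  then have "0 \<le> Sup S" if "S \<noteq> {}"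
    using that spectrum_bounds(1) by (auto simp: S_def intro: cSup_upper2)
  then show ?thesis by (simp add: spectral_gap_def Let_def flip: S_def)
qed

text \<open>Strictness of g < gap \<le> 1 gives s = 1 - g > 0, so \<open>form_le_of_gap\<close>
  applies even when the gap equals 1.\<close>

lemma form_le_of_spectral_gap:
  assumes g: "0 < g" "g < spectral_gap M Q"
    and M: "prob_space M" and Q1: "AE x in M. Q (\<lambda>x. 1) x = 1"
    and f: "f \<in> L2 M" "l2_inner M f (\<lambda>x. 1) = 0"
  shows "Re (l2_inner M (Q f) f) \<le> (1 - g) * (l2_norm M f)\<^sup>2"
proof -
  define S where "S = {t::real. complex_of_real t \<in> l2_spectrum M Q \<and> t \<noteq> 1}"
  have eq: "spectral_gap M Q
      = (if l2_simple_eigenvalue M Q 1 then 1 - (if S = {} then 0 else Sup S) else 0)"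
    by (simp add: spectral_gap_def Let_def flip: S_def)
  then have simple: "l2_simple_eigenvalue M Q 1" using g by (auto split: if_splits)
  have bdd: "bdd_above S" using spectrum_bounds by (intro bdd_aboveI[of _ 1]) (auto simp: S_def)
  show ?thesis
  proof (rule form_le_of_gap[OF _ _ _ simple M Q1 f])
    show "0 < 1 - g" using g spectral_gap_le_1 by simp
    show "1 - g < 1" using g by simp
    fix t assume t: "1 - g < t" "t < 1"
    show "\<exists>S. l2_is_inverse M (\<lambda>f x. complex_of_real t * f x - Q f x) S"
    proof (rule ccontr)
      assume "\<not> ?thesis"
      then have "t \<in> S" using t by (simp add: S_def l2_spectrum_def)
      then have "t \<le> Sup S" "S \<noteq> {}" using bdd by (auto intro: cSup_upper)
      then show False using eq simple g t by simp
    qed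
  qed
qed

end

section \<open>The adjoint of a Markov operator\<close>

lemma integrable_bind_kernel:
  fixes f :: "'b \<Rightarrow> 'c::{banach, second_countable_topology}"
  assumes K: "K \<in> N \<rightarrow>\<^sub>M subprob_algebra B" and N: "space N \<noteq> {}"
    and f: "integrable (N \<bind> K) f"
  shows AE_integrable_bind_kernel: "AE x in N. integrable (K x) f"
    and integrable_bind_kernel_iterated: "integrable N (\<lambda>x. \<integral>y. f y \<partial>K x)"
proof -
  have fm [measurable]: "f \<in> borel_measurable B"
    using borel_measurable_integrable[OF f] by (simp add: measurable_cong_sets[OF sets_bind[OF sets_kernel[OF K] N] refl])
  have fK: "f \<in> borel_measurable (K x)" if "x \<in> space N" for x
    using fm by (simp add: measurable_cong_sets[OF sets_kernel[OF K that] refl])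
  have [measurable]: "(\<lambda>x. \<integral>\<^sup>+y. norm (f y) \<partial>K x) \<in> borel_measurable N"
    by (rule measurable_compose[OF K nn_integral_measurable_subprob_algebra]) measurable
  have [measurable]: "(\<lambda>x. \<integral>y. f y \<partial>K x) \<in> borel_measurable N"
    by (rule measurable_compose[OF K integral_measurable_subprob_algebra]) measurable
  have fin: "(\<integral>\<^sup>+x. \<integral>\<^sup>+y. norm (f y) \<partial>K x \<partial>N) < \<infinity>"
    using f K by (subst nn_integral_bind[symmetric, of _ B]) (auto simp: integrable_iff_bounded)
  then have "AE x in N. (\<integral>\<^sup>+y. norm (f y) \<partial>K x) \<noteq> \<infinity>"
    by (intro nn_integral_PInf_AE) auto
  with AE_space show ae: "AE x in N. integrable (K x) f"
    by eventually_elim (auto simp: integrable_iff_bounded less_top fK)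
  have "(\<integral>\<^sup>+x. norm (\<integral>y. f y \<partial>K x) \<partial>N) \<le> (\<integral>\<^sup>+x. \<integral>\<^sup>+y. norm (f y) \<partial>K x \<partial>N)"
    by (rule nn_integral_mono_AE, use ae in eventually_elim) (rule integral_norm_bound_ennreal)
  with fin show "integrable N (\<lambda>x. \<integral>y. f y \<partial>K x)"
    by (intro integrableI_bounded) auto
qed

text \<open>The iterated formula is inherited from the nonnegative Lebesgue integral. Real
  integrands follow by positive and negative parts, complex ones by real and imaginary
  parts.\<close>

lemma integral_bind_kernel_nonneg:
  fixes f :: "'b \<Rightarrow> real"
  assumes K: "K \<in> N \<rightarrow>\<^sub>M subprob_algebra B" and N: "space N \<noteq> {}"
    and f: "integrable (N \<bind> K) f" "\<And>x. 0 \<le> f x"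
  shows "(\<integral>y. f y \<partial>(N \<bind> K)) = (\<integral>x. \<integral>y. f y \<partial>K x \<partial>N)"
proof -
  have [measurable]: "f \<in> borel_measurable B"
    using borel_measurable_integrable[OF f(1)] by (simp add: measurable_cong_sets[OF sets_bind_measurable[OF K N] refl])
  have "ennreal (\<integral>y. f y \<partial>(N \<bind> K)) = (\<integral>\<^sup>+y. ennreal (f y) \<partial>(N \<bind> K))"
    using f by (simp add: nn_integral_eq_integral)
  also have "\<dots> = (\<integral>\<^sup>+x. \<integral>\<^sup>+y. ennreal (f y) \<partial>K x \<partial>N)"
    using K by (intro nn_integral_bind[of _ B]) auto
  also have "\<dots> = (\<integral>\<^sup>+x. ennreal (\<integral>y. f y \<partial>K x) \<partial>N)"
    by (rule nn_integral_cong_AE, use AE_integrable_bind_kernel[OF K N f(1)] in eventually_elim)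
      (simp add: nn_integral_eq_integral f(2))
  also have "\<dots> = ennreal (\<integral>x. \<integral>y. f y \<partial>K x \<partial>N)"
    by (intro nn_integral_eq_integral integrable_bind_kernel_iterated[OF K N f(1)])
      (simp add: f(2))
  finally show ?thesis
    by (subst (asm) ennreal_inj) (simp_all add: f(2))
qed

lemma integral_bind_kernel_real:
  fixes f :: "'b \<Rightarrow> real"
  assumes K: "K \<in> N \<rightarrow>\<^sub>M subprob_algebra B" and N: "space N \<noteq> {}"
    and f: "integrable (N \<bind> K) f"
  shows "(\<integral>y. f y \<partial>(N \<bind> K)) = (\<integral>x. \<integral>y. f y \<partial>K x \<partial>N)"
proof -
  let ?p = "\<lambda>x. max (f x) 0" and ?m = "\<lambda>x. max (- f x) 0"
  have eq: "f = (\<lambda>x. ?p x - ?m x)" by auto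
  have int: "integrable (N \<bind> K) ?p" "integrable (N \<bind> K) ?m" using f by auto
  have "(\<integral>y. f y \<partial>(N \<bind> K)) = (\<integral>y. ?p y \<partial>(N \<bind> K)) - (\<integral>y. ?m y \<partial>(N \<bind> K))"
    by (subst eq, rule Bochner_Integration.integral_diff[OF int])
  also have "\<dots> = (\<integral>x. \<integral>y. ?p y \<partial>K x \<partial>N) - (\<integral>x. \<integral>y. ?m y \<partial>K x \<partial>N)"
    using integral_bind_kernel_nonneg[OF K N int(1)] integral_bind_kernel_nonneg[OF K N int(2)] by simp
  also have "\<dots> = (\<integral>x. (\<integral>y. ?p y \<partial>K x) - (\<integral>y. ?m y \<partial>K x) \<partial>N)"
    by (intro Bochner_Integration.integral_diff[symmetric] integrable_bind_kernel_iterated[OF K N] int)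
  also have "\<dots> = (\<integral>x. \<integral>y. f y \<partial>K x \<partial>N)"
  proof (rule integral_cong_AE)
    show "AE x in N. (\<integral>y. ?p y \<partial>K x) - (\<integral>y. ?m y \<partial>K x) = (\<integral>y. f y \<partial>K x)"
      using AE_integrable_bind_kernel[OF K N int(1)] AE_integrable_bind_kernel[OF K N int(2)]
    proof eventually_elim
      case (elim x)
      show ?case by (subst (3) eq, rule Bochner_Integration.integral_diff[OF elim, symmetric])
    qed
  qed (use integrable_bind_kernel_iterated[OF K N int(1)] integrable_bind_kernel_iterated[OF K N int(2)]
      integrable_bind_kernel_iterated[OF K N f] in auto)
  finally show ?thesis .
qed

lemma integral_bind_kernel:
  fixes f :: "'b \<Rightarrow> complex"
  assumes K: "K \<in> N \<rightarrow>\<^sub>M subprob_algebra B" and N: "space N \<noteq> {}"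
    and f: "integrable (N \<bind> K) f"
  shows "(\<integral>y. f y \<partial>(N \<bind> K)) = (\<integral>x. \<integral>y. f y \<partial>K x \<partial>N)"
proof -
  note ae = AE_integrable_bind_kernel[OF K N f]
  note it = integrable_bind_kernel_iterated[OF K N f]
  have int: "integrable (N \<bind> K) (\<lambda>x. Re (f x))" "integrable (N \<bind> K) (\<lambda>x. Im (f x))"
    using f by auto
  have "(\<integral>x. Re (\<integral>y. f y \<partial>K x) \<partial>N) = (\<integral>x. \<integral>y. Re (f y) \<partial>K x \<partial>N)"
    by (rule integral_cong_AE)
      (use ae it integrable_bind_kernel_iterated[OF K N int(1)] in \<open>auto elim!: eventually_mono\<close>)
  moreover have "(\<integral>x. Im (\<integral>y. f y \<partial>K x) \<partial>N) = (\<integral>x. \<integral>y. Im (f y) \<partial>K x \<partial>N)"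
    by (rule integral_cong_AE)
      (use ae it integrable_bind_kernel_iterated[OF K N int(2)] in \<open>auto elim!: eventually_mono\<close>)
  ultimately show ?thesis
    using integral_bind_kernel_real[OF K N int(1)] integral_bind_kernel_real[OF K N int(2)] f it
    by (intro complex_eqI) simp_all
qed

lemma l2_ext:
  assumes u: "u \<in> L2 M" and v: "v \<in> L2 M"
    and eq: "\<And>f. f \<in> L2 M \<Longrightarrow> l2_inner M f u = l2_inner M f v"
  shows "AE x in M. u x = v x"
proof -
  have "l2_inner M (\<lambda>x. u x - v x) (\<lambda>x. u x - v x) = 0"
    using u v eq[of "\<lambda>x. u x - v x"] by (simp only: l2_inner_diff_right L2_diff) simp
  then have "l2_norm M (\<lambda>x. u x - v x) = 0" by (simp add: l2_inner_self)
  then show ?thesis using u v by (simp add: l2_norm_diff_eq_0_iff)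
qed

text \<open>Pairings determine an element of \<open>L2\<close>, so an operator that has an adjoint
  is automatically linear. This settles linearity of an adjoint whose values are chosen one vector
  at a time.\<close>

lemma bounded_operatorI_adjoint:
  assumes T: "\<And>f. f \<in> L2 M \<Longrightarrow> T f \<in> L2 M" and S: "\<And>f. f \<in> L2 M \<Longrightarrow> S f \<in> L2 M"
    and adj: "\<And>f g. f \<in> L2 M \<Longrightarrow> g \<in> L2 M \<Longrightarrow> l2_inner M f (T g) = l2_inner M (S f) g"
    and bound: "\<And>f. f \<in> L2 M \<Longrightarrow> l2_norm M (T f) \<le> C * l2_norm M f"
  shows "l2_bounded_operator M T"
  unfolding l2_bounded_operator_def
proof (intro conjI ballI allI)
  show "AE x in M. T (\<lambda>y. f y + g y) x = T f x + T g x" if "f \<in> L2 M" "g \<in> L2 M" for f g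
    using that by (intro l2_ext) (simp_all add: T S adj)
  show "AE x in M. T (\<lambda>y. c * f y) x = c * T f x" if "f \<in> L2 M" for f c
    using that by (intro l2_ext) (simp_all add: T S adj)
qed (use T bound in auto)

lemma L2_dominated:
  fixes f g :: "'a \<Rightarrow> complex"
  assumes g: "g \<in> L2 M" and f [measurable]: "f \<in> borel_measurable M" and le: "\<And>x. cmod (f x) \<le> cmod (g x)"
  shows "f \<in> L2 M"
proof -
  have "integrable M (\<lambda>x. (cmod (g x))\<^sup>2)" using g by (simp add: L2_def)
  then have "integrable M (\<lambda>x. (cmod (f x))\<^sup>2)"
    by (rule Bochner_Integration.integrable_bound) (auto simp: le power_mono)
  then show ?thesis by (simp add: L2_def)
qed

section \<open>The Markov operator of a stationary kernel\<close>

locale stationary_kernel =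
  fixes P :: "'a::polish_space \<Rightarrow> 'a measure" and \<pi> :: "'a measure"
  assumes kernel: "markov_kernel P" and stationary: "stationary_dist P \<pi>"
begin

sublocale prob_space \<pi>
  using stationary by (simp add: stationary_dist_def)

lemma sets_\<pi> [simp, measurable_cong]: "sets \<pi> = sets borel"
  using stationary by (simp add: stationary_dist_def)

lemma space_\<pi> [simp]: "space \<pi> = UNIV"
  using sets_eq_imp_space_eq[OF sets_\<pi>] by simp

lemma bind_\<pi>: "\<pi> \<bind> P = \<pi>"
  using stationary by (simp add: stationary_dist_def)

lemma P_prob_algebra [measurable]: "P \<in> borel \<rightarrow>\<^sub>M prob_algebra borel"
  using kernel by (simp add: markov_kernel_def)

lemma P_borel: "P \<in> borel \<rightarrow>\<^sub>M subprob_algebra borel"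
  by (rule measurable_prob_algebraD) (rule P_prob_algebra)

lemma P_\<pi>: "P \<in> \<pi> \<rightarrow>\<^sub>M subprob_algebra borel"
  using P_borel by (simp add: measurable_cong_sets[OF sets_\<pi> refl])

lemma prob_space_P: "prob_space (P x)" and sets_P [simp, measurable_cong]: "sets (P x) = sets borel"
  using measurable_space[OF P_prob_algebra, of x] by (auto simp: space_prob_algebra)

lemma measurable_\<pi> [simp]: "f \<in> borel_measurable \<pi> \<longleftrightarrow> f \<in> borel_measurable borel"
  by (rule measurable_cong_sets[THEN eqset_imp_iff]) simp_all

lemma AE_integrable_P:
  fixes f :: "'a \<Rightarrow> 'c::{banach, second_countable_topology}"
  shows "integrable \<pi> f \<Longrightarrow> AE x in \<pi>. integrable (P x) f"
  by (rule AE_integrable_bind_kernel[OF P_\<pi>]) (simp_all add: bind_\<pi>)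

lemma integrable_P:
  fixes f :: "'a \<Rightarrow> 'c::{banach, second_countable_topology}"
  shows "integrable \<pi> f \<Longrightarrow> integrable \<pi> (\<lambda>x. \<integral>y. f y \<partial>P x)"
  by (rule integrable_bind_kernel_iterated[OF P_\<pi>]) (simp_all add: bind_\<pi>)

lemma integral_markov_op: "integrable \<pi> f \<Longrightarrow> (\<integral>x. markov_op P f x \<partial>\<pi>) = (\<integral>x. f x \<partial>\<pi>)"
  using integral_bind_kernel[OF P_\<pi>, of f] by (simp add: bind_\<pi> markov_op_def)

lemma markov_op_measurable [measurable (raw)]:
  "f \<in> borel_measurable borel \<Longrightarrow> markov_op P f \<in> borel_measurable borel"
  unfolding markov_op_def by (rule measurable_compose[OF P_borel integral_measurable_subprob_algebra])

lemma L2_borel: "f \<in> L2 \<pi> \<Longrightarrow> f \<in> borel_measurable borel"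
  by (simp add: L2_def)

text \<open>Jensen's inequality, proved as Cauchy-Schwarz against the constant 1 under the
  probability \<open>P x\<close>: the square of \<bar>P f\<bar> is at most P applied to
  \<bar>f\<bar>^2. Integration over \<pi> removes the outer P by stationarity.\<close>

lemma markov_op_contraction:
  assumes f: "f \<in> L2 \<pi>"
  shows markov_op_L2: "markov_op P f \<in> L2 \<pi>"
    and markov_op_norm_le: "l2_norm \<pi> (markov_op P f) \<le> l2_norm \<pi> f"
proof -
  note [measurable] = L2_borel[OF f]
  have "AE x in \<pi>. integrable (P x) (\<lambda>x. (cmod (f x))\<^sup>2)"
    using f by (intro AE_integrable_P) (simp add: L2_def)
  then have ae: "AE x in \<pi>. ennreal ((cmod (markov_op P f x))\<^sup>2) \<le> (\<integral>\<^sup>+y. ennreal ((cmod (f y))\<^sup>2) \<partial>P x)"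
  proof eventually_elim
    case (elim x)
    interpret Px: prob_space "P x" by (rule prob_space_P)
    have fx: "f \<in> L2 (P x)" using elim by (simp add: L2_def measurable_cong_sets[OF sets_P refl])
    have "l2_norm (P x) (\<lambda>x. 1) = 1" by (simp add: l2_norm_def Px.prob_space)
    then have "cmod (markov_op P f x) \<le> l2_norm (P x) f"
      using l2_Cauchy_Schwarz[OF fx Px.L2_const[of 1]] by (simp add: l2_inner_def markov_op_def)
    then show ?case
      unfolding nn_integral_l2_norm[OF fx] by (intro ennreal_leI power_mono) auto
  qed
  have "(\<integral>\<^sup>+x. ennreal ((cmod (markov_op P f x))\<^sup>2) \<partial>\<pi>) \<le> (\<integral>\<^sup>+x. \<integral>\<^sup>+y. ennreal ((cmod (f y))\<^sup>2) \<partial>P x \<partial>\<pi>)"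
    using ae by (rule nn_integral_mono_AE)
  also have "\<dots> = (\<integral>\<^sup>+x. ennreal ((cmod (f x))\<^sup>2) \<partial>\<pi>)"
    by (subst nn_integral_bind[OF _ P_\<pi>, symmetric]) (simp_all add: bind_\<pi>)
  also have "\<dots> \<le> ennreal ((l2_norm \<pi> f)\<^sup>2)" by (simp add: nn_integral_l2_norm f)
  finally have *: "(\<integral>\<^sup>+x. ennreal ((cmod (markov_op P f x))\<^sup>2) \<partial>\<pi>) \<le> ennreal ((l2_norm \<pi> f)\<^sup>2)" .
  have m: "markov_op P f \<in> borel_measurable \<pi>" by simp
  show "markov_op P f \<in> L2 \<pi>" "l2_norm \<pi> (markov_op P f) \<le> l2_norm \<pi> f"
    using L2_bound_nn_integral[OF m * l2_norm_nonneg] by auto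
qed

lemma markov_op_bounded: "l2_bounded_operator \<pi> (markov_op P)"
  unfolding l2_bounded_operator_def
proof (intro conjI ballI allI)
  show "markov_op P f \<in> L2 \<pi>" if "f \<in> L2 \<pi>" for f using that by (rule markov_op_L2)
  show "AE x in \<pi>. markov_op P (\<lambda>y. f y + g y) x = markov_op P f x + markov_op P g x"
    if "f \<in> L2 \<pi>" "g \<in> L2 \<pi>" for f g
    using AE_integrable_P[OF L2_integrable[OF that(1)]] AE_integrable_P[OF L2_integrable[OF that(2)]]
    by eventually_elim (simp add: markov_op_def)
  show "AE x in \<pi>. markov_op P (\<lambda>y. c * f y) x = c * markov_op P f x" for c f
    by (simp add: markov_op_def)
  show "\<exists>C. \<forall>f\<in>L2 \<pi>. l2_norm \<pi> (markov_op P f) \<le> C * l2_norm \<pi> f"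
    using markov_op_norm_le by (intro exI[of _ 1]) auto
qed

lemma markov_op_const [simp]: "markov_op P (\<lambda>x. c) = (\<lambda>x. c)"
  by (simp add: markov_op_def fun_eq_iff prob_space.prob_space[OF prob_space_P])

lemma funpow_markov_op:
  assumes f: "f \<in> L2 \<pi>"
  shows funpow_markov_op_L2: "(markov_op P ^^ n) f \<in> L2 \<pi>"
    and funpow_markov_op_norm_le: "l2_norm \<pi> ((markov_op P ^^ n) f) \<le> l2_norm \<pi> f"
    and funpow_markov_op_centered:
      "(\<integral>x. (markov_op P ^^ n) f x \<partial>\<pi>) = (\<integral>x. f x \<partial>\<pi>)"
proof (induction n)
  case (Suc n)
  { case 1 show ?case using Suc by (simp add: markov_op_L2) }
  { case 2 show ?case using markov_op_norm_le[OF Suc(1)] Suc(2) by simp }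
  { case 3 show ?case using integral_markov_op[OF L2_integrable[OF Suc(1)]] Suc(3) by simp }
qed (use f in auto)

text \<open>The adjoint applied to \<open>g\<close> is the density of the image under \<open>P\<close> of the measure with density \<open>g\<close>;
  truncation shows that it is square integrable.\<close>

lemma adjoint_exists_nonneg:
  fixes g :: "'a \<Rightarrow> real"
  assumes g: "(\<lambda>x. complex_of_real (g x)) \<in> L2 \<pi>" and g0: "\<And>x. 0 \<le> g x"
  shows "\<exists>h\<in>L2 \<pi>. \<forall>f\<in>L2 \<pi>. l2_inner \<pi> (markov_op P f) (\<lambda>x. complex_of_real (g x)) = l2_inner \<pi> f h"
proof -
  define G where "G = (\<lambda>x. complex_of_real (g x))"
  have G: "G \<in> L2 \<pi>" using g by (simp add: G_def)
  have gm [measurable]: "g \<in> borel_measurable borel"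
    using measurable_compose[OF L2_borel[OF G] borel_measurable_Re] by (simp add: G_def)
  have gint: "integrable \<pi> g" using integrable_Re[OF L2_integrable[OF G]] by (simp add: G_def)
  define N where "N = density \<pi> (\<lambda>x. ennreal (g x))"
  have setsN [simp, measurable_cong]: "sets N = sets borel" and spaceN: "space N \<noteq> {}"
    by (simp_all add: N_def)
  have KN: "P \<in> N \<rightarrow>\<^sub>M subprob_algebra borel"
    using P_borel by (simp add: measurable_cong_sets[OF setsN refl])
  define \<nu> where "\<nu> = N \<bind> P"
  have sets\<nu> [simp, measurable_cong]: "sets \<nu> = sets borel"
    unfolding \<nu>_def by (rule sets_bind_measurable[OF KN spaceN])
  have nn\<nu>: "(\<integral>\<^sup>+x. f x \<partial>\<nu>) = (\<integral>\<^sup>+x. ennreal (g x) * (\<integral>\<^sup>+y. f y \<partial>P x) \<partial>\<pi>)"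
    if [measurable]: "f \<in> borel_measurable borel" for f
  proof -
    have [measurable]: "(\<lambda>x. \<integral>\<^sup>+y. f y \<partial>P x) \<in> borel_measurable borel"
      by (rule measurable_compose[OF P_borel nn_integral_measurable_subprob_algebra]) measurable
    show ?thesis
      unfolding \<nu>_def nn_integral_bind[OF that KN] unfolding N_def by (subst nn_integral_density) auto
  qed
  \<comment> \<open>If A is \<pi>-null, stationarity makes the \<pi>-average of P(x, A) vanish, so
    P(x, A) = 0 for almost every x.\<close>
  have ac: "absolutely_continuous \<pi> \<nu>"
    unfolding absolutely_continuous_def
  proof
    fix A assume A: "A \<in> null_sets \<pi>"
    then have [measurable]: "A \<in> sets borel" by auto
    have "(\<integral>\<^sup>+x. (\<integral>\<^sup>+y. indicator A y \<partial>P x) \<partial>\<pi>) = (\<integral>\<^sup>+x. indicator A x \<partial>\<pi>)"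
      by (subst nn_integral_bind[OF _ P_\<pi>, symmetric]) (simp_all add: bind_\<pi>)
    also have "\<dots> = 0" using A by (simp add: null_setsD1)
    finally have "AE x in \<pi>. (\<integral>\<^sup>+y. indicator A y \<partial>P x) = 0"
      by (subst (asm) nn_integral_0_iff_AE)
        (use measurable_emeasure_kernel[OF P_borel] in auto)
    then have "(\<integral>\<^sup>+x. ennreal (g x) * (\<integral>\<^sup>+y. indicator A y \<partial>P x) \<partial>\<pi>) = (\<integral>\<^sup>+x. 0 \<partial>\<pi>)"
      by (intro nn_integral_cong_AE) auto
    then have "emeasure \<nu> A = 0" using nn\<nu>[of "indicator A"] by simp
    then show "A \<in> null_sets \<nu>" by (simp add: null_sets_def)
  qed
  obtain h0 where h0 [measurable]: "h0 \<in> borel_measurable borel" and dens: "density \<pi> h0 = \<nu>"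
    using Radon_Nikodym[OF ac] by auto
  \<comment> \<open>The image measure has the finite mass of \<open>g\<close>, so its density is
    finite almost everywhere and may be replaced by a real function.\<close>
  have "(\<integral>\<^sup>+x. h0 x \<partial>\<pi>) = (\<integral>\<^sup>+x. 1 \<partial>\<nu>)"
    unfolding dens[symmetric] by (subst nn_integral_density) auto
  also have "\<dots> = (\<integral>\<^sup>+x. ennreal (g x) \<partial>\<pi>)"
    by (subst nn\<nu>) (simp_all add: prob_space.emeasure_space_1[OF prob_space_P])
  also have "\<dots> < \<infinity>" using gint g0 by (simp add: integrable_iff_bounded)
  finally have "AE x in \<pi>. h0 x \<noteq> \<infinity>" by (intro nn_integral_PInf_AE) auto
  then have h0_eq: "AE x in \<pi>. h0 x = ennreal (enn2real (h0 x))"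
    by eventually_elim (simp add: less_top)
  define h where "h = (\<lambda>x. enn2real (h0 x))"
  have h_nonneg: "0 \<le> h x" for x by (simp add: h_def)
  have [measurable]: "h \<in> borel_measurable borel" by (simp add: h_def)
  have dens': "density \<pi> (\<lambda>x. ennreal (h x)) = \<nu>"
    unfolding dens[symmetric] using h0_eq by (intro density_cong) (auto simp: h_def eq_commute)
  define H where "H = (\<lambda>x. complex_of_real (h x))"
  \<comment> \<open>With k = min h n, the integral of k^2 is at most that of h k, which equals
    \<langle>P k, g\<rangle> \<le> \<bar>\<bar>k\<bar>\<bar> \<bar>\<bar>g\<bar>\<bar>. Dividing by
    \<bar>\<bar>k\<bar>\<bar> is legitimate because the truncated function is already known to be
    square integrable.\<close>
  have trunc: "(\<integral>\<^sup>+x. ennreal ((min (h x) (real n))\<^sup>2) \<partial>\<pi>) \<le> ennreal ((l2_norm \<pi> G)\<^sup>2)" for n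
  proof -
    define k where "k = (\<lambda>x. min (h x) (real n))"
    have k0: "0 \<le> k x" and kn: "k x \<le> real n" and kh: "k x \<le> h x" for x using h_nonneg[of x] by (auto simp: k_def)
    have [measurable]: "k \<in> borel_measurable borel" by (simp add: k_def)
    have kL: "(\<lambda>x. complex_of_real (k x)) \<in> L2 \<pi>"
      by (rule L2_dominated[OF L2_const[of "complex_of_real (real n)"]]) (use k0 kn in auto)
    have kPint: "integrable (P x) k" for x
    proof -
      interpret Px: prob_space "P x" by (rule prob_space_P)
      show ?thesis by (rule Px.integrable_const_bound[of _ "real n"])
          (use k0 kn in \<open>auto simp: measurable_cong_sets[OF sets_P refl]\<close>)
    qed
    have Pk: "markov_op P (\<lambda>x. complex_of_real (k x)) x = complex_of_real (\<integral>y. k y \<partial>P x)" for x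
      by (simp add: markov_op_def)
    have inner: "l2_inner \<pi> (markov_op P (\<lambda>x. complex_of_real (k x))) G
        = complex_of_real (\<integral>x. g x * (\<integral>y. k y \<partial>P x) \<partial>\<pi>)"
      unfolding l2_inner_def Pk G_def by (simp add: mult.commute flip: of_real_mult)
    have int: "integrable \<pi> (\<lambda>x. g x * (\<integral>y. k y \<partial>P x))"
      using integrable_Re[OF L2_integrable_inner[OF markov_op_L2[OF kL] G]]
      unfolding Pk G_def by (simp add: mult.commute)
    have "(\<integral>\<^sup>+x. ennreal ((k x)\<^sup>2) \<partial>\<pi>) \<le> (\<integral>\<^sup>+x. ennreal (h x) * ennreal (k x) \<partial>\<pi>)"
      by (intro nn_integral_mono)
        (auto simp: power2_eq_square k0 h_nonneg kh simp flip: ennreal_mult intro!: ennreal_leI mult_right_mono)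
    also have "\<dots> = (\<integral>\<^sup>+x. ennreal (k x) \<partial>\<nu>)"
      unfolding dens'[symmetric] by (subst nn_integral_density) auto
    also have "\<dots> = (\<integral>\<^sup>+x. ennreal (g x * (\<integral>y. k y \<partial>P x)) \<partial>\<pi>)"
      by (subst nn\<nu>) (simp_all add: nn_integral_eq_integral[OF kPint] k0 g0 ennreal_mult)
    also have "\<dots> = ennreal (\<integral>x. g x * (\<integral>y. k y \<partial>P x) \<partial>\<pi>)"
      using int by (intro nn_integral_eq_integral) (auto simp: k0 g0)
    also have "(\<integral>x. g x * (\<integral>y. k y \<partial>P x) \<partial>\<pi>) \<le> l2_norm \<pi> (\<lambda>x. complex_of_real (k x)) * l2_norm \<pi> G"
    proof -
      have "(\<integral>x. g x * (\<integral>y. k y \<partial>P x) \<partial>\<pi>)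
          \<le> l2_norm \<pi> (markov_op P (\<lambda>x. complex_of_real (k x))) * l2_norm \<pi> G"
        using l2_Cauchy_Schwarz[OF markov_op_L2[OF kL] G] unfolding inner norm_of_real by simp
      also have "\<dots> \<le> l2_norm \<pi> (\<lambda>x. complex_of_real (k x)) * l2_norm \<pi> G"
        by (intro mult_right_mono markov_op_norm_le kL) simp
      finally show ?thesis .
    qed
    finally have "ennreal ((l2_norm \<pi> (\<lambda>x. complex_of_real (k x)))\<^sup>2)
        \<le> ennreal (l2_norm \<pi> (\<lambda>x. complex_of_real (k x)) * l2_norm \<pi> G)"
      by (simp add: nn_integral_l2_norm[OF kL, symmetric] ennreal_leI)
    then have "l2_norm \<pi> (\<lambda>x. complex_of_real (k x)) * l2_norm \<pi> (\<lambda>x. complex_of_real (k x))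
        \<le> l2_norm \<pi> (\<lambda>x. complex_of_real (k x)) * l2_norm \<pi> G"
      by (simp add: power2_eq_square mult_nonneg_nonneg)
    then have "l2_norm \<pi> (\<lambda>x. complex_of_real (k x)) \<le> l2_norm \<pi> G"
      by (cases "l2_norm \<pi> (\<lambda>x. complex_of_real (k x)) = 0") (auto simp: mult_le_cancel_left less_le)
    moreover have "min (h x) (real n) = k x" for x by (simp add: k_def)
    ultimately show ?thesis
      using nn_integral_l2_norm[OF kL] by (simp add: ennreal_leI power_mono)
  qed
  have "(\<integral>\<^sup>+x. ennreal ((cmod (H x))\<^sup>2) \<partial>\<pi>) \<le> (\<integral>\<^sup>+x. (SUP n. ennreal ((min (h x) (real n))\<^sup>2)) \<partial>\<pi>)"
  proof (rule nn_integral_mono)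
    fix x
    obtain n where "h x \<le> real n" using real_arch_simple by blast
    then show "ennreal ((cmod (H x))\<^sup>2) \<le> (SUP n. ennreal ((min (h x) (real n))\<^sup>2))"
      using h_nonneg[of x] by (intro SUP_upper2[of n]) (auto simp: H_def)
  qed
  also have "\<dots> = (SUP n. \<integral>\<^sup>+x. ennreal ((min (h x) (real n))\<^sup>2) \<partial>\<pi>)"
    by (intro nn_integral_monotone_convergence_SUP)
      (auto simp: incseq_def le_fun_def h_nonneg intro!: ennreal_leI power_mono)
  also have "\<dots> \<le> ennreal ((l2_norm \<pi> G)\<^sup>2)" by (intro SUP_least trunc)
  finally have H: "H \<in> L2 \<pi>"
    by (intro L2_bound_nn_integral(1)[OF _ _ l2_norm_nonneg]) (simp_all add: H_def)
  have "l2_inner \<pi> (markov_op P f) G = l2_inner \<pi> f H" if f: "f \<in> L2 \<pi>" for f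
  proof -
    note fm [measurable] = L2_borel[OF f]
    have int: "integrable \<nu> f"
      unfolding dens'[symmetric]
      by (subst integrable_density)
        (use L2_integrable_inner[OF f H] in \<open>auto simp: H_def h_nonneg scaleR_conv_of_real mult.commute\<close>)
    have "l2_inner \<pi> f H = (\<integral>x. f x \<partial>\<nu>)"
      unfolding dens'[symmetric] l2_inner_def
      by (subst integral_density) (auto simp: H_def h_nonneg scaleR_conv_of_real mult.commute)
    also have "\<dots> = (\<integral>x. markov_op P f x \<partial>N)"
      using integral_bind_kernel[OF KN spaceN] int by (simp add: \<nu>_def markov_op_def)
    also have "\<dots> = l2_inner \<pi> (markov_op P f) G"
      unfolding N_def l2_inner_def
      by (subst integral_density) (auto simp: G_def g0 scaleR_conv_of_real mult.commute)
    finally show ?thesis by simp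
  qed
  then show ?thesis using H unfolding G_def by blast
qed

lemma adjoint_exists:
  assumes g: "g \<in> L2 \<pi>"
  shows "\<exists>h\<in>L2 \<pi>. \<forall>f\<in>L2 \<pi>. l2_inner \<pi> (markov_op P f) g = l2_inner \<pi> f h"
proof -
  note [measurable] = L2_borel[OF g]
  have [measurable]: "(\<lambda>x. Re (g x)) \<in> borel_measurable borel" "(\<lambda>x. Im (g x)) \<in> borel_measurable borel"
    by measurable
  define p where "p = (\<lambda>(u :: 'a \<Rightarrow> real) x. complex_of_real (max (u x) 0))"
  have pL: "p u \<in> L2 \<pi>" if "u \<in> borel_measurable borel" "\<And>x. \<bar>u x\<bar> \<le> cmod (g x)" for u
  proof (rule L2_dominated[OF g])
    show "p u \<in> borel_measurable \<pi>" using that(1) by (simp add: p_def)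
    show "cmod (p u x) \<le> cmod (g x)" for x
      using that(2)[of x] by (auto simp: p_def max_def abs_if split: if_splits)
  qed
  have pA: "\<exists>h\<in>L2 \<pi>. \<forall>f\<in>L2 \<pi>. l2_inner \<pi> (markov_op P f) (p u) = l2_inner \<pi> f h"
    if "p u \<in> L2 \<pi>" for u
    using that unfolding p_def by (rule adjoint_exists_nonneg) simp
  have L: "p (\<lambda>x. Re (g x)) \<in> L2 \<pi>" "p (\<lambda>x. - Re (g x)) \<in> L2 \<pi>"
      "p (\<lambda>x. Im (g x)) \<in> L2 \<pi>" "p (\<lambda>x. - Im (g x)) \<in> L2 \<pi>"
    by (rule pL; simp add: abs_Re_le_cmod abs_Im_le_cmod)+
  obtain h1 h2 h3 h4 where h: "h1 \<in> L2 \<pi>" "h2 \<in> L2 \<pi>" "h3 \<in> L2 \<pi>" "h4 \<in> L2 \<pi>"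
    and eq: "\<forall>f\<in>L2 \<pi>. l2_inner \<pi> (markov_op P f) (p (\<lambda>x. Re (g x))) = l2_inner \<pi> f h1"
      "\<forall>f\<in>L2 \<pi>. l2_inner \<pi> (markov_op P f) (p (\<lambda>x. - Re (g x))) = l2_inner \<pi> f h2"
      "\<forall>f\<in>L2 \<pi>. l2_inner \<pi> (markov_op P f) (p (\<lambda>x. Im (g x))) = l2_inner \<pi> f h3"
      "\<forall>f\<in>L2 \<pi>. l2_inner \<pi> (markov_op P f) (p (\<lambda>x. - Im (g x))) = l2_inner \<pi> f h4"
    using pA[OF L(1)] pA[OF L(2)] pA[OF L(3)] pA[OF L(4)] by (elim bexE)
  have g_eq: "g = (\<lambda>x. (p (\<lambda>x. Re (g x)) x - p (\<lambda>x. - Re (g x)) x)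
      + \<i> * (p (\<lambda>x. Im (g x)) x - p (\<lambda>x. - Im (g x)) x))"
    by (auto simp: fun_eq_iff complex_eq_iff p_def)
  show ?thesis
  proof (intro bexI ballI)
    fix f :: "'a \<Rightarrow> complex" assume f: "f \<in> L2 \<pi>"
    show "l2_inner \<pi> (markov_op P f) g = l2_inner \<pi> f (\<lambda>x. (h1 x - h2 x) + \<i> * (h3 x - h4 x))"
      by (subst g_eq) (simp add: f L h markov_op_L2[OF f] eq)
  qed (use h in auto)
qed

end

section \<open>Decay of centered functions\<close>

context stationary_kernel
begin

lemma prob_UNIV [simp]: "prob UNIV = 1"
  using prob_space by simp

abbreviation Padj :: "'a operator" where "Padj \<equiv> l2_adjoint \<pi> (markov_op P)"

lemma Padj:
  assumes "g \<in> L2 \<pi>"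
  shows Padj_L2 [simp]: "Padj g \<in> L2 \<pi>"
    and inner_Padj: "f \<in> L2 \<pi> \<Longrightarrow> l2_inner \<pi> f (Padj g) = l2_inner \<pi> (markov_op P f) g"
proof -
  have "\<exists>h. h \<in> L2 \<pi> \<and> (\<forall>f\<in>L2 \<pi>. l2_inner \<pi> (markov_op P f) g = l2_inner \<pi> f h)"
    using adjoint_exists[OF assms] by blast
  then have "Padj g \<in> L2 \<pi> \<and> (\<forall>f\<in>L2 \<pi>. l2_inner \<pi> (markov_op P f) g = l2_inner \<pi> f (Padj g))"
    unfolding l2_adjoint_def by (rule someI_ex)
  then show "Padj g \<in> L2 \<pi>" "f \<in> L2 \<pi> \<Longrightarrow> l2_inner \<pi> f (Padj g) = l2_inner \<pi> (markov_op P f) g"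
    by auto
qed

lemma Padj_norm_le:
  assumes g: "g \<in> L2 \<pi>" shows "l2_norm \<pi> (Padj g) \<le> l2_norm \<pi> g"
proof -
  have "l2_norm \<pi> (Padj g) * l2_norm \<pi> (Padj g) = cmod (l2_inner \<pi> (Padj g) (Padj g))"
    by (simp add: l2_inner_self power2_eq_square norm_mult)
  also have "\<dots> = cmod (l2_inner \<pi> (markov_op P (Padj g)) g)"
    using g by (simp add: inner_Padj)
  also have "\<dots> \<le> l2_norm \<pi> (markov_op P (Padj g)) * l2_norm \<pi> g"
    using g by (intro l2_Cauchy_Schwarz markov_op_L2) auto
  also have "\<dots> \<le> l2_norm \<pi> (Padj g) * l2_norm \<pi> g"
    using g by (intro mult_right_mono markov_op_norm_le) auto
  finally show ?thesis
    by (cases "l2_norm \<pi> (Padj g) = 0") (auto simp: mult_le_cancel_left less_le)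
qed

lemma Padj_bounded: "l2_bounded_operator \<pi> Padj"
  by (rule bounded_operatorI_adjoint[where S = "markov_op P" and C = 1])
    (simp_all add: markov_op_L2 inner_Padj Padj_norm_le)

text \<open>This is stationarity in dual form: pairing with 1 is integration, and P preserves
  \<pi>-integrals.\<close>

lemma Padj_one: "AE x in \<pi>. Padj (\<lambda>x. 1) x = 1"
proof (rule l2_ext)
  fix f :: "'a \<Rightarrow> complex" assume f: "f \<in> L2 \<pi>"
  have "l2_inner \<pi> f (Padj (\<lambda>x. 1)) = l2_inner \<pi> (markov_op P f) (\<lambda>x. 1)"
    using f by (simp add: inner_Padj)
  also have "\<dots> = l2_inner \<pi> f (\<lambda>x. 1)"
    using integral_markov_op[OF L2_integrable[OF f]] by (simp add: l2_inner_def)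
  finally show "l2_inner \<pi> f (Padj (\<lambda>x. 1)) = l2_inner \<pi> f (\<lambda>x. 1)" .
qed auto

lemma funpow_Padj:
  assumes g: "g \<in> L2 \<pi>"
  shows funpow_Padj_L2: "(Padj ^^ n) g \<in> L2 \<pi>"
    and funpow_Padj_norm_le: "l2_norm \<pi> ((Padj ^^ n) g) \<le> l2_norm \<pi> g"
proof (induction n)
  case (Suc n)
  { case 1 show ?case using Suc by simp }
  { case 2 show ?case using Padj_norm_le[OF Suc(1)] Suc(2) by simp }
qed (use g in auto)

lemma inner_funpow_Padj:
  assumes "f \<in> L2 \<pi>" "g \<in> L2 \<pi>"
  shows "l2_inner \<pi> f ((Padj ^^ n) g) = l2_inner \<pi> ((markov_op P ^^ n) f) g"
  using assms(1)
proof (induction n arbitrary: f)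
  case (Suc n)
  have "l2_inner \<pi> f ((Padj ^^ Suc n) g) = l2_inner \<pi> (markov_op P f) ((Padj ^^ n) g)"
    using Suc.prems assms(2) by (simp add: inner_Padj funpow_Padj_L2)
  also have "\<dots> = l2_inner \<pi> ((markov_op P ^^ n) (markov_op P f)) g"
    by (intro Suc.IH markov_op_L2 Suc.prems)
  finally show ?case by (simp add: funpow_swap1)
qed simp

lemma Padj_funpow_one: "AE x in \<pi>. (Padj ^^ n) (\<lambda>x. 1) x = 1"
proof (induction n)
  case (Suc n)
  have "AE x in \<pi>. Padj ((Padj ^^ n) (\<lambda>x. 1)) x = Padj (\<lambda>x. 1) x"
    using Suc by (intro bounded_operator_cong[OF Padj_bounded]) (simp_all add: funpow_Padj_L2)
  with Padj_one show ?case by eventually_elim simp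
qed simp

lemma markov_op_funpow_const: "(markov_op P ^^ n) (\<lambda>x. c) = (\<lambda>x. c)"
  by (induction n) auto

text \<open>With A = P^k, the form of A* A at f is \<bar>\<bar>A f\<bar>\<bar>^2, and \<bar>\<bar>A*
  A f\<bar>\<bar> \<le> \<bar>\<bar>A f\<bar>\<bar> since A* is a contraction. That is exactly the
  condition \<open>firm\<close>.\<close>

lemma reversibilization: "l2_positive_contraction \<pi> ((Padj ^^ k) \<circ> (markov_op P ^^ k))"
proof
  note [simp] = funpow_Padj_L2 funpow_markov_op_L2
  show "l2_bounded_operator \<pi> ((Padj ^^ k) \<circ> (markov_op P ^^ k))"
    unfolding comp_def
    by (rule bounded_operator_comp[OF bounded_operator_funpow[OF Padj_bounded]
          bounded_operator_funpow[OF markov_op_bounded]])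
  have eq: "l2_inner \<pi> f (((Padj ^^ k) \<circ> (markov_op P ^^ k)) g)
      = l2_inner \<pi> ((markov_op P ^^ k) f) ((markov_op P ^^ k) g)"
    if "f \<in> L2 \<pi>" "g \<in> L2 \<pi>" for f g
    using that by (simp add: inner_funpow_Padj)
  have eq': "l2_inner \<pi> (((Padj ^^ k) \<circ> (markov_op P ^^ k)) f) g
      = l2_inner \<pi> ((markov_op P ^^ k) f) ((markov_op P ^^ k) g)"
    if "f \<in> L2 \<pi>" "g \<in> L2 \<pi>" for f g
    using eq[OF that(2,1)] l2_inner_cnj by metis
  show "l2_inner \<pi> (((Padj ^^ k) \<circ> (markov_op P ^^ k)) f) g
      = l2_inner \<pi> f (((Padj ^^ k) \<circ> (markov_op P ^^ k)) g)"
    if "f \<in> L2 \<pi>" "g \<in> L2 \<pi>" for f g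
    using eq[OF that] eq'[OF that] by simp
  show "(l2_norm \<pi> (((Padj ^^ k) \<circ> (markov_op P ^^ k)) f))\<^sup>2
      \<le> Re (l2_inner \<pi> (((Padj ^^ k) \<circ> (markov_op P ^^ k)) f) f)" if f: "f \<in> L2 \<pi>" for f
    unfolding eq'[OF f f] Re_l2_inner_self
    using f by (simp add: funpow_Padj_norm_le power_mono)
qed

lemma funpow_norm_le_of_gap:
  assumes g: "0 < g" "g < spectral_gap \<pi> ((Padj ^^ k) \<circ> (markov_op P ^^ k))"
    and f: "f \<in> L2 \<pi>" "(\<integral>x. f x \<partial>\<pi>) = 0"
  shows "l2_norm \<pi> ((markov_op P ^^ k) f) \<le> sqrt (1 - g) * l2_norm \<pi> f"
proof -
  interpret Qk: l2_positive_contraction \<pi> "(Padj ^^ k) \<circ> (markov_op P ^^ k)"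
    by (rule reversibilization)
  have g1: "g < 1" using g Qk.spectral_gap_le_1 by simp
  have "(l2_norm \<pi> ((markov_op P ^^ k) f))\<^sup>2
      = Re (l2_inner \<pi> f (((Padj ^^ k) \<circ> (markov_op P ^^ k)) f))"
    using f by (simp add: inner_funpow_Padj funpow_markov_op_L2 Re_l2_inner_self)
  also have "\<dots> = Re (l2_inner \<pi> (((Padj ^^ k) \<circ> (markov_op P ^^ k)) f) f)"
    by (rule Re_l2_inner_commute)
  also have "\<dots> \<le> (1 - g) * (l2_norm \<pi> f)\<^sup>2"
  proof (rule Qk.form_le_of_spectral_gap[OF g prob_space_axioms _ f(1)])
    show "AE x in \<pi>. ((Padj ^^ k) \<circ> (markov_op P ^^ k)) (\<lambda>x. 1) x = 1"
      using Padj_funpow_one by (simp add: markov_op_funpow_const)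
    show "l2_inner \<pi> f (\<lambda>x. 1) = 0" using f by (simp add: l2_inner_def)
  qed
  finally have "(l2_norm \<pi> ((markov_op P ^^ k) f))\<^sup>2 \<le> (sqrt (1 - g) * l2_norm \<pi> f)\<^sup>2"
    using g1 by (simp add: power_mult_distrib)
  then show ?thesis by (rule power2_le_imp_le) (use g1 in simp)
qed

text \<open>Each block of \<open>k\<close> steps gains a factor \<open>\<rho>\<close> because P
  keeps functions centered, and the \<open>r\<close> remaining steps do not increase the
  norm.\<close>

lemma funpow_decay:
  assumes \<rho>: "0 \<le> \<rho>" "\<And>f. f \<in> L2 \<pi> \<Longrightarrow> (\<integral>x. f x \<partial>\<pi>) = 0 \<Longrightarrow>
      l2_norm \<pi> ((markov_op P ^^ k) f) \<le> \<rho> * l2_norm \<pi> f"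
    and f: "f \<in> L2 \<pi>" "(\<integral>x. f x \<partial>\<pi>) = 0"
  shows "l2_norm \<pi> ((markov_op P ^^ (q * k + r)) f) \<le> \<rho> ^ q * l2_norm \<pi> f"
  using f
proof (induction q arbitrary: f)
  case (Suc q)
  have split: "Suc q * k + r = (q * k + r) + k" by simp
  have "l2_norm \<pi> ((markov_op P ^^ (Suc q * k + r)) f)
      = l2_norm \<pi> ((markov_op P ^^ (q * k + r)) ((markov_op P ^^ k) f))"
    unfolding split funpow_add by simp
  also have "\<dots> \<le> \<rho> ^ q * l2_norm \<pi> ((markov_op P ^^ k) f)"
    using Suc.prems by (intro Suc.IH) (simp_all add: funpow_markov_op_L2 funpow_markov_op_centered)
  also have "\<dots> \<le> \<rho> ^ q * (\<rho> * l2_norm \<pi> f)"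
    using \<rho> Suc.prems by (intro mult_left_mono) auto
  finally show ?case by (simp add: mult_ac)
qed (simp add: funpow_markov_op_norm_le)

end

text \<open>Every exponent m is the value of \<open>n div k\<close> for exactly \<open>k\<close>
  values of n, so the series is \<open>k\<close> times a geometric one.\<close>

lemma sum_power_div:
  fixes \<rho> :: real
  assumes k: "k \<ge> 1" and \<rho>: "0 \<le> \<rho>" "\<rho> < 1"
  shows summable_power_div: "summable (\<lambda>n. \<rho> ^ (n div k))"
    and suminf_power_div_le: "(\<Sum>n. \<rho> ^ (n div k)) \<le> real k / (1 - \<rho>)"
proof -
  have part: "(\<Sum>n<N. \<rho> ^ (n div k)) \<le> real k / (1 - \<rho>)" for N
  proof -
    have "(\<Sum>n<N. \<rho> ^ (n div k)) \<le> (\<Sum>n<N * k. \<rho> ^ (n div k))"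
      using k \<rho> by (intro sum_mono2) auto
    also have "\<dots> = (\<Sum>m<N. \<Sum>n\<in>{m * k..<m * k + k}. \<rho> ^ (n div k))"
      by (rule sum.nat_group[symmetric])
    also have "\<dots> = (\<Sum>m<N. \<Sum>n\<in>{m * k..<m * k + k}. \<rho> ^ m)"
    proof (intro sum.cong refl)
      fix m n assume "n \<in> {m * k..<m * k + k}"
      then have "n div k = m" using k by (intro div_nat_eqI) (auto simp: algebra_simps)
      then show "\<rho> ^ (n div k) = \<rho> ^ m" by simp
    qed
    also have "\<dots> = real k * (\<Sum>m<N. \<rho> ^ m)" by (simp add: sum_distrib_left)
    also have "\<dots> \<le> real k * (1 / (1 - \<rho>))"
      using \<rho> by (intro mult_left_mono) (simp_all add: sum_gp_strict divide_right_mono)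
    finally show ?thesis by simp
  qed
  show sm: "summable (\<lambda>n. \<rho> ^ (n div k))"
    by (rule summableI_nonneg_bounded[OF _ part]) (simp add: \<rho>)
  show "(\<Sum>n. \<rho> ^ (n div k)) \<le> real k / (1 - \<rho>)"
    by (rule suminf_le_const[OF sm part])
qed

context stationary_kernel
begin

lemma pseudo_gap_decay:
  assumes x: "0 < x" "x < pseudo_spectral_gap P \<pi>"
  obtains c :: "nat \<Rightarrow> real" where "\<And>n. 0 \<le> c n" "c 0 = 1" "summable c" "suminf c \<le> 2 / x"
    "\<And>f n. f \<in> L2 \<pi> \<Longrightarrow> (\<integral>x. f x \<partial>\<pi>) = 0 \<Longrightarrow> l2_norm \<pi> ((markov_op P ^^ n) f) \<le> c n * l2_norm \<pi> f"
proof -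
  define G where "G = (\<lambda>k. spectral_gap \<pi> ((Padj ^^ k) \<circ> (markov_op P ^^ k)))"
  have G1: "G k \<le> 1" for k
    unfolding G_def by (rule l2_positive_contraction.spectral_gap_le_1[OF reversibilization])
  have "G k / real k \<le> 1" if "k \<ge> 1" for k
    using G1[of k] that by (simp add: field_simps)
  then have "bdd_above ((\<lambda>k. G k / real k) ` {1..})" by (intro bdd_aboveI2[where M = 1]) auto
  \<comment> \<open>Boundedness makes the supremum a genuine least upper bound, so a number strictly
    below it is exceeded by some member.\<close>
  then obtain k where k: "k \<ge> 1" "x < G k / real k"
    using x unfolding pseudo_spectral_gap_def G_def[symmetric]
    by (subst (asm) less_cSUP_iff) (auto simp: G_def)
  define g where "g = real k * x"
  have g: "0 < g" "g < G k" "g < 1" using k x G1[of k] by (auto simp: g_def field_simps)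
  define \<rho> where "\<rho> = sqrt (1 - g)"
  \<comment> \<open>The bound sqrt (1 - g) \<le> 1 - g / 2 with g = k x cancels the block length: k
    / (1 - \<rho>) \<le> 2 / x.\<close>
  have "\<rho> \<le> 1 - g / 2"
    unfolding \<rho>_def using g by (intro real_le_lsqrt) (auto simp: power2_eq_square field_simps)
  then have \<rho>: "0 \<le> \<rho>" "\<rho> < 1" "g / 2 \<le> 1 - \<rho>" using g by (auto simp: \<rho>_def)
  show thesis
  proof (rule that)
    show "summable (\<lambda>n. \<rho> ^ (n div k))" by (rule summable_power_div[OF k(1) \<rho>(1,2)])
    have "(\<Sum>n. \<rho> ^ (n div k)) \<le> real k / (1 - \<rho>)" by (rule suminf_power_div_le[OF k(1) \<rho>(1,2)])
    also have "\<dots> \<le> real k / (g / 2)" using \<rho> g by (intro divide_left_mono) auto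
    also have "\<dots> = 2 / x" using k x by (simp add: g_def)
    finally show "(\<Sum>n. \<rho> ^ (n div k)) \<le> 2 / x" .
    show "l2_norm \<pi> ((markov_op P ^^ n) f) \<le> \<rho> ^ (n div k) * l2_norm \<pi> f"
      if f: "f \<in> L2 \<pi>" "(\<integral>x. f x \<partial>\<pi>) = 0" for f n
      using funpow_decay[OF \<rho>(1) _ f, of k "n div k" "n mod k"]
        funpow_norm_le_of_gap[OF g(1) g(2)[unfolded G_def]]
      by (simp add: \<rho>_def)
  qed (simp_all add: \<rho>)
qed

section \<open>Centering and the resolvent of P - \<pi>\<close>

lemma center:
  assumes f: "f \<in> L2 \<pi>"
  shows center_integral: "(\<integral>x. f x - (\<integral>y. f y \<partial>\<pi>) \<partial>\<pi>) = 0"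
    and center_norm_le: "l2_norm \<pi> (\<lambda>x. f x - (\<integral>y. f y \<partial>\<pi>)) \<le> l2_norm \<pi> f"
proof -
  define m where "m = (\<integral>y. f y \<partial>\<pi>)"
  show "(\<integral>x. f x - (\<integral>y. f y \<partial>\<pi>) \<partial>\<pi>) = 0"
    using L2_integrable[OF f] by (simp add: prob_space)
  have "l2_inner \<pi> f (\<lambda>x. m) = m * cnj m"
    using L2_integrable[OF f] by (simp add: l2_inner_def m_def)
  then have "Re (l2_inner \<pi> f (\<lambda>x. m)) = (cmod m)\<^sup>2"
    by (metis complex_norm_square Re_complex_of_real)
  moreover have "(l2_norm \<pi> (\<lambda>x. m))\<^sup>2 = (cmod m)\<^sup>2" by (simp add: l2_norm_power2 prob_space)
  \<comment> \<open>Centering is an orthogonal projection: the squared norm drops by the square of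
    \<bar>m\<bar>.\<close>
  ultimately have "(l2_norm \<pi> (\<lambda>x. f x - m))\<^sup>2 \<le> (l2_norm \<pi> f)\<^sup>2"
    using f by (simp add: l2_norm_diff_power2)
  then show "l2_norm \<pi> (\<lambda>x. f x - (\<integral>y. f y \<partial>\<pi>)) \<le> l2_norm \<pi> f"
    unfolding m_def by (rule power2_le_imp_le) simp
qed

abbreviation centered_op :: "'a operator" where
  "centered_op \<equiv> \<lambda>g x. markov_op P g x - mean_op \<pi> g x"

lemma mean_op_bounded: "l2_bounded_operator \<pi> (mean_op \<pi>)"
  unfolding l2_bounded_operator_def
proof (intro conjI ballI allI)
  show "mean_op \<pi> f \<in> L2 \<pi>" for f unfolding mean_op_def by auto
  show "AE x in \<pi>. mean_op \<pi> (\<lambda>y. f y + g y) x = mean_op \<pi> f x + mean_op \<pi> g x"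
    if "f \<in> L2 \<pi>" "g \<in> L2 \<pi>" for f g
    using that by (simp add: mean_op_def L2_integrable)
  show "AE x in \<pi>. mean_op \<pi> (\<lambda>y. c * f y) x = c * mean_op \<pi> f x" for c f
    by (simp add: mean_op_def)
  have "l2_norm \<pi> (mean_op \<pi> f) \<le> 1 * l2_norm \<pi> f" if f: "f \<in> L2 \<pi>" for f
  proof -
    have "l2_norm \<pi> (mean_op \<pi> f) = cmod (l2_inner \<pi> f (\<lambda>x. 1))"
      by (simp add: l2_norm_def mean_op_def l2_inner_def prob_space)
    also have "\<dots> \<le> l2_norm \<pi> f * l2_norm \<pi> (\<lambda>x. 1)" by (intro l2_Cauchy_Schwarz f) auto
    also have "l2_norm \<pi> (\<lambda>x. 1) = 1" by (simp add: l2_norm_def prob_space)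
    finally show ?thesis by simp
  qed
  then show "\<exists>C. \<forall>f\<in>L2 \<pi>. l2_norm \<pi> (mean_op \<pi> f) \<le> C * l2_norm \<pi> f" by blast
qed

lemma centered_op_bounded: "l2_bounded_operator \<pi> centered_op"
  by (intro bounded_operator_minus markov_op_bounded mean_op_bounded)

text \<open>One application of P - \<pi> produces a centered function, and on centered functions P -
  \<pi> agrees with P. At exponent 0 nothing has been centered yet, hence
  \<open>Suc n\<close>.\<close>

lemma centered_op_funpow:
  assumes f: "f \<in> L2 \<pi>"
  shows "AE x in \<pi>. (centered_op ^^ Suc n) f x
    = (markov_op P ^^ Suc n) (\<lambda>x. f x - (\<integral>y. f y \<partial>\<pi>)) x"
proof (induction n)
  case 0
  show ?case
    using bounded_operator_diff[OF markov_op_bounded f L2_const[of "\<integral>y. f y \<partial>\<pi>"]]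
    by (simp add: mean_op_def eq_commute)
next
  case (Suc n)
  define g where "g = (markov_op P ^^ Suc n) (\<lambda>x. f x - (\<integral>y. f y \<partial>\<pi>))"
  have f0: "(\<lambda>x. f x - (\<integral>y. f y \<partial>\<pi>)) \<in> L2 \<pi>" using f by auto
  have g: "g \<in> L2 \<pi>" "(\<integral>x. g x \<partial>\<pi>) = 0"
    unfolding g_def using funpow_markov_op_L2[OF f0, of "Suc n"] funpow_markov_op_centered[OF f0, of "Suc n"]
      center_integral[OF f] by simp_all
  have "AE x in \<pi>. centered_op ((centered_op ^^ Suc n) f) x = centered_op g x"
    using Suc unfolding g_def[symmetric]
    by (intro bounded_operator_cong[OF centered_op_bounded] g
        bounded_operator_L2[OF bounded_operator_funpow[OF centered_op_bounded]] f) 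
  moreover have "centered_op g x = markov_op P g x" for x using g by (simp add: mean_op_def)
  ultimately show ?case by (simp add: g_def)
qed

text \<open>Without this the choice in \<open>l2_inverse\<close>, and with it
  \<open>asymptotic_variance\<close>, would have no known property.\<close>

lemma centered_resolvent_exists:
  assumes c: "\<And>n. 0 \<le> c n" "c 0 = 1" "summable c"
    and decay: "\<And>f n. f \<in> L2 \<pi> \<Longrightarrow> (\<integral>x. f x \<partial>\<pi>) = 0 \<Longrightarrow>
      l2_norm \<pi> ((markov_op P ^^ n) f) \<le> c n * l2_norm \<pi> f"
  shows "\<exists>S. l2_is_inverse \<pi> (\<lambda>g x. g x - (markov_op P g x - mean_op \<pi> g x)) S"
proof (rule l2_Neumann[OF centered_op_bounded _ c(3,1)])
  fix n and f :: "'a \<Rightarrow> complex" assume f: "f \<in> L2 \<pi>"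
  show "l2_norm \<pi> ((centered_op ^^ n) f) \<le> c n * l2_norm \<pi> f"
  proof (cases n)
    case 0
    then show ?thesis by (simp add: c)
  next
    case (Suc m)
    have f0: "(\<lambda>x. f x - (\<integral>y. f y \<partial>\<pi>)) \<in> L2 \<pi>" using f by auto
    have "l2_norm \<pi> ((centered_op ^^ n) f) = l2_norm \<pi> ((markov_op P ^^ n) (\<lambda>x. f x - (\<integral>y. f y \<partial>\<pi>)))"
      unfolding Suc by (intro l2_norm_cong_AE centered_op_funpow f funpow_markov_op_L2 f0
          bounded_operator_L2[OF bounded_operator_funpow[OF centered_op_bounded]])
    also have "\<dots> \<le> c n * l2_norm \<pi> (\<lambda>x. f x - (\<integral>y. f y \<partial>\<pi>))"
      by (intro decay f0 center_integral f)
    also have "\<dots> \<le> c n * l2_norm \<pi> f" by (intro mult_left_mono center_norm_le f c)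
    finally show ?thesis .
  qed
qed

text \<open>Stated for an arbitrary inverse \<open>R\<close>, since the asymptotic variance uses a
  chosen one. On centered functions the mean drops out and \<open>R\<close> solves the Poisson
  equation.\<close>

lemma centered_resolvent:
  assumes c: "\<And>n. 0 \<le> c n" "summable c"
    and decay: "\<And>f n. f \<in> L2 \<pi> \<Longrightarrow> (\<integral>x. f x \<partial>\<pi>) = 0 \<Longrightarrow>
      l2_norm \<pi> ((markov_op P ^^ n) f) \<le> c n * l2_norm \<pi> f"
    and R: "l2_is_inverse \<pi> (\<lambda>g x. g x - (markov_op P g x - mean_op \<pi> g x)) R"
    and f: "f \<in> L2 \<pi>" "(\<integral>x. f x \<partial>\<pi>) = 0"
  shows centered_resolvent_L2: "R f \<in> L2 \<pi>"
    and centered_resolvent_centered: "(\<integral>x. R f x \<partial>\<pi>) = 0"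
    and centered_resolvent_Poisson: "AE x in \<pi>. f x = R f x - markov_op P (R f) x"
    and centered_resolvent_norm_le: "l2_norm \<pi> (R f) \<le> suminf c * l2_norm \<pi> f"
proof -
  show h: "R f \<in> L2 \<pi>"
    using R f by (auto simp: l2_is_inverse_def intro: bounded_operator_L2)
  have eq: "AE x in \<pi>. R f x - (markov_op P (R f) x - mean_op \<pi> (R f) x) = f x"
    using R f by (auto simp: l2_is_inverse_def)
  note int = L2_integrable[OF h] L2_integrable[OF markov_op_L2[OF h]]
  \<comment> \<open>Stationarity gives both terms in the bracket the same integral, so
    \<open>R f\<close> has the mean of \<open>f\<close>.\<close>
  have "(\<integral>x. f x \<partial>\<pi>) = (\<integral>x. R f x - (markov_op P (R f) x - mean_op \<pi> (R f) x) \<partial>\<pi>)"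
  proof (rule integral_cong_AE)
    show "f \<in> borel_measurable \<pi>" by (rule L2_measurable[OF f(1)])
    show "(\<lambda>x. R f x - (markov_op P (R f) x - mean_op \<pi> (R f) x)) \<in> borel_measurable \<pi>"
      using L2_measurable[OF h] L2_measurable[OF markov_op_L2[OF h]] by (simp add: mean_op_def)
    show "AE x in \<pi>. f x = R f x - (markov_op P (R f) x - mean_op \<pi> (R f) x)"
      using eq by eventually_elim simp
  qed
  also have "\<dots> = (\<integral>x. R f x \<partial>\<pi>)"
    using int integral_markov_op[OF int(1)] by (simp add: mean_op_def prob_space)
  finally show h0: "(\<integral>x. R f x \<partial>\<pi>) = 0" using f by simp
  show po: "AE x in \<pi>. f x = R f x - markov_op P (R f) x"
    using eq by eventually_elim (simp add: mean_op_def h0)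
  \<comment> \<open>Iterating the Poisson equation gives a finite expansion. Its remainder P^N (R f)
    tends to 0 because \<open>R f\<close> is itself centered, so the norm of \<open>R f\<close> is
    at most that of the series.\<close>
  have iter: "AE x in \<pi>. R f x = (\<Sum>n<N. (markov_op P ^^ n) f x) + (markov_op P ^^ N) (R f) x" for N
  proof (induction N)
    case (Suc N)
    have "AE x in \<pi>. (markov_op P ^^ N) f x = (markov_op P ^^ N) (\<lambda>x. R f x - markov_op P (R f) x) x"
      using po f h by (intro bounded_operator_cong[OF bounded_operator_funpow[OF markov_op_bounded]])
        (auto simp: markov_op_L2)
    moreover have "AE x in \<pi>. (markov_op P ^^ N) (\<lambda>x. R f x - markov_op P (R f) x) x
        = (markov_op P ^^ N) (R f) x - (markov_op P ^^ N) (markov_op P (R f)) x"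
      by (intro bounded_operator_diff[OF bounded_operator_funpow[OF markov_op_bounded]] h markov_op_L2)
    ultimately show ?case using Suc by eventually_elim (simp add: funpow_swap1)
  qed simp
  have "l2_norm \<pi> (R f) \<le> suminf c * l2_norm \<pi> f + c N * l2_norm \<pi> (R f)" for N
  proof -
    note [simp] = funpow_markov_op_L2[OF f(1)] funpow_markov_op_L2[OF h]
    have "l2_norm \<pi> (R f) = l2_norm \<pi> (\<lambda>x. (\<Sum>n<N. (markov_op P ^^ n) f x) + (markov_op P ^^ N) (R f) x)"
      by (intro l2_norm_cong_AE iter h) simp
    also have "\<dots> \<le> l2_norm \<pi> (\<lambda>x. \<Sum>n<N. (markov_op P ^^ n) f x) + l2_norm \<pi> ((markov_op P ^^ N) (R f))"
      by (intro l2_norm_triangle) simp_all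
    also have "\<dots> \<le> (\<Sum>n<N. l2_norm \<pi> ((markov_op P ^^ n) f)) + c N * l2_norm \<pi> (R f)"
      by (intro add_mono l2_norm_sum decay h h0) simp
    also have "(\<Sum>n<N. l2_norm \<pi> ((markov_op P ^^ n) f)) \<le> (\<Sum>n<N. c n) * l2_norm \<pi> f"
      unfolding sum_distrib_right by (intro sum_mono decay f)
    also have "\<dots> \<le> suminf c * l2_norm \<pi> f"
      using c by (intro mult_right_mono sum_le_suminf) auto
    finally show ?thesis by simp
  qed
  moreover have "(\<lambda>N. suminf c * l2_norm \<pi> f + c N * l2_norm \<pi> (R f))
      \<longlonglongrightarrow> suminf c * l2_norm \<pi> f + 0 * l2_norm \<pi> (R f)"
    by (intro tendsto_intros summable_LIMSEQ_zero c)
  ultimately have "l2_norm \<pi> (R f) \<le> suminf c * l2_norm \<pi> f + 0 * l2_norm \<pi> (R f)"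
    by (intro LIMSEQ_le_const) auto
  then show "l2_norm \<pi> (R f) \<le> suminf c * l2_norm \<pi> f" by simp
qed

end

section \<open>Covariances of a stationary chain\<close>

lemma L2_of_real: "(\<lambda>x. complex_of_real (f x)) \<in> L2 M \<longleftrightarrow> f \<in> L2 M"
proof
  assume "(\<lambda>x. complex_of_real (f x)) \<in> L2 M"
  then show "f \<in> L2 M"
    using measurable_compose[of "\<lambda>x. complex_of_real (f x)" M borel Re borel]
    by (simp add: L2_def)
qed (auto simp: L2_def)

locale stationary_chain = stationary_kernel P \<pi>
  for P :: "'a::polish_space \<Rightarrow> 'a measure" and \<pi> :: "'a measure" +
  fixes M :: "'b measure" and n :: nat and X :: "nat \<Rightarrow> 'b \<Rightarrow> 'a"
  assumes chain: "markov_chain M n X P \<pi>"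
begin

sublocale chain: prob_space M
  using chain by (simp add: markov_chain_def)

lemma X_measurable [measurable]: "1 \<le> i \<Longrightarrow> i \<le> n \<Longrightarrow> X i \<in> M \<rightarrow>\<^sub>M borel"
  using chain by (simp add: markov_chain_def)

lemma subalgebra_past: assumes "i \<le> n" shows "subalgebra M (past_algebra M X i)"
proof -
  have gen: "(\<Union>j\<in>{1..i}. {X j -` A \<inter> space M | A. A \<in> sets borel}) \<subseteq> sets M"
    using assms by (auto intro!: measurable_sets[OF X_measurable])
  then have "(\<Union>j\<in>{1..i}. {X j -` A \<inter> space M | A. A \<in> sets borel}) \<subseteq> Pow (space M)"
    using sets.space_closed by blast
  then show ?thesis
    using gen by (simp add: past_algebra_def subalgebra_def space_measure_of sets_measure_of sets.sigma_sets_subset)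
qed

lemma X_past_measurable:
  assumes "1 \<le> j" "j \<le> i" "i \<le> n" shows "X j \<in> past_algebra M X i \<rightarrow>\<^sub>M borel"
proof (rule measurableI)
  have sub: "(\<Union>j\<in>{1..i}. {X j -` A \<inter> space M | A. A \<in> sets borel}) \<subseteq> Pow (space M)" by auto
  have sp: "space (past_algebra M X i) = space M"
    by (simp add: past_algebra_def space_measure_of_conv)
  fix A :: "'a set" assume "A \<in> sets borel"
  then show "X j -` A \<inter> space (past_algebra M X i) \<in> sets (past_algebra M X i)"
    unfolding sp using assms unfolding past_algebra_def sets_measure_of[OF sub]
    by (intro sigma_sets.Basic UN_I[of j]) auto
qed simp

lemma finite_measure_subalgebra_past: "i \<le> n \<Longrightarrow> finite_measure_subalgebra M (past_algebra M X i)"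
  using subalgebra_past chain.finite_measure_axioms
  by (simp add: finite_measure_subalgebra_def finite_measure_subalgebra_axioms_def)

lemma cond_exp_step:
  assumes "1 \<le> i" "i < n" "A \<in> sets borel"
  shows "AE \<omega> in M. real_cond_exp M (past_algebra M X i) (indicator (X (Suc i) -` A \<inter> space M)) \<omega>
    = measure (P (X i \<omega>)) A"
  using chain assms by (simp add: markov_chain_def)

lemma measure_P_measurable [measurable]: "A \<in> sets borel \<Longrightarrow> (\<lambda>x. measure (P x) A) \<in> borel_measurable borel"
  by (rule measurable_compose[OF P_borel measurable_measure_subprob_algebra])

text \<open>The exceptional null set in the Markov property depends on \<open>A\<close>. Integrating
  over a past event absorbs it, leaving an identity between numbers.\<close>

lemma set_step:
  assumes i: "1 \<le> i" "i < n" and A: "A \<in> sets borel" and C: "C \<in> sets (past_algebra M X i)"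
  shows "measure M (C \<inter> (X (Suc i) -` A \<inter> space M)) = (\<integral>\<omega>. indicator C \<omega> * measure (P (X i \<omega>)) A \<partial>M)"
proof -
  interpret S: finite_measure_subalgebra M "past_algebra M X i"
    using i by (intro finite_measure_subalgebra_past) simp
  have Cm [measurable]: "C \<in> sets M"
    using C subalgebra_past[of i] i by (auto simp: subalgebra_def)
  have [measurable]: "X i \<in> M \<rightarrow>\<^sub>M borel" using i by simp
  have B [measurable]: "X (Suc i) -` A \<inter> space M \<in> sets M" using i A by (intro measurable_sets[OF X_measurable]) auto
  have "measure M (C \<inter> (X (Suc i) -` A \<inter> space M))
      = (\<integral>\<omega>\<in>C. indicator (X (Suc i) -` A \<inter> space M) \<omega> \<partial>M)"
    unfolding set_lebesgue_integral_def by (simp add: Int_ac flip: indicator_inter_arith)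
  also have "\<dots> = (\<integral>\<omega>\<in>C. real_cond_exp M (past_algebra M X i) (indicator (X (Suc i) -` A \<inter> space M)) \<omega> \<partial>M)"
    by (rule S.real_cond_exp_intA[OF _ C]) (simp add: integrable_real_indicator less_top[symmetric])
  also have "\<dots> = (\<integral>\<omega>. indicator C \<omega> * measure (P (X i \<omega>)) A \<partial>M)"
    unfolding set_lebesgue_integral_def using cond_exp_step[OF i A] A
    by (intro integral_cong_AE) (auto elim!: eventually_mono)
  finally show ?thesis .
qed

text \<open>Induction over time: with the whole space as past event, \<open>set_step\<close> says
  that the next law is the current one bound to \<open>P\<close>, and \<pi> is invariant.\<close>

lemma distr_X: "1 \<le> i \<Longrightarrow> i \<le> n \<Longrightarrow> distr M borel (X i) = \<pi>"
proof (induction i)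
  case (Suc i)
  show ?case
  proof (cases "i = 0")
    case True
    then show ?thesis using chain by (simp add: markov_chain_def)
  next
    case False
    then have i: "1 \<le> i" "i < n" using Suc.prems by auto
    have IH: "distr M borel (X i) = \<pi>" using Suc i by simp
    have [measurable]: "X i \<in> M \<rightarrow>\<^sub>M borel" "X (Suc i) \<in> M \<rightarrow>\<^sub>M borel" using i by simp_all
    show ?thesis
    proof (rule measure_eqI)
      fix A assume "A \<in> sets (distr M borel (X (Suc i)))"
      then have A [measurable]: "A \<in> sets borel" by simp
      have sp: "space M \<in> sets (past_algebra M X i)"
        using sets.top[of "past_algebra M X i"] by (simp add: past_algebra_def)
      have "measure M (X (Suc i) -` A \<inter> space M) = (\<integral>\<omega>. indicator (space M) \<omega> * measure (P (X i \<omega>)) A \<partial>M)"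
        using set_step[OF i A sp] by (simp add: Int_absorb1)
      also have "\<dots> = (\<integral>\<omega>. measure (P (X i \<omega>)) A \<partial>M)"
        by (intro Bochner_Integration.integral_cong) auto
      also have "\<dots> = (\<integral>x. measure (P x) A \<partial>\<pi>)"
        unfolding IH[symmetric] by (subst integral_distr) auto
      also have "ennreal (\<integral>x. measure (P x) A \<partial>\<pi>) = (\<integral>\<^sup>+x. ennreal (measure (P x) A) \<partial>\<pi>)"
        by (intro nn_integral_eq_integral[symmetric] integrable_const_bound[of _ 1])
          (auto simp: prob_space.prob_le_1[OF prob_space_P])
      also have "\<dots> = (\<integral>\<^sup>+x. emeasure (P x) A \<partial>\<pi>)"
        using finite_measure.emeasure_eq_measure[OF prob_space.finite_measure[OF prob_space_P]] by simp
      also have "\<dots> = emeasure (\<pi> \<bind> P) A"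
        using P_\<pi> by (intro emeasure_bind[symmetric]) auto
      finally show "emeasure (distr M borel (X (Suc i))) A = emeasure \<pi> A"
        by (simp add: emeasure_distr bind_\<pi> chain.emeasure_eq_measure)
    qed simp
  qed
qed simp

lemma integral_X:
  fixes f :: "'a \<Rightarrow> 'c::{banach, second_countable_topology}"
  assumes "1 \<le> i" "i \<le> n" "f \<in> borel_measurable borel"
  shows "(\<integral>\<omega>. f (X i \<omega>) \<partial>M) = (\<integral>x. f x \<partial>\<pi>)"
  unfolding distr_X[OF assms(1,2), symmetric] using assms by (subst integral_distr) auto

lemma integrable_X:
  fixes f :: "'a \<Rightarrow> 'c::{banach, second_countable_topology}"
  assumes "1 \<le> i" "i \<le> n" "integrable \<pi> f"
  shows "integrable M (\<lambda>\<omega>. f (X i \<omega>))"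
  using assms integrable_distr[OF X_measurable[OF assms(1,2)], of f] by (simp add: distr_X)

lemma L2_X:
  fixes f :: "'a \<Rightarrow> real"
  assumes "1 \<le> i" "i \<le> n" "f \<in> L2 \<pi>"
  shows "(\<lambda>\<omega>. f (X i \<omega>)) \<in> L2 M"
  using assms integrable_X[OF assms(1,2), of "\<lambda>x. (norm (f x))\<^sup>2"]
    measurable_compose[OF X_measurable[OF assms(1,2)], of f borel] by (simp add: L2_def)

lemma integrable_X_mult:
  fixes f g :: "'a \<Rightarrow> real"
  assumes "1 \<le> i" "i \<le> n" "f \<in> L2 \<pi>" "1 \<le> j" "j \<le> n" "g \<in> L2 \<pi>"
  shows "integrable M (\<lambda>\<omega>. f (X i \<omega>) * g (X j \<omega>))"
proof -
  have "(\<lambda>\<omega>. complex_of_real (f (X i \<omega>))) \<in> L2 M" "(\<lambda>\<omega>. complex_of_real (g (X j \<omega>))) \<in> L2 M"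
    using L2_X assms by (auto simp: L2_of_real)
  from integrable_Re[OF L2_integrable_inner[OF this]] show ?thesis by simp
qed

text \<open>The passage from indicators to integrable \<open>f\<close> compares measures. For each
  past event C, the law of the next state restricted to C is the law of the current state restricted
  to C, bound to \<open>P\<close>; integrating \<open>f\<close> against both sides gives the
  defining property of the conditional expectation.\<close>

lemma cond_exp_integrable_step:
  fixes f :: "'a \<Rightarrow> real"
  assumes i: "1 \<le> i" "i < n" and f: "integrable \<pi> f"
  shows "AE \<omega> in M. real_cond_exp M (past_algebra M X i) (\<lambda>\<omega>. f (X (Suc i) \<omega>)) \<omega> = (\<integral>y. f y \<partial>P (X i \<omega>))"
proof -
  interpret S: finite_measure_subalgebra M "past_algebra M X i"
    using i by (intro finite_measure_subalgebra_past) simp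
  have Xm [measurable]: "X i \<in> M \<rightarrow>\<^sub>M borel" "X (Suc i) \<in> M \<rightarrow>\<^sub>M borel" using i by simp_all
  have fm [measurable]: "f \<in> borel_measurable borel"
    using borel_measurable_integrable[OF f] by simp
  have Pf [measurable]: "(\<lambda>x. \<integral>y. f y \<partial>P x) \<in> borel_measurable borel"
    by (rule measurable_compose[OF P_borel integral_measurable_subprob_algebra]) measurable
  have intf: "integrable M (\<lambda>\<omega>. f (X (Suc i) \<omega>))" using i f by (intro integrable_X) auto
  have intPf: "integrable M (\<lambda>\<omega>. \<integral>y. f y \<partial>P (X i \<omega>))"
    using i by (intro integrable_X[of i "\<lambda>x. \<integral>y. f y \<partial>P x"] integrable_P f) auto
  show ?thesis
  proof (rule S.real_cond_exp_charact[OF _ intf intPf])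
    show "(\<lambda>\<omega>. \<integral>y. f y \<partial>P (X i \<omega>)) \<in> borel_measurable (past_algebra M X i)"
      using i by (intro measurable_compose[OF X_past_measurable Pf]) auto
    fix C assume C: "C \<in> sets (past_algebra M X i)"
    have Cm [measurable]: "C \<in> sets M"
      using C subalgebra_past[of i] i by (auto simp: subalgebra_def)
    \<comment> \<open>\<open>D\<close> is the probability restricted to C, a finite measure that is
      in general not normalized.\<close>
    define D where "D = density M (\<lambda>\<omega>. ennreal (indicator C \<omega>))"
    have setsD [measurable_cong]: "sets D = sets M" and spD: "space D = space M" by (simp_all add: D_def)
    define N where "N = distr D borel (X i)"
    have setsN [simp, measurable_cong]: "sets N = sets borel" and spaceN: "space N \<noteq> {}"
      by (simp_all add: N_def)
    have KN: "P \<in> N \<rightarrow>\<^sub>M subprob_algebra borel"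
      using P_borel by (simp add: measurable_cong_sets[OF setsN refl])
    have XD [measurable]: "X i \<in> D \<rightarrow>\<^sub>M borel" "X (Suc i) \<in> D \<rightarrow>\<^sub>M borel" by measurable
    have eq: "distr D borel (X (Suc i)) = N \<bind> P"
    proof (rule measure_eqI)
      show "sets (distr D borel (X (Suc i))) = sets (N \<bind> P)"
        by (simp add: sets_bind_measurable[OF KN spaceN])
      fix A assume "A \<in> sets (distr D borel (X (Suc i)))"
      then have A [measurable]: "A \<in> sets borel" by simp
      have B [measurable]: "X (Suc i) -` A \<inter> space M \<in> sets M" by measurable
      have "emeasure (distr D borel (X (Suc i))) A = emeasure D (X (Suc i) -` A \<inter> space M)"
        by (simp add: emeasure_distr spD)
      also have "\<dots> = (\<integral>\<^sup>+\<omega>. indicator (C \<inter> (X (Suc i) -` A \<inter> space M)) \<omega> \<partial>M)"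
        unfolding D_def by (subst emeasure_density, simp, simp, rule nn_integral_cong)
          (auto split: split_indicator)
      also have "\<dots> = ennreal (measure M (C \<inter> (X (Suc i) -` A \<inter> space M)))"
        by (simp add: chain.emeasure_eq_measure)
      also have "\<dots> = ennreal (\<integral>\<omega>. indicator C \<omega> * measure (P (X i \<omega>)) A \<partial>M)"
        by (simp add: set_step[OF i A C])
      also have "\<dots> = (\<integral>\<^sup>+\<omega>. ennreal (indicator C \<omega> * measure (P (X i \<omega>)) A) \<partial>M)"
        by (intro nn_integral_eq_integral[symmetric] chain.integrable_const_bound[of _ 1])
          (auto simp: prob_space.prob_le_1[OF prob_space_P] split: split_indicator)
      also have "\<dots> = (\<integral>\<^sup>+\<omega>. ennreal (measure (P (X i \<omega>)) A) \<partial>D)"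
        unfolding D_def by (subst nn_integral_density) (auto simp: ennreal_mult)
      also have "\<dots> = (\<integral>\<^sup>+x. ennreal (measure (P x) A) \<partial>N)"
        unfolding N_def by (subst nn_integral_distr) auto
      also have "\<dots> = (\<integral>\<^sup>+x. emeasure (P x) A \<partial>N)"
        using finite_measure.emeasure_eq_measure[OF prob_space.finite_measure[OF prob_space_P]] by simp
      also have "\<dots> = emeasure (N \<bind> P) A"
        using KN spaceN by (intro emeasure_bind[symmetric]) auto
      finally show "emeasure (distr D borel (X (Suc i))) A = emeasure (N \<bind> P) A" .
    qed
    have intD: "integrable D (\<lambda>\<omega>. f (X (Suc i) \<omega>))"
      using integrable_mult_indicator[OF Cm intf] unfolding D_def by (subst integrable_density) auto
    have "integrable (N \<bind> P) f"
      unfolding eq[symmetric] using intD by (subst integrable_distr_eq) auto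
    then have "(\<integral>y. f y \<partial>(N \<bind> P)) = (\<integral>x. \<integral>y. f y \<partial>P x \<partial>N)"
      by (rule integral_bind_kernel_real[OF KN spaceN])
    moreover have "(\<integral>y. f y \<partial>(N \<bind> P)) = (\<integral>\<omega>\<in>C. f (X (Suc i) \<omega>) \<partial>M)"
      unfolding eq[symmetric] set_lebesgue_integral_def
      by (subst integral_distr) (auto simp: D_def integral_density)
    moreover have "(\<integral>x. \<integral>y. f y \<partial>P x \<partial>N) = (\<integral>\<omega>\<in>C. (\<integral>y. f y \<partial>P (X i \<omega>)) \<partial>M)"
      unfolding N_def set_lebesgue_integral_def
      by (subst integral_distr) (auto simp: D_def integral_density)
    ultimately show "(\<integral>\<omega>\<in>C. f (X (Suc i) \<omega>) \<partial>M) = (\<integral>\<omega>\<in>C. (\<integral>y. f y \<partial>P (X i \<omega>)) \<partial>M)"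
      by simp
  qed
qed

lemma real_P_L2:
  fixes f :: "'a \<Rightarrow> real"
  assumes f: "f \<in> L2 \<pi>" shows "(\<lambda>x. \<integral>y. f y \<partial>P x) \<in> L2 \<pi>"
  using markov_op_L2[of "\<lambda>x. complex_of_real (f x)"] f
  by (simp add: L2_of_real markov_op_def[abs_def])

text \<open>Conditioning on the past up to time i + d moves the later variable one step back and
  replaces \<open>f\<close> by P f. The induction therefore runs over all \<open>f\<close>.\<close>

lemma expectation_mult:
  fixes f g :: "'a \<Rightarrow> real"
  assumes "1 \<le> i" "i + d \<le> n" and g: "g \<in> L2 \<pi>" and f: "f \<in> L2 \<pi>"
  shows "(\<integral>\<omega>. g (X i \<omega>) * f (X (i + d) \<omega>) \<partial>M)
    = Re (l2_inner \<pi> (\<lambda>x. complex_of_real (g x)) ((markov_op P ^^ d) (\<lambda>x. complex_of_real (f x))))"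
  using assms(2) f
proof (induction d arbitrary: f)
  case 0
  have m [measurable]: "g \<in> borel_measurable borel" "f \<in> borel_measurable borel"
    using g 0 by (simp_all add: L2_def)
  have "(\<integral>\<omega>. g (X i \<omega>) * f (X i \<omega>) \<partial>M) = (\<integral>x. g x * f x \<partial>\<pi>)"
    using integral_X[of i "\<lambda>x. g x * f x"] assms(1) 0 by simp
  then show ?case by (simp add: l2_inner_def flip: of_real_mult)
next
  case (Suc d)
  interpret S: finite_measure_subalgebra M "past_algebra M X (i + d)"
    using Suc.prems by (intro finite_measure_subalgebra_past) simp
  have fint: "integrable \<pi> f" using L2_integrable[OF Suc.prems(2)] .
  have m [measurable]: "g \<in> borel_measurable borel" "f \<in> borel_measurable borel"
    using g Suc by (simp_all add: L2_def)
  have Xm [measurable]: "X i \<in> M \<rightarrow>\<^sub>M borel" "X (i + d) \<in> M \<rightarrow>\<^sub>M borel" "X (Suc (i + d)) \<in> M \<rightarrow>\<^sub>M borel"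
    using assms(1) Suc.prems by simp_all
  have Pf [measurable]: "(\<lambda>x. \<integral>y. f y \<partial>P x) \<in> borel_measurable borel"
    by (rule measurable_compose[OF P_borel integral_measurable_subprob_algebra]) measurable
  have "(\<integral>\<omega>. g (X i \<omega>) * f (X (Suc (i + d)) \<omega>) \<partial>M)
     = (\<integral>\<omega>. g (X i \<omega>) * real_cond_exp M (past_algebra M X (i + d)) (\<lambda>\<omega>. f (X (Suc (i + d)) \<omega>)) \<omega> \<partial>M)"
  proof (rule S.real_cond_exp_intg(2)[symmetric])
    show "integrable M (\<lambda>\<omega>. g (X i \<omega>) * f (X (Suc (i + d)) \<omega>))"
      using assms(1) Suc.prems g by (intro integrable_X_mult) auto
    show "(\<lambda>\<omega>. g (X i \<omega>)) \<in> borel_measurable (past_algebra M X (i + d))"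
      using assms(1) Suc.prems by (intro measurable_compose[OF X_past_measurable m(1)]) auto
  qed measurable
  also have "\<dots> = (\<integral>\<omega>. g (X i \<omega>) * (\<integral>y. f y \<partial>P (X (i + d) \<omega>)) \<partial>M)"
  proof (rule integral_cong_AE)
    have "AE \<omega> in M. real_cond_exp M (past_algebra M X (i + d)) (\<lambda>\<omega>. f (X (Suc (i + d)) \<omega>)) \<omega>
        = (\<integral>y. f y \<partial>P (X (i + d) \<omega>))"
      using assms(1) Suc.prems by (intro cond_exp_integrable_step fint) auto
    then show "AE \<omega> in M. g (X i \<omega>) * real_cond_exp M (past_algebra M X (i + d)) (\<lambda>\<omega>. f (X (Suc (i + d)) \<omega>)) \<omega>
        = g (X i \<omega>) * (\<integral>y. f y \<partial>P (X (i + d) \<omega>))"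
      by eventually_elim simp
  qed measurable
  also have "\<dots> = Re (l2_inner \<pi> (\<lambda>x. complex_of_real (g x))
      ((markov_op P ^^ d) (\<lambda>x. complex_of_real (\<integral>y. f y \<partial>P x))))"
    using Suc.prems by (intro Suc.IH real_P_L2) auto
  also have "(\<lambda>x. complex_of_real (\<integral>y. f y \<partial>P x)) = markov_op P (\<lambda>x. complex_of_real (f x))"
    by (simp add: markov_op_def fun_eq_iff)
  finally show ?case by (simp add: funpow_swap1)
qed

end

section \<open>Variance of additive functionals\<close>

text \<open>With truncated subtraction \<open>(i - j) + (j - i)\<close> is the distance of i and j.
  The added row and column each contribute r 1, ..., r m, and the corner contributes r 0.\<close>

lemma sum_pairs_Suc:
  fixes r :: "nat \<Rightarrow> real"
  shows "(\<Sum>i=1..Suc m. \<Sum>j=1..Suc m. r ((i - j) + (j - i)))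
    = (\<Sum>i=1..m. \<Sum>j=1..m. r ((i - j) + (j - i))) + 2 * (\<Sum>d=1..m. r d) + r 0"
proof -
  have "(\<Sum>i=1..m. r (Suc m - i)) = (\<Sum>d=1..m. r d)"
    using sum.atLeastAtMost_rev[of r 1 m] by simp
  moreover have "(\<Sum>i=1..m. r ((i - Suc m) + (Suc m - i))) = (\<Sum>i=1..m. r (Suc m - i))"
    by (intro sum.cong) auto
  moreover have "(\<Sum>i=1..m. r ((Suc m - i) + (i - Suc m))) = (\<Sum>i=1..m. r (Suc m - i))"
    by (intro sum.cong) auto
  ultimately show ?thesis by (simp add: sum.distrib)
qed

text \<open>As \<open>r\<close> is a second difference of \<open>G\<close>, the increment found in
  \<open>sum_pairs_Suc\<close> is 2 (H 1 - H (m+1)) + r 0 = (2 H 0 - r 0) - 2 H (m+1). The first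
  part is the constant slope, and the second telescopes through \<open>G\<close>.\<close>

lemma sum_pairs_telescope:
  fixes r H G :: "nat \<Rightarrow> real"
  assumes r: "\<And>d. r d = H d - H (Suc d)" and H: "\<And>d. H d = G d - G (Suc d)"
  shows "(\<Sum>i=1..m. \<Sum>j=1..m. r ((i - j) + (j - i))) = real m * (2 * H 0 - r 0) - 2 * (G 1 - G (Suc m))"
proof (induction m)
  case (Suc m)
  have tele: "(\<Sum>d=1..m. r d) = H 1 - H (Suc m)" for m
    by (induction m) (auto simp: r)
  show ?case
    unfolding sum_pairs_Suc Suc tele r[of 0] H[of "Suc m"] by (simp add: algebra_simps)
qed simp

text \<open>Each distance from i occurs at most once on either side, which is the origin of the
  factor 2. The two ranges overlap in i, so distance 0 is counted twice.\<close>

lemma sum_distance_le: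
  fixes c :: "nat \<Rightarrow> real"
  assumes c: "\<And>n. 0 \<le> c n" "summable c"
  shows "(\<Sum>j=1..m. c ((i - j) + (j - i))) \<le> 2 * suminf c"
proof -
  have "(\<Sum>j=1..m. c ((i - j) + (j - i))) \<le> (\<Sum>j\<in>{..i} \<union> {i..i+m}. c ((i - j) + (j - i)))"
    using c by (intro sum_mono2) auto
  also have "\<dots> \<le> (\<Sum>j\<in>{..i}. c ((i - j) + (j - i))) + (\<Sum>j\<in>{i..i+m}. c ((i - j) + (j - i)))"
    using c by (subst sum_Un) (auto intro: sum_nonneg)
  also have "(\<Sum>j\<in>{..i}. c ((i - j) + (j - i))) = (\<Sum>j\<in>(\<lambda>j. i - j) ` {..i}. c j)"
    by (subst sum.reindex) (auto simp: inj_on_def)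
  also have "\<dots> \<le> suminf c" using c by (intro sum_le_suminf) auto
  also have "(\<Sum>j\<in>{i..i+m}. c ((i - j) + (j - i))) = (\<Sum>j\<in>(\<lambda>j. j - i) ` {i..i+m}. c j)"
    by (subst sum.reindex) (auto simp: inj_on_def)
  also have "\<dots> \<le> suminf c" using c by (intro sum_le_suminf) auto
  finally show ?thesis by simp
qed

context stationary_kernel
begin

lemma variance_eq_norm:
  fixes f :: "'a \<Rightarrow> real"
  shows "variance f = (l2_norm \<pi> (\<lambda>x. complex_of_real (f x - expectation f)))\<^sup>2"
  by (simp add: l2_norm_power2 del: of_real_diff)

lemma centered_real:
  fixes f :: "'a \<Rightarrow> real"
  assumes f: "f \<in> L2 \<pi>"
  shows centered_real_L2: "(\<lambda>x. complex_of_real (f x - expectation f)) \<in> L2 \<pi>"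
    and centered_real_integral: "(\<integral>x. complex_of_real (f x - expectation f) \<partial>\<pi>) = 0"
proof -
  show "(\<lambda>x. complex_of_real (f x - expectation f)) \<in> L2 \<pi>"
    unfolding L2_of_real using f by auto
  have "(\<integral>x. complex_of_real (f x - expectation f) \<partial>\<pi>) = complex_of_real (\<integral>x. f x - expectation f \<partial>\<pi>)"
    by (rule integral_complex_of_real)
  also have "(\<integral>x. f x - expectation f \<partial>\<pi>) = 0" using L2_integrable[OF f] by simp
  finally show "(\<integral>x. complex_of_real (f x - expectation f) \<partial>\<pi>) = 0" by simp
qed

end

context stationary_chain
begin

lemma variance_X:
  fixes f :: "'a \<Rightarrow> real"
  assumes "1 \<le> i" "i \<le> n" "f \<in> L2 \<pi>"
  shows "chain.variance (\<lambda>\<omega>. f (X i \<omega>)) = variance f"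
proof -
  have [measurable]: "f \<in> borel_measurable borel" using assms by (simp add: L2_def)
  show ?thesis
    using integral_X[OF assms(1,2), of f] integral_X[OF assms(1,2), of "\<lambda>x. (f x - expectation f)\<^sup>2"] by simp
qed

lemma variance_sum_X:
  fixes f :: "nat \<Rightarrow> 'a \<Rightarrow> real"
  assumes f: "\<And>i. 1 \<le> i \<Longrightarrow> i \<le> n \<Longrightarrow> f i \<in> L2 \<pi>"
  shows "chain.variance (\<lambda>\<omega>. \<Sum>i=1..n. f i (X i \<omega>))
    = (\<Sum>i=1..n. \<Sum>j=1..n. \<integral>\<omega>. (f i (X i \<omega>) - expectation (f i)) * (f j (X j \<omega>) - expectation (f j)) \<partial>M)"
proof -
  have L: "(\<lambda>x. f i x - expectation (f i)) \<in> L2 \<pi>" if "1 \<le> i" "i \<le> n" for i using f[OF that] by auto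
  have "chain.expectation (\<lambda>\<omega>. \<Sum>i=1..n. f i (X i \<omega>)) = (\<Sum>i=1..n. chain.expectation (\<lambda>\<omega>. f i (X i \<omega>)))"
    by (rule Bochner_Integration.integral_sum) (use f integrable_X L2_integrable in auto)
  also have "\<dots> = (\<Sum>i=1..n. expectation (f i))"
    by (intro sum.cong refl integral_X) (use f in \<open>auto simp: L2_def\<close>)
  finally have "chain.variance (\<lambda>\<omega>. \<Sum>i=1..n. f i (X i \<omega>))
      = (\<integral>\<omega>. (\<Sum>i=1..n. f i (X i \<omega>) - expectation (f i))\<^sup>2 \<partial>M)"
    by (simp add: sum_subtractf)
  also have "\<dots> = (\<integral>\<omega>. (\<Sum>i=1..n. \<Sum>j=1..n. (f i (X i \<omega>) - expectation (f i)) * (f j (X j \<omega>) - expectation (f j))) \<partial>M)"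
    by (simp add: power2_eq_square sum_product)
  also have "\<dots> = (\<Sum>i=1..n. \<Sum>j=1..n. \<integral>\<omega>. (f i (X i \<omega>) - expectation (f i)) * (f j (X j \<omega>) - expectation (f j)) \<partial>M)"
  proof -
    have int: "integrable M (\<lambda>\<omega>. (f i (X i \<omega>) - expectation (f i)) * (f j (X j \<omega>) - expectation (f j)))"
      if "i \<in> {1..n}" "j \<in> {1..n}" for i j
      using integrable_X_mult[OF _ _ L _ _ L, of i i j j] that by auto
    show ?thesis
      by (subst Bochner_Integration.integral_sum, intro Bochner_Integration.integrable_sum int, assumption+)
        (intro sum.cong refl Bochner_Integration.integral_sum int)
  qed
  finally show ?thesis .
qed

lemma covariance_X:
  fixes f g :: "'a \<Rightarrow> real"
  assumes "1 \<le> i" "i \<le> j" "j \<le> n" and f: "f \<in> L2 \<pi>" and g: "g \<in> L2 \<pi>"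
  shows "(\<integral>\<omega>. (f (X i \<omega>) - expectation f) * (g (X j \<omega>) - expectation g) \<partial>M)
    = Re (l2_inner \<pi> (\<lambda>x. complex_of_real (f x - expectation f))
        ((markov_op P ^^ (j - i)) (\<lambda>x. complex_of_real (g x - expectation g))))"
  using assms expectation_mult[of i "j - i" "\<lambda>x. f x - expectation f" "\<lambda>x. g x - expectation g"] by auto

context
  fixes c :: "nat \<Rightarrow> real"
  assumes c: "\<And>n. 0 \<le> c n" "c 0 = 1" "summable c"
    and decay: "\<And>f n. f \<in> L2 \<pi> \<Longrightarrow> (\<integral>x. f x \<partial>\<pi>) = 0 \<Longrightarrow>
      l2_norm \<pi> ((markov_op P ^^ n) f) \<le> c n * l2_norm \<pi> f"
begin

lemma covariance_X_le:
  fixes f g :: "'a \<Rightarrow> real"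
  assumes ij: "1 \<le> i" "i \<le> j" "j \<le> n" and f: "f \<in> L2 \<pi>" and g: "g \<in> L2 \<pi>"
  shows "(\<integral>\<omega>. (f (X i \<omega>) - expectation f) * (g (X j \<omega>) - expectation g) \<partial>M)
    \<le> c (j - i) * ((variance f + variance g) / 2)"
proof -
  define F G where "F = (\<lambda>x. complex_of_real (f x - expectation f))"
    and "G = (\<lambda>x. complex_of_real (g x - expectation g))"
  have F: "F \<in> L2 \<pi>" and G: "G \<in> L2 \<pi>" and G0: "(\<integral>x. G x \<partial>\<pi>) = 0"
    unfolding F_def G_def using centered_real_L2[OF f] centered_real_L2[OF g] centered_real_integral[OF g] by auto
  have "(\<integral>\<omega>. (f (X i \<omega>) - expectation f) * (g (X j \<omega>) - expectation g) \<partial>M)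
      \<le> cmod (l2_inner \<pi> F ((markov_op P ^^ (j - i)) G))"
    unfolding covariance_X[OF ij f g] F_def G_def by (rule complex_Re_le_cmod)
  also have "\<dots> \<le> l2_norm \<pi> F * l2_norm \<pi> ((markov_op P ^^ (j - i)) G)"
    by (intro l2_Cauchy_Schwarz F funpow_markov_op_L2 G)
  also have "\<dots> \<le> l2_norm \<pi> F * (c (j - i) * l2_norm \<pi> G)"
    by (intro mult_left_mono decay G G0) simp
  also have "\<dots> = c (j - i) * (l2_norm \<pi> F * l2_norm \<pi> G)" by simp
  also have "\<dots> \<le> c (j - i) * (((l2_norm \<pi> F)\<^sup>2 + (l2_norm \<pi> G)\<^sup>2) / 2)"
    using sum_squares_bound[of "l2_norm \<pi> F" "l2_norm \<pi> G"] by (intro mult_left_mono c) simp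
  finally show ?thesis unfolding variance_eq_norm F_def G_def .
qed

text \<open>Schur test: covariances are dominated by a symmetric matrix with row sums at most
  \<open>2 * suminf c\<close>, and the mean of two variances in \<open>covariance_X_le\<close>
  distributes each entry evenly over its row and column.\<close>

lemma variance_sum_le:
  fixes f :: "nat \<Rightarrow> 'a \<Rightarrow> real"
  assumes f: "\<And>i. 1 \<le> i \<Longrightarrow> i \<le> n \<Longrightarrow> f i \<in> L2 \<pi>"
  shows "chain.variance (\<lambda>\<omega>. \<Sum>i=1..n. f i (X i \<omega>)) \<le> 2 * suminf c * (\<Sum>i=1..n. variance (f i))"
proof -
  define V where "V = (\<lambda>i. variance (f i))"
  have V0: "0 \<le> V i" for i by (simp add: V_def)
  define d where "d = (\<lambda>i j. c ((i - j) + (j - i)))"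
  have d_sym: "d i j = d j i" for i j by (simp add: d_def add.commute)
  have "chain.variance (\<lambda>\<omega>. \<Sum>i=1..n. f i (X i \<omega>))
      = (\<Sum>i=1..n. \<Sum>j=1..n. \<integral>\<omega>. (f i (X i \<omega>) - expectation (f i)) * (f j (X j \<omega>) - expectation (f j)) \<partial>M)"
    by (rule variance_sum_X) (rule f)
  also have "\<dots> \<le> (\<Sum>i=1..n. \<Sum>j=1..n. d i j * ((V i + V j) / 2))"
  proof (intro sum_mono)
    fix i j assume ij: "i \<in> {1..n}" "j \<in> {1..n}"
    show "(\<integral>\<omega>. (f i (X i \<omega>) - expectation (f i)) * (f j (X j \<omega>) - expectation (f j)) \<partial>M)
        \<le> d i j * ((V i + V j) / 2)"
    proof (cases "i \<le> j")
      case True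
      then show ?thesis using covariance_X_le[of i j "f i" "f j"] ij f by (simp add: d_def V_def)
    next
      case False
      then have "(\<integral>\<omega>. (f j (X j \<omega>) - expectation (f j)) * (f i (X i \<omega>) - expectation (f i)) \<partial>M)
          \<le> d i j * ((V i + V j) / 2)"
        using covariance_X_le[of j i "f j" "f i"] ij f by (simp add: d_def V_def add.commute)
      then show ?thesis by (simp add: mult.commute)
    qed
  qed
  also have "\<dots> = (\<Sum>i=1..n. \<Sum>j=1..n. d i j * V i) / 2 + (\<Sum>i=1..n. \<Sum>j=1..n. d i j * V j) / 2"
    by (simp add: sum.distrib[symmetric] sum_divide_distrib distrib_left add_divide_distrib)
  also have "(\<Sum>i=1..n. \<Sum>j=1..n. d i j * V j) = (\<Sum>i=1..n. \<Sum>j=1..n. d i j * V i)"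
    \<comment> \<open>Symmetry of \<open>d\<close> makes the column half equal to the row
      half.\<close>
    by (subst sum.swap) (simp add: d_sym)
  also have "(\<Sum>i=1..n. \<Sum>j=1..n. d i j * V i) / 2 + (\<Sum>i=1..n. \<Sum>j=1..n. d i j * V i) / 2
      = (\<Sum>i=1..n. (\<Sum>j=1..n. d i j) * V i)"
    by (simp add: sum_distrib_right)
  also have "\<dots> \<le> (\<Sum>i=1..n. (2 * suminf c) * V i)"
    unfolding d_def by (intro sum_mono mult_right_mono sum_distance_le c V0)
  finally show ?thesis by (simp add: V_def sum_distrib_left)
qed

lemma asymptotic_variance_error:
  fixes f :: "'a \<Rightarrow> real"
  assumes f: "f \<in> L2 \<pi>"
  shows "\<bar>chain.variance (\<lambda>\<omega>. \<Sum>i=1..n. f (X i \<omega>)) - real n * asymptotic_variance P \<pi> f\<bar>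
    \<le> 4 * (suminf c)\<^sup>2 * variance f"
proof -
  define F where "F = (\<lambda>x. complex_of_real (f x - expectation f))"
  have F: "F \<in> L2 \<pi>" and F0: "(\<integral>x. F x \<partial>\<pi>) = 0"
    unfolding F_def using centered_real_L2[OF f] centered_real_integral[OF f] by auto
  define R where "R = l2_inverse \<pi> (\<lambda>g x. g x - (markov_op P g x - mean_op \<pi> g x))"
  have ex: "\<exists>S. l2_is_inverse \<pi> (\<lambda>g x. g x - (markov_op P g x - mean_op \<pi> g x)) S"
    by (rule centered_resolvent_exists[OF c]) (rule decay)
  have R: "l2_is_inverse \<pi> (\<lambda>g x. g x - (markov_op P g x - mean_op \<pi> g x)) R"
    unfolding R_def l2_inverse_def by (rule someI_ex[OF ex])
  have res: "R u \<in> L2 \<pi>" "(\<integral>x. R u x \<partial>\<pi>) = 0" "AE x in \<pi>. u x = R u x - markov_op P (R u) x"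
    "l2_norm \<pi> (R u) \<le> suminf c * l2_norm \<pi> u" if u: "u \<in> L2 \<pi>" "(\<integral>x. u x \<partial>\<pi>) = 0" for u
    by (rule centered_resolvent_L2[OF c(1,3) _ R u] centered_resolvent_centered[OF c(1,3) _ R u]
        centered_resolvent_Poisson[OF c(1,3) _ R u] centered_resolvent_norm_le[OF c(1,3) _ R u];
        erule (1) decay)+
  define h g where "h = R F" and "g = R h"
  have h: "h \<in> L2 \<pi>" "(\<integral>x. h x \<partial>\<pi>) = 0" and hP: "AE x in \<pi>. F x = h x - markov_op P h x"
    and hn: "l2_norm \<pi> h \<le> suminf c * l2_norm \<pi> F"
    unfolding h_def using res[OF F F0] by auto
  have g: "g \<in> L2 \<pi>" and gP: "AE x in \<pi>. h x = g x - markov_op P g x"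
    and gn: "l2_norm \<pi> g \<le> suminf c * l2_norm \<pi> h"
    unfolding g_def using res[OF h] by auto
  have c0: "0 \<le> suminf c" by (intro suminf_nonneg c)
  define I where "I = (\<lambda>u d. Re (l2_inner \<pi> F ((markov_op P ^^ d) u)))"
  \<comment> \<open>Applying P^d to a Poisson equation u = v - P v expresses the pairings of u as
    first differences of those of v. Used for (F, h) and (h, g), it makes \<open>I F\<close> a
    second difference of \<open>I g\<close>.\<close>
  have step: "I u d = I v d - I v (Suc d)"
    if u: "u \<in> L2 \<pi>" and v: "v \<in> L2 \<pi>" and eq: "AE x in \<pi>. u x = v x - markov_op P v x" for u v d
  proof -
    note op = bounded_operator_funpow[OF markov_op_bounded, of d]
    have "AE x in \<pi>. (markov_op P ^^ d) u x = (markov_op P ^^ d) (\<lambda>x. v x - markov_op P v x) x"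
      by (rule bounded_operator_cong[OF op u _ eq]) (simp add: v markov_op_L2)
    moreover have "AE x in \<pi>. (markov_op P ^^ d) (\<lambda>x. v x - markov_op P v x) x
        = (markov_op P ^^ d) v x - (markov_op P ^^ d) (markov_op P v) x"
      by (rule bounded_operator_diff[OF op v markov_op_L2[OF v]])
    ultimately have "AE x in \<pi>. (markov_op P ^^ d) u x
        = (markov_op P ^^ d) v x - (markov_op P ^^ d) (markov_op P v) x"
      by eventually_elim simp
    then have "l2_inner \<pi> F ((markov_op P ^^ d) u)
        = l2_inner \<pi> F (\<lambda>x. (markov_op P ^^ d) v x - (markov_op P ^^ d) (markov_op P v) x)"
      by (intro l2_inner_cong_AE) (simp_all add: F u v funpow_markov_op_L2 markov_op_L2)
    then show ?thesis
      by (simp add: I_def F v funpow_markov_op_L2 markov_op_L2 funpow_swap1)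
  qed
  have var: "chain.variance (\<lambda>\<omega>. \<Sum>i=1..n. f (X i \<omega>))
      = (\<Sum>i=1..n. \<Sum>j=1..n. I F ((i - j) + (j - i)))"
  proof (subst variance_sum_X, rule f, intro sum.cong refl)
    fix i j assume ij: "i \<in> {1..n}" "j \<in> {1..n}"
    show "(\<integral>\<omega>. (f (X i \<omega>) - expectation f) * (f (X j \<omega>) - expectation f) \<partial>M) = I F ((i - j) + (j - i))"
    proof (cases "i \<le> j")
      case True
      then show ?thesis using covariance_X[of i j f f] ij f by (simp add: I_def F_def)
    next
      case False
      then have "(\<integral>\<omega>. (f (X j \<omega>) - expectation f) * (f (X i \<omega>) - expectation f) \<partial>M) = I F ((i - j) + (j - i))"
        using covariance_X[of j i f f] ij f by (simp add: I_def F_def)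
      then show ?thesis by (simp add: mult.commute)
    qed
  qed
  have "asymptotic_variance P \<pi> f = Re (l2_inner \<pi> F (\<lambda>x. 2 * h x - F x))"
    by (simp add: asymptotic_variance_def Let_def F_def R_def h_def)
  also have "\<dots> = 2 * I h 0 - I F 0" using F h by (simp add: I_def)
  finally have av: "asymptotic_variance P \<pi> f = 2 * I h 0 - I F 0" .
  \<comment> \<open>The asymptotic variance 2 \<langle>F, h\<rangle> - \<langle>F, F\<rangle> is
    exactly the slope in \<open>sum_pairs_telescope\<close>, so only the two boundary terms
    remain.\<close>
  have error: "chain.variance (\<lambda>\<omega>. \<Sum>i=1..n. f (X i \<omega>)) - real n * asymptotic_variance P \<pi> f
      = - 2 * (I g 1 - I g (Suc n))"
    unfolding var av using sum_pairs_telescope[of "I F" "I h" "I g" n] step[OF F h(1) hP] step[OF h(1) g gP]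
    by simp
  \<comment> \<open>P^d does not increase the norm, and each of the two resolvents producing
    \<open>g\<close> costs a factor \<open>suminf c\<close>.\<close>
  have "\<bar>I g d\<bar> \<le> (suminf c)\<^sup>2 * variance f" for d
  proof -
    have "\<bar>I g d\<bar> \<le> cmod (l2_inner \<pi> F ((markov_op P ^^ d) g))"
      unfolding I_def by (rule abs_Re_le_cmod)
    also have "\<dots> \<le> l2_norm \<pi> F * l2_norm \<pi> ((markov_op P ^^ d) g)"
      by (intro l2_Cauchy_Schwarz F funpow_markov_op_L2 g)
    also have "\<dots> \<le> l2_norm \<pi> F * l2_norm \<pi> g"
      by (intro mult_left_mono funpow_markov_op_norm_le g) simp
    also have "\<dots> \<le> l2_norm \<pi> F * (suminf c * (suminf c * l2_norm \<pi> F))"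
      using gn mult_left_mono[OF hn c0] by (intro mult_left_mono) auto
    also have "\<dots> = (suminf c)\<^sup>2 * variance f"
      unfolding variance_eq_norm F_def[symmetric] by (simp add: power2_eq_square)
    finally show ?thesis .
  qed
  moreover have "\<bar>- 2 * (a - b)\<bar> \<le> 4 * B" if "\<bar>a\<bar> \<le> B" "\<bar>b\<bar> \<le> B" for a b B :: real
    using that abs_triangle_ineq4[of a b] by (simp add: abs_mult)
  ultimately have "\<bar>- 2 * (I g 1 - I g (Suc n))\<bar> \<le> 4 * ((suminf c)\<^sup>2 * variance f)"
    by blast
  then show ?thesis unfolding error by (simp add: mult.assoc)
qed

end

end

text \<open>Decay rates exist only for x strictly below the pseudo spectral gap; continuity from the
  left reaches the gap itself. The exponent is 1 for the variance bound and 2 for the asymptotic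
  one.\<close>

lemma le_divide_of_le_below:
  fixes a b g :: real
  assumes g: "0 < g" and le: "\<And>x. 0 < x \<Longrightarrow> x < g \<Longrightarrow> a \<le> b / x ^ k"
  shows "a \<le> b / g ^ k"
proof (rule tendsto_lowerbound)
  show "((\<lambda>x. b / x ^ k) \<longlongrightarrow> b / g ^ k) (at_left g)"
    using g by (intro tendsto_intros) auto
  show "\<forall>\<^sub>F x in at_left g. a \<le> b / x ^ k"
    using eventually_at_left_real[OF g] by eventually_elim (simp add: le)
qed simp

theorem theorem3p7:
  fixes M :: "'b measure"
    and X :: "nat \<Rightarrow> 'b \<Rightarrow> 'a::polish_space"
    and P :: "'a \<Rightarrow> 'a measure"
    and \<pi> :: "'a measure"
    and n :: nat
  assumes "n \<ge> 1"
    and "markov_chain M n X P \<pi>"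
    and "stationary_dist P \<pi>"
    and "\<forall>\<mu>. stationary_dist P \<mu> \<longrightarrow> \<mu> = \<pi>"
    and "phi_irreducible P"
    and "aperiodic P \<pi>"
    and "pseudo_spectral_gap P \<pi> > 0"
  shows "(\<forall>f :: 'a \<Rightarrow> real. f \<in> L2 \<pi> \<longrightarrow>
      prob_space.variance M (\<lambda>\<omega>. \<Sum>i=1..n. f (X i \<omega>))
        \<le> 4 * real n * prob_space.variance \<pi> f / pseudo_spectral_gap P \<pi> \<and>
      \<bar>prob_space.variance M (\<lambda>\<omega>. \<Sum>i=1..n. f (X i \<omega>)) - real n * asymptotic_variance P \<pi> f\<bar>
        \<le> 16 * prob_space.variance \<pi> f / (pseudo_spectral_gap P \<pi>)\<^sup>2) \<and>
    (\<forall>f :: nat \<Rightarrow> 'a \<Rightarrow> real. (\<forall>i\<in>{1..n}. f i \<in> L2 \<pi>) \<longrightarrow>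
      prob_space.variance M (\<lambda>\<omega>. \<Sum>i=1..n. f i (X i \<omega>))
        \<le> 4 / pseudo_spectral_gap P \<pi> *
            (\<Sum>i=1..n. prob_space.variance M (\<lambda>\<omega>. f i (X i \<omega>))))"
proof -
  have "markov_kernel P" using assms(2) by (simp add: markov_chain_def)
  then interpret stationary_chain P \<pi> M n X
    using assms(2,3) by unfold_locales
  let ?\<gamma> = "pseudo_spectral_gap P \<pi>"
  have general: "chain.variance (\<lambda>\<omega>. \<Sum>i=1..n. f i (X i \<omega>)) \<le> 4 * (\<Sum>i=1..n. variance (f i)) / ?\<gamma> ^ 1"
    if f: "\<And>i. 1 \<le> i \<Longrightarrow> i \<le> n \<Longrightarrow> f i \<in> L2 \<pi>" for f :: "nat \<Rightarrow> 'a \<Rightarrow> real"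
  proof (rule le_divide_of_le_below[OF assms(7)])
    fix x assume x: "0 < x" "x < ?\<gamma>"
    obtain c :: "nat \<Rightarrow> real" where c: "\<And>n. 0 \<le> c n" "c 0 = 1" "summable c" "suminf c \<le> 2 / x"
      "\<And>f n. f \<in> L2 \<pi> \<Longrightarrow> (\<integral>x. f x \<partial>\<pi>) = 0 \<Longrightarrow> l2_norm \<pi> ((markov_op P ^^ n) f) \<le> c n * l2_norm \<pi> f"
      using pseudo_gap_decay[OF x] by metis
    have "chain.variance (\<lambda>\<omega>. \<Sum>i=1..n. f i (X i \<omega>)) \<le> 2 * suminf c * (\<Sum>i=1..n. variance (f i))"
      by (rule variance_sum_le[OF c(1,2,3)]) (erule (1) c(5) f)+
    also have "\<dots> \<le> 2 * (2 / x) * (\<Sum>i=1..n. variance (f i))"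
      using c(4) by (intro mult_right_mono sum_nonneg) auto
    finally show "chain.variance (\<lambda>\<omega>. \<Sum>i=1..n. f i (X i \<omega>)) \<le> 4 * (\<Sum>i=1..n. variance (f i)) / x ^ 1"
      by simp
  qed
  have asym: "\<bar>chain.variance (\<lambda>\<omega>. \<Sum>i=1..n. f (X i \<omega>)) - real n * asymptotic_variance P \<pi> f\<bar>
      \<le> 16 * variance f / ?\<gamma>\<^sup>2" if f: "f \<in> L2 \<pi>" for f :: "'a \<Rightarrow> real"
  proof (rule le_divide_of_le_below[OF assms(7)])
    fix x assume x: "0 < x" "x < ?\<gamma>"
    obtain c :: "nat \<Rightarrow> real" where c: "\<And>n. 0 \<le> c n" "c 0 = 1" "summable c" "suminf c \<le> 2 / x"
      "\<And>f n. f \<in> L2 \<pi> \<Longrightarrow> (\<integral>x. f x \<partial>\<pi>) = 0 \<Longrightarrow> l2_norm \<pi> ((markov_op P ^^ n) f) \<le> c n * l2_norm \<pi> f"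
      using pseudo_gap_decay[OF x] by metis
    have "\<bar>chain.variance (\<lambda>\<omega>. \<Sum>i=1..n. f (X i \<omega>)) - real n * asymptotic_variance P \<pi> f\<bar>
        \<le> 4 * (suminf c)\<^sup>2 * variance f"
      by (rule asymptotic_variance_error[OF c(1,2,3) _ f]) (erule (1) c(5))
    also have "\<dots> \<le> 4 * (2 / x)\<^sup>2 * variance f"
      using c(4) suminf_nonneg[OF c(3,1)] by (intro mult_right_mono mult_left_mono power_mono) auto
    finally show "\<bar>chain.variance (\<lambda>\<omega>. \<Sum>i=1..n. f (X i \<omega>)) - real n * asymptotic_variance P \<pi> f\<bar>
        \<le> 16 * variance f / x\<^sup>2"
      by (simp add: power_divide)
  qed
  show ?thesis
  proof (intro conjI allI impI)
    fix f :: "'a \<Rightarrow> real" assume f: "f \<in> L2 \<pi>"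
    \<comment> \<open>For a constant family the sum of the variances is n times a single
      one.\<close>
    show "chain.variance (\<lambda>\<omega>. \<Sum>i=1..n. f (X i \<omega>)) \<le> 4 * real n * variance f / ?\<gamma>"
      using general[of "\<lambda>i. f"] f by simp
    show "\<bar>chain.variance (\<lambda>\<omega>. \<Sum>i=1..n. f (X i \<omega>)) - real n * asymptotic_variance P \<pi> f\<bar>
        \<le> 16 * variance f / ?\<gamma>\<^sup>2"
      by (rule asym[OF f])
  next
    fix f :: "nat \<Rightarrow> 'a \<Rightarrow> real" assume f: "\<forall>i\<in>{1..n}. f i \<in> L2 \<pi>"
    have "(\<Sum>i=1..n. chain.variance (\<lambda>\<omega>. f i (X i \<omega>))) = (\<Sum>i=1..n. variance (f i))"
      using f by (intro sum.cong refl variance_X) auto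
    then show "chain.variance (\<lambda>\<omega>. \<Sum>i=1..n. f i (X i \<omega>))
        \<le> 4 / ?\<gamma> * (\<Sum>i=1..n. chain.variance (\<lambda>\<omega>. f i (X i \<omega>)))"
      using general[of f] f by simp
  qed
qed

end
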